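(* Let $p=1+\frac{3}{2n}$ and $f(\xi)=|\xi|^{p-1}\xi$. Let $u_0\in L^1_1(\mathbb R^n)\cap L^\infty(\mathbb R^n)$ and let $u$ be the global solution with initial datum $u_0$. Then for every $q\in[1,\infty]$ there exists $C>0$ such that $$t^{\frac n2(1-\frac1q)}\|u(t)-\mathcal A_{0,1}(t)\|_q\le Ct^{-\frac12}\quad\text{for all }t>4.$$
   Context: Let $n\ge1$, $a\in\mathbb R^n\setminus\{0\}$. $\|\cdot\|_q$ is the $L^q(\mathbb R^n)$ norm; $L^1_1=\{\varphi\in L^1: x_j\varphi\in L^1\ \forall j\}$. $G_t(x)=(4\pi t)^{-n/2}e^{-|x|^2/(4t)}$, $e^{t\Delta}\varphi=G_t*\varphi$. The global solution for $u_0\in L^1\cap L^\infty$ is the unique $u\in (C\cap L^\infty)([0,\infty);L^1)\cap(C\cap L^\infty)((0,\infty);L^\infty)$ with $u(t)=e^{t\Delta}u_0+\int_0^ta\cdot\nabla e^{(t-s)\Delta}f(u(s))ds$ for all $t>0$. $\mathcal M_0(\varphi)=\int\varphi$; $\mathcal A_0(t)=\mathcal M_0(u_0)G_t$; $\mathcal A_{0,1}(t)=\mathcal A_0(t)+\int_0^ta\cdot\nabla e^{(t-s)\Delta}f(\mathcal A_0(s))ds$. *)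

theory Defs
  imports "HOL-Analysis.Analysis" "HOL-Probability.Essential_Supremum"
begin

definition Lnorm :: "ereal \<Rightarrow> ('a::euclidean_space \<Rightarrow> real) \<Rightarrow> ereal" where
  "Lnorm q \<phi> =
     (if q = \<infinity> then esssup lebesgue (\<lambda>x. ereal \<bar>\<phi> x\<bar>)
      else (let I = (\<integral>\<^sup>+ x. ennreal (\<bar>\<phi> x\<bar> powr real_of_ereal q) \<partial>lebesgue)
            in if I = \<infinity> then \<infinity> else ereal (enn2real I powr (1 / real_of_ereal q))))"

definition memLq :: "ereal \<Rightarrow> ('a::euclidean_space \<Rightarrow> real) \<Rightarrow> bool" where
  "memLq q \<phi> \<longleftrightarrow> \<phi> \<in> borel_measurable lebesgue \<and> Lnorm q \<phi> < \<infinity>"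

definition memL11 :: "('a::euclidean_space \<Rightarrow> real) \<Rightarrow> bool" where
  "memL11 \<phi> \<longleftrightarrow> memLq 1 \<phi> \<and> (\<forall>b\<in>Basis. memLq 1 (\<lambda>x. (x \<bullet> b) * \<phi> x))"

definition heat_kernel :: "real \<Rightarrow> 'a::euclidean_space \<Rightarrow> real" where
  "heat_kernel t x = (4 * pi * t) powr (- real DIM('a) / 2) * exp (- (norm x)\<^sup>2 / (4 * t))"

definition heat :: "real \<Rightarrow> ('a::euclidean_space \<Rightarrow> real) \<Rightarrow> 'a \<Rightarrow> real" where
  "heat t \<phi> x = (if t = 0 then \<phi> x else (\<integral> y. heat_kernel t (x - y) * \<phi> y \<partial>lebesgue))"

definition dir_grad :: "'a::euclidean_space \<Rightarrow> ('a \<Rightarrow> real) \<Rightarrow> 'a \<Rightarrow> real" where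
  "dir_grad a \<psi> x = deriv (\<lambda>h. \<psi> (x + h *\<^sub>R a)) 0"

text \<open>Global (mild) solution of u_t = \<Delta>u + a\<cdot>\<nabla>f(u), u(0)=u0:
  u \<in> (C \<inter> L^\<infinity>)([0,\<infinity>);L^1) \<inter> (C \<inter> L^\<infinity>)((0,\<infinity>);L^\<infinity>) satisfying the Duhamel formula
  for all t > 0 (as an identity of L^1 functions, i.e. almost everywhere).\<close>
definition global_solution ::
  "'a::euclidean_space \<Rightarrow> (real \<Rightarrow> real) \<Rightarrow> ('a \<Rightarrow> real) \<Rightarrow> (real \<Rightarrow> 'a \<Rightarrow> real) \<Rightarrow> bool" where
  "global_solution a f u0 u \<longleftrightarrow>
     (\<forall>t\<ge>0. memLq 1 (u t)) \<and>
     (\<exists>M::real. \<forall>t\<ge>0. Lnorm 1 (u t) \<le> ereal M) \<and>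
     (\<forall>t\<ge>0. ((\<lambda>s. Lnorm 1 (\<lambda>x. u s x - u t x)) \<longlongrightarrow> 0) (at t within {0..})) \<and>
     (\<forall>t>0. memLq \<infinity> (u t)) \<and>
     (\<exists>M::real. \<forall>t>0. Lnorm \<infinity> (u t) \<le> ereal M) \<and>
     (\<forall>t>0. ((\<lambda>s. Lnorm \<infinity> (\<lambda>x. u s x - u t x)) \<longlongrightarrow> 0) (at t within {0<..})) \<and>
     (\<forall>t>0. AE x in lebesgue.
        u t x = heat t u0 x + (LINT s:{0..t}|lborel. dir_grad a (heat (t - s) (\<lambda>y. f (u s y))) x))"

definition mass0 :: "('a::euclidean_space \<Rightarrow> real) \<Rightarrow> real" where
  "mass0 \<phi> = (\<integral> x. \<phi> x \<partial>lebesgue)"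

definition A0 :: "('a::euclidean_space \<Rightarrow> real) \<Rightarrow> real \<Rightarrow> 'a \<Rightarrow> real" where
  "A0 u0 t x = mass0 u0 * heat_kernel t x"

definition A01 :: "'a::euclidean_space \<Rightarrow> (real \<Rightarrow> real) \<Rightarrow> ('a \<Rightarrow> real) \<Rightarrow> real \<Rightarrow> 'a \<Rightarrow> real" where
  "A01 a f u0 t x = A0 u0 t x +
     (LINT s:{0..t}|lborel. dir_grad a (heat (t - s) (\<lambda>y. f (A0 u0 s y))) x)"

end

theory Submission
  imports Defs "HOL-Probability.Distributions"
begin

text \<open>
  The solution decays like the heat kernel in \<open>L\<^sup>1\<close> and \<open>L\<^sup>\<infinity>\<close>. Since
  \<open>\<integral> f(z) a\<cdot>\<nabla>z = 0\<close>, the nonlinearity does not contribute to the energy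
  \<open>\<integral> u\<^sup>2\<close>; comparing over short time steps with the heat semigroup, whose energy is
  logarithmically convex in time, gives \<open>\<integral> u\<^sup>2 \<le> C t\<^bsup>-n/2\<^esup>\<close>, and Duhamel's formula restarted at
  \<open>t/2\<close> upgrades this to the supremum norm. The expansion is then bootstrapped:
  \<open>u - A\<^sub>0 = O(t\<^bsup>-1/4\<^esup>)\<close>, then \<open>u - A\<^sub>0\<^sub>1 = O(t\<^bsup>-3/8\<^esup>)\<close>. In the last step
  \<open>f(u) - f(A\<^sub>0)\<close> is of critical size \<open>s\<^bsup>-1\<^esup>\<close>, which would produce a logarithm, but its leading part
  \<open>f'(A\<^sub>0)(A\<^sub>0\<^sub>1 - A\<^sub>0)\<close> is odd in space and hence has zero mean.
\<close>

section \<open>Translations and reflections of Lebesgue measure\<close>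

text \<open>The solution is known only through Duhamel's formula, so the energy is not
  differentiated in time; energies at \<open>t\<close> and \<open>t + h\<close> are compared
  instead. This closes because the error of one step is of order h^(9/8): a gradient singularity of
  exponent 1/4 integrates to h^(3/4), and Hoelder continuity in time contributes h^(3/8). The rates
  come from n (p - 1) = 3/2. A function of the size of the heat kernel at time s has (p - 1)-st
  power of order s^(-3/4), so Duhamel's integral has size t^(1/2 - 3/4) = t^(-1/4), and the
  difference of the nonlinearities has size s^(-3/4 - 1/4) = s^(-1), just short of integrability at
  infinity. Any rate for u - A_{0,1} strictly better than 1/4 makes the part left after removing the
  odd term integrable in time; this is the purpose of the rate 3/8. The odd term is handled through
  its first moment: zero mean gains another half power of time from the derivative kernel. Every
  bound controls the L^1 norm and the rescaled sup norm together; the remaining q follow by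
  interpolation at the very end.\<close>

lemma distr_lborel_isometry:
  fixes c :: "'a::euclidean_space"
  assumes "\<bar>r\<bar> = 1"
  shows "distr lborel borel (\<lambda>x. c + r *\<^sub>R x) = lborel"
proof -
  have "r \<noteq> 0" using assms by auto
  from lborel_affine[OF this, of c] assms show ?thesis
    by (simp add: density_1)
qed

lemma
  fixes g :: "'a::euclidean_space \<Rightarrow> real"
  assumes [measurable]: "g \<in> borel_measurable borel"
  shows integral_lborel_reflect: "(LINT x|lborel. g (c - x)) = (LINT x|lborel. g x)"
    and integrable_lborel_reflect: "integrable lborel (\<lambda>x. g (c - x)) \<longleftrightarrow> integrable lborel g"
    and integral_lborel_shift: "(LINT x|lborel. g (c + x)) = (LINT x|lborel. g x)"
    and integrable_lborel_shift: "integrable lborel (\<lambda>x. g (c + x)) \<longleftrightarrow> integrable lborel g"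
proof -
  have 1: "distr lborel borel (\<lambda>x. c - x) = lborel"
    using distr_lborel_isometry[of "-1" c] by simp
  have 2: "distr lborel borel (\<lambda>x. c + x) = lborel"
    using distr_lborel_isometry[of "1" c] by simp
  show "(LINT x|lborel. g (c - x)) = (LINT x|lborel. g x)"
    using integral_distr[of "\<lambda>x. c - x" lborel borel g] by (simp add: 1)
  show "integrable lborel (\<lambda>x. g (c - x)) \<longleftrightarrow> integrable lborel g"
    using integrable_distr_eq[of "\<lambda>x. c - x" lborel borel g] by (simp add: 1)
  show "(LINT x|lborel. g (c + x)) = (LINT x|lborel. g x)"
    using integral_distr[of "\<lambda>x. c + x" lborel borel g] by (simp add: 2)
  show "integrable lborel (\<lambda>x. g (c + x)) \<longleftrightarrow> integrable lborel g"
    using integrable_distr_eq[of "\<lambda>x. c + x" lborel borel g] by (simp add: 2)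
qed

lemma
  fixes g :: "'a::euclidean_space \<Rightarrow> real"
  assumes [measurable]: "g \<in> borel_measurable borel"
  shows integral_lborel_shift': "(LINT x|lborel. g (x - c)) = (LINT x|lborel. g x)"
    and integrable_lborel_shift': "integrable lborel (\<lambda>x. g (x - c)) \<longleftrightarrow> integrable lborel g"
  using integral_lborel_shift[of g "-c"] integrable_lborel_shift[of g "-c"] by simp_all

section \<open>The heat kernel\<close>

lemma heat_kernel_measurable [measurable (raw)]:
  assumes [measurable]: "T \<in> borel_measurable M" "X \<in> borel_measurable M"
  shows "(\<lambda>w. heat_kernel (T w) (X w :: 'a::euclidean_space)) \<in> borel_measurable M"
  unfolding heat_kernel_def by measurable

lemma heat_kernel_nonneg [simp]: "heat_kernel t x \<ge> 0"
  by (simp add: heat_kernel_def)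

lemma heat_kernel_minus [simp]: "heat_kernel t (- x) = heat_kernel t x"
  by (simp add: heat_kernel_def)

lemma heat_kernel_commute: "heat_kernel t (x - y) = heat_kernel t (y - x)"
  by (simp add: heat_kernel_def norm_minus_commute)

text \<open>The kernel factors over the basis into centred normal densities of variance
  \<open>2 * t\<close>, each of mass one.\<close>

lemma heat_kernel_nn_integral:
  assumes t: "t > 0"
  shows "(\<integral>\<^sup>+x. heat_kernel t (x::'a::euclidean_space) \<partial>lborel) = 1"
proof -
  define N where "N = normal_density 0 (sqrt (2*t))"
  have N: "(\<integral>\<^sup>+x. ennreal (N x) \<partial>lborel) = 1"
    using integral_normal_density[of "sqrt (2*t)" 0] t unfolding N_def
    by (subst nn_integral_eq_integral) auto
  have *: "heat_kernel t x = (\<Prod>b\<in>Basis. N (x \<bullet> b))" for x :: 'a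
  proof -
    have "(\<Prod>b\<in>(Basis::'a set). N (x \<bullet> b)) = 
        (\<Prod>b\<in>(Basis::'a set). (4*pi*t) powr (-1/2) * exp (- (x \<bullet> b)\<^sup>2 / (4*t)))"
      unfolding N_def normal_density_def using t
      by (intro prod.cong refl) (simp add: powr_minus powr_half_sqrt field_simps)
    also have "\<dots> = ((4*pi*t) powr (-1/2)) ^ DIM('a) * (\<Prod>b\<in>(Basis::'a set). exp (- (x \<bullet> b)\<^sup>2 / (4*t)))"
      by (simp add: prod.distrib)
    also have "((4*pi*t) powr (-1/2)) ^ DIM('a) = (4*pi*t) powr (- real DIM('a) / 2)"
      using t by (simp add: powr_realpow[symmetric] powr_powr)
    also have "(\<Prod>b\<in>(Basis::'a set). exp (- (x \<bullet> b)\<^sup>2 / (4*t))) = exp (- (norm x)\<^sup>2 / (4 * t))"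
      unfolding power2_norm_eq_inner euclidean_inner[of x x]
      by (simp add: exp_sum[symmetric] sum_divide_distrib[symmetric] sum_negf power2_eq_square)
    finally show ?thesis by (simp add: heat_kernel_def)
  qed
  have "(\<integral>\<^sup>+x. heat_kernel t (x::'a) \<partial>lborel) = (\<integral>\<^sup>+x. (\<Prod>b\<in>(Basis::'a set). ennreal (N (x \<bullet> b))) \<partial>lborel)"
    unfolding * by (simp add: prod_ennreal N_def)
  also have "\<dots> = (\<Prod>b\<in>(Basis::'a set). (\<integral>\<^sup>+x. ennreal (N x) \<partial>lborel))"
    by (intro nn_integral_lborel_prod) (auto simp: N_def)
  also have "\<dots> = 1" by (simp add: N)
  finally show ?thesis .
qed

lemma
  assumes t: "t > 0"
  shows heat_kernel_integrable [simp]: "integrable lborel (heat_kernel t :: 'a::euclidean_space \<Rightarrow> real)"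
    and heat_kernel_integral [simp]: "(LINT x|lborel. heat_kernel t (x::'a)) = 1"
proof -
  show "integrable lborel (heat_kernel t :: 'a \<Rightarrow> real)"
    using heat_kernel_nn_integral[OF t, where 'a='a]
    by (intro integrableI_nonneg) auto
  show "(LINT x|lborel. heat_kernel t (x::'a)) = 1"
    using heat_kernel_nn_integral[OF t, where 'a='a]
    by (subst integral_eq_nn_integral) auto
qed

lemma heat_kernel_le:
  fixes x :: "'a::euclidean_space"
  assumes t: "t > 0"
  shows "heat_kernel t x \<le> t powr (- real DIM('a) / 2)"
proof -
  have "(4 * pi * t) powr (- real DIM('a) / 2) \<le> t powr (- real DIM('a) / 2)"
    using t pi_ge_two by (intro powr_mono2') auto
  moreover have "exp (- (norm x)\<^sup>2 / (4 * t)) \<le> 1" using t by simp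
  ultimately have "heat_kernel t x \<le> t powr (- real DIM('a) / 2) * 1"
    unfolding heat_kernel_def by (intro mult_mono) auto
  then show ?thesis by simp
qed

text \<open>The exponent is cut into two equal halves: one makes up the kernel at time
  \<open>2 * t\<close>, the other survives as a Gaussian factor in norm x / sqrt t that is free to
  absorb polynomials.\<close>

lemma heat_kernel_double:
  fixes x :: "'a::euclidean_space"
  assumes t: "t > 0"
  shows "heat_kernel t x = 2 powr (real DIM('a) / 2) * exp (- (norm x / sqrt t)\<^sup>2 / 8) * heat_kernel (2*t) x"
proof -
  have "(4 * pi * (2*t)) powr (- real DIM('a) / 2) = (4*pi*t) powr (- real DIM('a)/2) * 2 powr (- real DIM('a)/2)"
    using t by (subst powr_mult[symmetric]) (auto simp: mult_ac)
  moreover have "2 powr (real DIM('a) / 2) * 2 powr (- real DIM('a) / 2) = (1::real)"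
    by (subst powr_add[symmetric]) simp
  moreover have "exp (- (norm x)\<^sup>2 / (4 * t)) = exp (- (norm x / sqrt t)\<^sup>2 / 8) * exp (- (norm x)\<^sup>2 / (4 * (2*t)))"
    using t by (subst exp_add[symmetric]) (simp add: power_divide field_simps)
  ultimately show ?thesis unfolding heat_kernel_def by simp
qed

section \<open>Directional derivatives of the heat kernel in closed form\<close>

definition dheat_kernel :: "'a::euclidean_space \<Rightarrow> real \<Rightarrow> 'a \<Rightarrow> real" where
  "dheat_kernel a t x = - (a \<bullet> x) / (2 * t) * heat_kernel t x"

definition ddheat_kernel :: "'a::euclidean_space \<Rightarrow> 'a \<Rightarrow> real \<Rightarrow> 'a \<Rightarrow> real" where
  "ddheat_kernel a b t x = ((a \<bullet> x) * (b \<bullet> x) / (4 * t\<^sup>2) - (a \<bullet> b) / (2 * t)) * heat_kernel t x"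

lemma dheat_kernel_measurable [measurable (raw)]:
  assumes [measurable]: "T \<in> borel_measurable M" "X \<in> borel_measurable M"
  shows "(\<lambda>w. dheat_kernel a (T w) (X w :: 'a::euclidean_space)) \<in> borel_measurable M"
  unfolding dheat_kernel_def by measurable

lemma ddheat_kernel_measurable [measurable (raw)]:
  assumes [measurable]: "T \<in> borel_measurable M" "X \<in> borel_measurable M"
  shows "(\<lambda>w. ddheat_kernel a b (T w) (X w :: 'a::euclidean_space)) \<in> borel_measurable M"
  unfolding ddheat_kernel_def by measurable

lemma dheat_kernel_minus [simp]: "dheat_kernel a t (- x) = - dheat_kernel a t x"
  by (simp add: dheat_kernel_def)

lemma continuous_heat_kernel [continuous_intros]:
  assumes "continuous_on A T" "continuous_on A X" "\<And>x. x \<in> A \<Longrightarrow> T x > 0"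
  shows "continuous_on A (\<lambda>w. heat_kernel (T w) (X w))"
  unfolding heat_kernel_def using assms
  by (intro continuous_intros) (auto dest: less_imp_neq[OF assms(3)] simp: less_imp_neq[OF assms(3), symmetric])

lemma continuous_dheat_kernel [continuous_intros]:
  assumes "continuous_on A T" "continuous_on A X" "\<And>x. x \<in> A \<Longrightarrow> T x > 0"
  shows "continuous_on A (\<lambda>w. dheat_kernel a (T w) (X w))"
  unfolding dheat_kernel_def using assms
  by (intro continuous_intros) (auto dest: less_imp_neq[OF assms(3)] simp: less_imp_neq[OF assms(3), symmetric])

lemma continuous_ddheat_kernel [continuous_intros]:
  assumes "continuous_on A T" "continuous_on A X" "\<And>x. x \<in> A \<Longrightarrow> T x > 0"
  shows "continuous_on A (\<lambda>w. ddheat_kernel a b (T w) (X w))"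
  unfolding ddheat_kernel_def using assms
  by (intro continuous_intros) (auto dest: less_imp_neq[OF assms(3)] simp: less_imp_neq[OF assms(3), symmetric])

lemma heat_kernel_has_dir_derivative:
  assumes t: "t \<noteq> 0"
  shows "((\<lambda>k. heat_kernel t (x + k *\<^sub>R b)) has_real_derivative dheat_kernel b t (x + k *\<^sub>R b)) (at k)"
proof -
  have n: "(norm (x + k *\<^sub>R b))\<^sup>2 = x \<bullet> x + 2 * k * (x \<bullet> b) + k\<^sup>2 * (b \<bullet> b)" for k
    unfolding power2_norm_eq_inner
    by (simp add: inner_add inner_commute power2_eq_square algebra_simps)
  have "((\<lambda>k. (4 * pi * t) powr (- real DIM('a) / 2) * exp (- (x \<bullet> x + 2 * k * (x \<bullet> b) + k\<^sup>2 * (b \<bullet> b)) / (4 * t)))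
    has_real_derivative dheat_kernel b t (x + k *\<^sub>R b)) (at k)"
    using t unfolding dheat_kernel_def heat_kernel_def n
    by (auto intro!: derivative_eq_intros simp: field_simps inner_add inner_commute)
  then show ?thesis unfolding heat_kernel_def n .
qed

lemma dheat_kernel_has_dir_derivative:
  assumes t: "t \<noteq> 0"
  shows "((\<lambda>k. dheat_kernel a t (x + k *\<^sub>R b)) has_real_derivative ddheat_kernel a b t (x + k *\<^sub>R b)) (at k)"
  unfolding dheat_kernel_def using t
  by (auto intro!: derivative_eq_intros heat_kernel_has_dir_derivative
      simp: ddheat_kernel_def dheat_kernel_def inner_add field_simps power2_eq_square)

text \<open>One constant for all derivative kernels. The power of 2 is the cost of doubling the
  time; the factor linear in the dimension dominates the polynomials in norm x / sqrt t, whose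
  coefficients contain half the dimension once time derivatives are taken.\<close>

definition kernel_const :: "'a::euclidean_space itself \<Rightarrow> real" where
  "kernel_const _ = 2 powr (real DIM('a) / 2) * (2 * real DIM('a) + 20)"

lemma kernel_const_ge: "kernel_const TYPE('a::euclidean_space) \<ge> 20"
proof -
  have "2 powr (real DIM('a) / 2) \<ge> (1::real)" by (simp add: ge_one_powr_ge_zero)
  then have "1 * (20::real) \<le> 2 powr (real DIM('a) / 2) * (2 * real DIM('a) + 20)"
    by (intro mult_mono) auto
  then show ?thesis by (simp add: kernel_const_def)
qed

lemma kernel_const_pos [simp]: "kernel_const TYPE('a::euclidean_space) > 0"
  using kernel_const_ge[where 'a='a] by simp

lemma kernel_const_nonneg [simp]: "kernel_const TYPE('a::euclidean_space) \<ge> 0"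
  using kernel_const_pos[where 'a='a] by linarith

text \<open>Halving the exponent of the Gaussian absorbs every polynomial factor.\<close>

lemma heat_kernel_absorb:
  fixes x :: "'a::euclidean_space"
  assumes t: "t > 0" and P: "\<bar>P\<bar> \<le> D * Q" and D: "D \<ge> 0"
    and Q: "Q \<le> (2 * real DIM('a) + 20) * exp ((norm x / sqrt t)\<^sup>2 / 8)"
  shows "\<bar>P * heat_kernel t x\<bar> \<le> kernel_const TYPE('a) * D * heat_kernel (2*t) x"
proof -
  define e where "e = exp ((norm x / sqrt t)\<^sup>2 / 8)"
  have e: "exp (- (norm x / sqrt t)\<^sup>2 / 8) = 1 / e" by (simp add: e_def exp_minus field_simps)
  have "e > 0" by (simp add: e_def)
  have "\<bar>P * heat_kernel t x\<bar> = \<bar>P\<bar> * (2 powr (real DIM('a) / 2) * (1/e) * heat_kernel (2*t) x)"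
    by (simp add: abs_mult heat_kernel_double[OF t] e[symmetric])
  also have "\<dots> \<le> (D * ((2 * real DIM('a) + 20) * e)) * (2 powr (real DIM('a) / 2) * (1/e) * heat_kernel (2*t) x)"
    using P Q D \<open>e > 0\<close> by (intro mult_right_mono order_trans[OF P] mult_left_mono) (auto simp: e_def)
  also have "\<dots> = kernel_const TYPE('a) * D * heat_kernel (2*t) x"
    using \<open>e > 0\<close> by (simp add: kernel_const_def field_simps)
  finally show ?thesis .
qed

lemma exp_ge_quad: "1 + z\<^sup>2 / 8 \<le> exp ((z::real)\<^sup>2 / 8)"
  using exp_ge_add_one_self[of "z\<^sup>2/8"] by simp

text \<open>Keeping a Gaussian at time \<open>2 * t\<close> on the right gives the L^1 bound and the
  sup bound of the kernel at once.\<close>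

lemma dheat_kernel_bound:
  fixes x :: "'a::euclidean_space"
  assumes t: "t > 0"
  shows "\<bar>dheat_kernel b t x\<bar> \<le> kernel_const TYPE('a) * (norm b * t powr (-1/2)) * heat_kernel (2*t) x"
  unfolding dheat_kernel_def
proof (rule heat_kernel_absorb[OF t])
  define z where "z = norm x / sqrt t"
  have z: "norm x = z * sqrt t" using t by (simp add: z_def)
  have st: "t powr (-1/2) = 1 / sqrt t" using t by (simp add: powr_minus powr_half_sqrt field_simps)
  show "\<bar>- (b \<bullet> x) / (2 * t)\<bar> \<le> norm b * t powr (-1/2) * (norm x / sqrt t / 2)"
  proof -
    have "\<bar>- (b \<bullet> x) / (2 * t)\<bar> \<le> norm b * norm x / (2*t)"
      using t Cauchy_Schwarz_ineq2[of b x] by (simp add: divide_right_mono)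
    also have "\<dots> = norm b * t powr (-1/2) * (norm x / sqrt t / 2)"
      unfolding st using t by (simp add: field_simps)
    finally show ?thesis .
  qed
  have "z / 2 \<le> 1 + z\<^sup>2/8" using zero_le_power2[of "z - 2"] by (simp add: power2_eq_square algebra_simps)
  also have "\<dots> \<le> 1 * exp (z\<^sup>2/8)" using exp_ge_quad[of z] by simp
  also have "\<dots> \<le> (2 * real DIM('a) + 20) * exp (z\<^sup>2/8)" by (intro mult_right_mono) auto
  finally show "norm x / sqrt t / 2 \<le> (2 * real DIM('a) + 20) * exp ((norm x / sqrt t)\<^sup>2 / 8)"
    by (simp add: z_def)
qed (use t in auto)

lemma ddheat_kernel_bound:
  fixes x :: "'a::euclidean_space"
  assumes t: "t > 0"
  shows "\<bar>ddheat_kernel a b t x\<bar> \<le> kernel_const TYPE('a) * (norm a * norm b / t) * heat_kernel (2*t) x"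
  unfolding ddheat_kernel_def
proof (rule heat_kernel_absorb[OF t])
  define z where "z = norm x / sqrt t"
  have z: "norm x = z * sqrt t" "(norm x)\<^sup>2 = z\<^sup>2 * t" using t by (simp_all add: z_def power_divide)
  show "\<bar>(a \<bullet> x) * (b \<bullet> x) / (4 * t\<^sup>2) - (a \<bullet> b) / (2 * t)\<bar> \<le> norm a * norm b / t * ((norm x / sqrt t)\<^sup>2/4 + 1/2)"
  proof -
    have "\<bar>(a \<bullet> x) * (b \<bullet> x)\<bar> \<le> (norm a * norm x) * (norm b * norm x)"
      unfolding abs_mult by (intro mult_mono Cauchy_Schwarz_ineq2) auto
    also have "\<dots> = norm a * norm b * (z\<^sup>2 * t)" using z(2) by (simp add: power2_eq_square)
    finally have "\<bar>(a \<bullet> x) * (b \<bullet> x) / (4 * t\<^sup>2)\<bar> \<le> norm a * norm b * (z\<^sup>2 * t) / (4 * t\<^sup>2)"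
      by (simp add: divide_right_mono)
    moreover have "\<bar>(a \<bullet> b) / (2 * t)\<bar> \<le> norm a * norm b / (2*t)"
      using t Cauchy_Schwarz_ineq2[of a b] by (simp add: divide_right_mono)
    ultimately have "\<bar>(a \<bullet> x) * (b \<bullet> x) / (4 * t\<^sup>2) - (a \<bullet> b) / (2 * t)\<bar> \<le> norm a * norm b * (z\<^sup>2 * t) / (4 * t\<^sup>2) + norm a * norm b / (2*t)"
      by linarith
    also have "\<dots> = norm a * norm b / t * (z\<^sup>2/4 + 1/2)" using t by (simp add: field_simps power2_eq_square)
    finally show ?thesis by (simp add: z_def)
  qed
  have "z\<^sup>2/4 + 1/2 \<le> 2 * (1 + z\<^sup>2/8)" by simp
  also have "\<dots> \<le> 2 * exp (z\<^sup>2/8)" using exp_ge_quad[of z] by (intro mult_left_mono) auto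
  also have "\<dots> \<le> (2 * real DIM('a) + 20) * exp (z\<^sup>2/8)" by (intro mult_right_mono) auto
  finally show "(norm x / sqrt t)\<^sup>2/4 + 1/2 \<le> (2 * real DIM('a) + 20) * exp ((norm x / sqrt t)\<^sup>2 / 8)"
    by (simp add: z_def)
qed (use t in auto)

section \<open>Time derivatives of the heat kernel and of its directional derivatives\<close>

definition theat_kernel :: "real \<Rightarrow> 'a::euclidean_space \<Rightarrow> real" where
  "theat_kernel t x = ((norm x)\<^sup>2 / (4 * t\<^sup>2) - real DIM('a) / (2 * t)) * heat_kernel t x"

definition tdheat_kernel :: "'a::euclidean_space \<Rightarrow> real \<Rightarrow> 'a \<Rightarrow> real" where
  "tdheat_kernel a t x = - (a \<bullet> x) / (2 * t\<^sup>2) * ((norm x)\<^sup>2 / (4 * t) - real DIM('a) / 2 - 1) * heat_kernel t x"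

lemma theat_kernel_measurable [measurable (raw)]:
  assumes [measurable]: "T \<in> borel_measurable M" "X \<in> borel_measurable M"
  shows "(\<lambda>w. theat_kernel (T w) (X w :: 'a::euclidean_space)) \<in> borel_measurable M"
  unfolding theat_kernel_def by measurable

lemma tdheat_kernel_measurable [measurable (raw)]:
  assumes [measurable]: "T \<in> borel_measurable M" "X \<in> borel_measurable M"
  shows "(\<lambda>w. tdheat_kernel a (T w) (X w :: 'a::euclidean_space)) \<in> borel_measurable M"
  unfolding tdheat_kernel_def by measurable

lemma continuous_theat_kernel [continuous_intros]:
  assumes "continuous_on A T" "continuous_on A X" "\<And>x. x \<in> A \<Longrightarrow> T x > 0"
  shows "continuous_on A (\<lambda>w. theat_kernel (T w) (X w))"
  unfolding theat_kernel_def using assms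
  by (intro continuous_intros) (auto dest: less_imp_neq[OF assms(3)] simp: less_imp_neq[OF assms(3), symmetric])

lemma continuous_tdheat_kernel [continuous_intros]:
  assumes "continuous_on A T" "continuous_on A X" "\<And>x. x \<in> A \<Longrightarrow> T x > 0"
  shows "continuous_on A (\<lambda>w. tdheat_kernel a (T w) (X w))"
  unfolding tdheat_kernel_def using assms
  by (intro continuous_intros) (auto dest: less_imp_neq[OF assms(3)] simp: less_imp_neq[OF assms(3), symmetric])

lemma heat_kernel_has_time_derivative:
  fixes x :: "'a::euclidean_space"
  assumes t: "t > 0"
  shows "((\<lambda>t. heat_kernel t x) has_real_derivative theat_kernel t x) (at t)"
proof -
  have "(4 * pi * t) powr (- real DIM('a) / 2 - 1) = (4 * pi * t) powr (- real DIM('a) / 2) / (4*pi*t)"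
    using t by (simp add: powr_diff)
  then show ?thesis
    unfolding heat_kernel_def theat_kernel_def using t
    by (auto intro!: derivative_eq_intros simp: field_simps power2_eq_square)
qed

lemma dheat_kernel_has_time_derivative:
  assumes t: "t > 0"
  shows "((\<lambda>t. dheat_kernel a t x) has_real_derivative tdheat_kernel a t x) (at t)"
  unfolding dheat_kernel_def using t
  by (auto intro!: derivative_eq_intros heat_kernel_has_time_derivative
      simp: theat_kernel_def tdheat_kernel_def field_simps power2_eq_square)

lemma theat_kernel_bound:
  fixes x :: "'a::euclidean_space"
  assumes t: "t > 0"
  shows "\<bar>theat_kernel t x\<bar> \<le> kernel_const TYPE('a) * (1 / t) * heat_kernel (2*t) x"
  unfolding theat_kernel_def
proof (rule heat_kernel_absorb[OF t])
  define z where "z = norm x / sqrt t"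
  have z: "norm x = z * sqrt t" "(norm x)\<^sup>2 = z\<^sup>2 * t" using t by (simp_all add: z_def power_divide)
  have "(norm x)\<^sup>2 / (4 * t\<^sup>2) - real DIM('a) / (2 * t) = 1/t * (z\<^sup>2/4 - real DIM('a)/2)"
    unfolding z(2) using t by (simp add: field_simps power2_eq_square)
  moreover have "\<bar>z\<^sup>2/4 - real DIM('a)/2\<bar> \<le> z\<^sup>2/4 + real DIM('a)/2"
    by (intro order_trans[OF abs_triangle_ineq4]) simp
  ultimately show "\<bar>(norm x)\<^sup>2 / (4 * t\<^sup>2) - real DIM('a) / (2 * t)\<bar> \<le> 1 / t * ((norm x / sqrt t)\<^sup>2/4 + real DIM('a)/2)"
    using t by (simp add: z_def[symmetric] abs_mult divide_right_mono)
  have "z\<^sup>2/4 + real DIM('a)/2 \<le> (2 * real DIM('a) + 20) * (1 + z\<^sup>2/8)"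
  proof -
    have "(2 * real DIM('a) + 20) * (1 + z\<^sup>2/8) = 2 * real DIM('a) + 20 + 2 * (real DIM('a) * z\<^sup>2) / 8 + 20 * z\<^sup>2 / 8"
      by (simp add: algebra_simps)
    moreover have "0 \<le> real DIM('a) * z\<^sup>2" "0 \<le> z\<^sup>2" "0 \<le> real DIM('a)" by auto
    ultimately show ?thesis by linarith
  qed
  also have "\<dots> \<le> (2 * real DIM('a) + 20) * exp (z\<^sup>2/8)" using exp_ge_quad[of z] by (intro mult_left_mono) auto
  finally show "(norm x / sqrt t)\<^sup>2/4 + real DIM('a)/2 \<le> (2 * real DIM('a) + 20) * exp ((norm x / sqrt t)\<^sup>2 / 8)"
    by (simp add: z_def)
qed (use t in auto)

lemma tdheat_kernel_bound:
  fixes x :: "'a::euclidean_space"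
  assumes t: "t > 0"
  shows "\<bar>tdheat_kernel a t x\<bar> \<le> kernel_const TYPE('a) * (norm a * t powr (-3/2)) * heat_kernel (2*t) x"
  unfolding tdheat_kernel_def
proof (rule heat_kernel_absorb[OF t])
  define z where "z = norm x / sqrt t"
  have z: "norm x = z * sqrt t" "(norm x)\<^sup>2 = z\<^sup>2 * t" using t by (simp_all add: z_def power_divide)
  have z0: "z \<ge> 0" using t by (simp add: z_def)
  have "t powr (-3/2) = t powr (-2) * t powr (1/2)" by (subst powr_add[symmetric]) simp
  then have st: "t powr (-3/2) = sqrt t / t\<^sup>2"
    using t by (simp add: powr_half_sqrt powr_minus powr_realpow[of t 2, simplified] field_simps)
  have 1: "\<bar>- (a \<bullet> x) / (2 * t\<^sup>2)\<bar> \<le> norm a * t powr (-3/2) * (z/2)"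
  proof -
    have "\<bar>- (a \<bullet> x) / (2 * t\<^sup>2)\<bar> \<le> norm a * norm x / (2*t\<^sup>2)"
      using t Cauchy_Schwarz_ineq2[of a x] by (simp add: divide_right_mono)
    then show ?thesis unfolding st z by (simp add: field_simps)
  qed
  have 2: "\<bar>(norm x)\<^sup>2 / (4 * t) - real DIM('a) / 2 - 1\<bar> \<le> z\<^sup>2/4 + real DIM('a)/2 + 1"
    unfolding z(2) using t by (simp add: abs_le_iff)
  have "\<bar>- (a \<bullet> x) / (2 * t\<^sup>2) * ((norm x)\<^sup>2 / (4 * t) - real DIM('a) / 2 - 1)\<bar> \<le>
      (norm a * t powr (-3/2) * (z/2)) * (z\<^sup>2/4 + real DIM('a)/2 + 1)"
    unfolding abs_mult using z0 by (intro mult_mono 1 2) auto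
  then show "\<bar>- (a \<bullet> x) / (2 * t\<^sup>2) * ((norm x)\<^sup>2 / (4 * t) - real DIM('a) / 2 - 1)\<bar> \<le>
      norm a * t powr (-3/2) * ((norm x / sqrt t / 2) * ((norm x / sqrt t)\<^sup>2/4 + real DIM('a)/2 + 1))"
    by (simp add: z_def mult_ac)
  \<comment> \<open>The polynomial is cubic here, so the available exponent 1/8 is shared: one half
    absorbs the linear factor, the other the quadratic one.\<close>
  have e: "1 + z\<^sup>2/16 \<le> exp (z\<^sup>2/16)" by (rule exp_ge_add_one_self)
  have "z / 2 \<le> 1 + z\<^sup>2/16" using zero_le_power2[of "z - 4"] by (simp add: power2_eq_square algebra_simps)
  with e have 3: "z / 2 \<le> exp (z\<^sup>2/16)" by linarith
  have "z\<^sup>2/4 + real DIM('a)/2 + 1 \<le> (2 * real DIM('a) + 20) * (1 + z\<^sup>2/16)"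
  proof -
    have "(2 * real DIM('a) + 20) * (1 + z\<^sup>2/16) = 2 * real DIM('a) + 20 + 2 * (real DIM('a) * z\<^sup>2) / 16 + 20 * z\<^sup>2 / 16"
      by (simp add: algebra_simps)
    moreover have "0 \<le> real DIM('a) * z\<^sup>2" "0 \<le> z\<^sup>2" "0 \<le> real DIM('a)" by auto
    ultimately show ?thesis by linarith
  qed
  also have "\<dots> \<le> (2 * real DIM('a) + 20) * exp (z\<^sup>2/16)" using e by (intro mult_left_mono) auto
  finally have 4: "z\<^sup>2/4 + real DIM('a)/2 + 1 \<le> (2 * real DIM('a) + 20) * exp (z\<^sup>2/16)" .
  have "(z/2) * (z\<^sup>2/4 + real DIM('a)/2 + 1) \<le> exp (z\<^sup>2/16) * ((2 * real DIM('a) + 20) * exp (z\<^sup>2/16))"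
    by (intro mult_mono 3 4) auto
  also have "\<dots> = (2 * real DIM('a) + 20) * exp (z\<^sup>2/8)"
    by (simp add: exp_add[symmetric])
  finally show "(norm x / sqrt t / 2) * ((norm x / sqrt t)\<^sup>2/4 + real DIM('a)/2 + 1) \<le> (2 * real DIM('a) + 20) * exp ((norm x / sqrt t)\<^sup>2 / 8)"
    by (simp add: z_def)
qed (use t in auto)

section \<open>Bounded integrable functions and convolution\<close>

text \<open>The Bochner integral vanishes on non-integrable functions, so a bound on
  \<open>l1\<close> is informative only together with integrability; this is why the two are usually
  stated side by side.\<close>

definition l1 :: "('a::euclidean_space \<Rightarrow> real) \<Rightarrow> real" where
  "l1 g = (LINT x|lborel. \<bar>g x\<bar>)"

text \<open>The bound holds at every point, not almost everywhere, and its value is hidden: it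
  serves to justify Fubini and the integrability of products.\<close>

definition L1b :: "('a::euclidean_space \<Rightarrow> real) \<Rightarrow> bool" where
  "L1b g \<longleftrightarrow> g \<in> borel_measurable borel \<and> integrable lborel g \<and> (\<exists>B. \<forall>x. \<bar>g x\<bar> \<le> B)"

definition kconv :: "('a::euclidean_space \<Rightarrow> real) \<Rightarrow> ('a \<Rightarrow> real) \<Rightarrow> 'a \<Rightarrow> real" where
  "kconv K g x = (LINT y|lborel. K (x - y) * g y)"

lemma L1bI: "g \<in> borel_measurable borel \<Longrightarrow> integrable lborel g \<Longrightarrow> (\<And>x. \<bar>g x\<bar> \<le> B) \<Longrightarrow> L1b g"
  unfolding L1b_def by blast

lemma L1b_measurable [measurable_dest]: "L1b g \<Longrightarrow> g \<in> borel_measurable borel"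
  and L1b_integrable: "L1b g \<Longrightarrow> integrable lborel g"
  by (auto simp: L1b_def)

lemma L1b_bound: assumes "L1b g" obtains B where "B \<ge> 0" "\<And>x. \<bar>g x\<bar> \<le> B"
  using assms unfolding L1b_def by (metis abs_ge_zero order_trans)

lemma l1_nonneg [simp]: "l1 g \<ge> 0"
  by (simp add: l1_def)

lemma integrable_mult_bounded:
  fixes g w :: "'a::euclidean_space \<Rightarrow> real"
  assumes g: "integrable lborel g" and [measurable]: "w \<in> borel_measurable borel"
    and w: "\<And>x. \<bar>w x\<bar> \<le> B"
  shows "integrable lborel (\<lambda>x. g x * w x)" "integrable lborel (\<lambda>x. w x * g x)"
    and "\<bar>LINT x|lborel. g x * w x\<bar> \<le> l1 g * B"
proof -
  have g': "integrable lborel (\<lambda>x. \<bar>g x\<bar> * B)" using g by auto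
  have B: "B \<ge> 0" using w abs_ge_zero order_trans by blast
  have [measurable]: "g \<in> borel_measurable borel" using g by auto
  have le: "\<bar>g x * w x\<bar> \<le> \<bar>g x\<bar> * B" for x using w B by (auto simp: abs_mult intro: mult_left_mono)
  show 1: "integrable lborel (\<lambda>x. g x * w x)"
    by (rule Bochner_Integration.integrable_bound[OF g']) (use le B in \<open>auto\<close>)
  then show "integrable lborel (\<lambda>x. w x * g x)" by (simp add: mult.commute)
  have "\<bar>LINT x|lborel. g x * w x\<bar> \<le> (LINT x|lborel. \<bar>g x\<bar> * B)"
    by (intro order_trans[OF integral_abs_bound] integral_mono le integrable_abs 1 g')
  then show "\<bar>LINT x|lborel. g x * w x\<bar> \<le> l1 g * B" by (simp add: l1_def)
qed

lemma L1b_add: "L1b g \<Longrightarrow> L1b h \<Longrightarrow> L1b (\<lambda>x. g x + h x)"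
  and L1b_diff: "L1b g \<Longrightarrow> L1b h \<Longrightarrow> L1b (\<lambda>x. g x - h x)"
proof -
  assume g: "L1b g" and h: "L1b h"
  from g obtain A where A: "\<And>x. \<bar>g x\<bar> \<le> A" by (rule L1b_bound) blast
  from h obtain B where B: "\<And>x. \<bar>h x\<bar> \<le> B" by (rule L1b_bound) blast
  have [measurable]: "g \<in> borel_measurable borel" "h \<in> borel_measurable borel" using g h by auto
  have le: "\<bar>g x + h x\<bar> \<le> A + B" "\<bar>g x - h x\<bar> \<le> A + B" for x
    using A[of x] B[of x] by linarith+
  show "L1b (\<lambda>x. g x + h x)"
    using g h by (intro L1bI[OF _ _ le(1)]) (auto simp: L1b_def)
  show "L1b (\<lambda>x. g x - h x)"
    using g h by (intro L1bI[OF _ _ le(2)]) (auto simp: L1b_def)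
qed

lemma L1b_mult_bounded:
  assumes g: "L1b g" and [measurable]: "w \<in> borel_measurable borel"
    and w: "\<And>x. \<bar>w x\<bar> \<le> B"
  shows "L1b (\<lambda>x. w x * g x)"
proof -
  from g obtain A where A: "A \<ge> 0" "\<And>x. \<bar>g x\<bar> \<le> A" by (rule L1b_bound) auto
  have B: "B \<ge> 0" using w abs_ge_zero order_trans by blast
  have [measurable]: "g \<in> borel_measurable borel" using g by auto
  show ?thesis
    by (rule L1bI[where B="B * A"])
      (auto intro!: integrable_mult_bounded[OF L1b_integrable[OF g] _ w] mult_mono A w B simp: abs_mult)
qed

lemma l1_bounded_le:
  assumes "integrable lborel h" "g \<in> borel_measurable borel" "\<And>x. \<bar>g x\<bar> \<le> h x"
  shows "integrable lborel g" "l1 g \<le> (LINT x|lborel. h x)"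
proof -
  have h0: "h x \<ge> 0" for x using assms(3)[of x] by linarith
  show 1: "integrable lborel g"
    by (rule Bochner_Integration.integrable_bound[OF assms(1)]) (use assms h0 in auto)
  show "l1 g \<le> (LINT x|lborel. h x)"
    unfolding l1_def by (intro integral_mono assms integrable_abs 1)
qed

lemma l1_triangle:
  assumes "integrable lborel g" "integrable lborel h"
  shows "l1 (\<lambda>x. g x + h x) \<le> l1 g + l1 h" "l1 (\<lambda>x. g x - h x) \<le> l1 g + l1 h"
  unfolding l1_def using assms
  by (auto simp flip: Bochner_Integration.integral_add intro!: integral_mono)

lemma l1_minus_commute: "l1 (\<lambda>x. g x - h x) = l1 (\<lambda>x. h x - g x)"
  by (simp add: l1_def abs_minus_commute)

lemma l1_eq_nn: "integrable lborel g \<Longrightarrow> (\<integral>\<^sup>+x. ennreal \<bar>g x\<bar> \<partial>lborel) = ennreal (l1 g)"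
  unfolding l1_def by (subst nn_integral_eq_integral) auto

lemma l1_le_nn:
  assumes [measurable]: "g \<in> borel_measurable borel" and "(\<integral>\<^sup>+x. ennreal \<bar>g x\<bar> \<partial>lborel) \<le> ennreal B" "B \<ge> 0"
  shows "integrable lborel g" "l1 g \<le> B"
proof -
  show 1: "integrable lborel g"
    using assms(2) by (intro integrableI_bounded) (auto simp: le_less_trans[OF _ ennreal_less_top])
  show "l1 g \<le> B" using assms(2,3) l1_eq_nn[OF 1] by simp
qed

lemma kconv_integrable1:
  fixes K g :: "'a::euclidean_space \<Rightarrow> real"
  assumes "integrable lborel g" and [measurable]: "K \<in> borel_measurable borel" and "\<And>x. \<bar>K x\<bar> \<le> B"
  shows "integrable lborel (\<lambda>y. K (x - y) * g y)"
  using assms by (intro integrable_mult_bounded[where B=B]) auto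

lemma kconv_le1:
  assumes g: "integrable lborel g" and [measurable]: "K \<in> borel_measurable borel" and "\<And>x. \<bar>K x\<bar> \<le> B"
  shows "\<bar>kconv K g x\<bar> \<le> B * l1 g"
  using integrable_mult_bounded(3)[OF g, of "\<lambda>y. K (x - y)" B] assms
  by (simp add: kconv_def mult.commute)

lemma kconv_AE_cong:
  assumes [measurable]: "K \<in> borel_measurable borel" "g \<in> borel_measurable borel" "h \<in> borel_measurable borel"
    and "AE y in lborel. g y = h y"
  shows "kconv K g x = kconv K h x"
  unfolding kconv_def using assms(4) by (intro integral_cong_AE) auto

lemma kconv_le2:
  assumes K: "integrable lborel K" and [measurable]: "g \<in> borel_measurable borel" and g: "AE y in lborel. \<bar>g y\<bar> \<le> B"
  shows "\<bar>kconv K g x\<bar> \<le> l1 K * B"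
proof -
  have [measurable]: "K \<in> borel_measurable borel" using K by auto
  have i: "integrable lborel (\<lambda>y. K (x - y))" using K by (subst integrable_lborel_reflect) auto
  have B: "AE y in lborel. \<bar>K (x - y) * g y\<bar> \<le> \<bar>K (x - y)\<bar> * B"
    using g by eventually_elim (auto simp: abs_mult intro: mult_left_mono)
  have ii: "integrable lborel (\<lambda>y. \<bar>K (x - y)\<bar> * B)" using i by auto
  have "integrable lborel (\<lambda>y. K (x - y) * g y)"
    by (rule Bochner_Integration.integrable_bound[OF ii]) (use B in \<open>auto elim!: eventually_mono\<close>)
  then have "\<bar>kconv K g x\<bar> \<le> (LINT y|lborel. \<bar>K (x - y)\<bar> * B)"
    unfolding kconv_def by (intro order_trans[OF integral_abs_bound] integral_mono_AE integrable_abs ii B)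
  also have "\<dots> = l1 K * B"
    using integral_lborel_reflect[of "\<lambda>y. \<bar>K y\<bar>" x] by (simp add: l1_def)
  finally show ?thesis .
qed

lemma kconv_measurable:
  assumes [measurable]: "K \<in> borel_measurable borel" "g \<in> borel_measurable borel"
  shows "kconv K g \<in> borel_measurable borel"
  unfolding kconv_def by measurable

lemma
  assumes K: "integrable lborel K" and g: "integrable lborel g"
  shows kconv_pair_integrable: "integrable (lborel \<Otimes>\<^sub>M lborel) (\<lambda>(y, x). K (x - y) * g y)"
    and kconv_l1: "integrable lborel (kconv K g)" "l1 (kconv K g) \<le> l1 K * l1 g"
proof -
  have [measurable]: "K \<in> borel_measurable borel" "g \<in> borel_measurable borel" using K g by auto
  have s: "(LINT x|lborel. \<bar>K (x - y)\<bar>) = l1 K" for y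
    using integral_lborel_shift'[of "\<lambda>y. \<bar>K y\<bar>" y] by (simp add: l1_def)
  show P: "integrable (lborel \<Otimes>\<^sub>M lborel) (\<lambda>(y, x). K (x - y) * g y)"
  proof (rule lborel_pair.Fubini_integrable)
    show "integrable lborel (\<lambda>y. LINT x|lborel. norm (case (y, x) of (y, x) \<Rightarrow> K (x - y) * g y))"
      using g by (simp add: abs_mult s)
    show "AE y in lborel. integrable lborel (\<lambda>x. case (y, x) of (y, x) \<Rightarrow> K (x - y) * g y)"
      using K by (simp add: integrable_lborel_shift')
  qed simp
  then show i: "integrable lborel (kconv K g)"
    using lborel_pair.integrable_snd[OF P] by (simp add: kconv_def[abs_def])
  have Pa: "integrable (lborel \<Otimes>\<^sub>M lborel) (\<lambda>(y, x). \<bar>K (x - y) * g y\<bar>)"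
    using integrable_abs[OF P] by (simp add: case_prod_beta')
  have "l1 (kconv K g) \<le> (LINT x|lborel. LINT y|lborel. \<bar>K (x - y) * g y\<bar>)"
    unfolding l1_def
    by (intro integral_mono integrable_abs i lborel_pair.integrable_snd[OF Pa])
      (auto simp: kconv_def intro!: order_trans[OF integral_abs_bound])
  also have "\<dots> = (LINT y|lborel. LINT x|lborel. \<bar>K (x - y) * g y\<bar>)"
    by (rule lborel_pair.Fubini_integral[OF Pa])
  also have "\<dots> = l1 K * l1 g" by (simp add: abs_mult s l1_def)
  finally show "l1 (kconv K g) \<le> l1 K * l1 g" .
qed

lemma kconv_L1b:
  assumes "L1b K" "L1b g"
  shows "L1b (kconv K g)"
proof -
  from \<open>L1b K\<close> obtain B where B: "\<And>x. \<bar>K x\<bar> \<le> B" by (rule L1b_bound) blast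
  show ?thesis
    using assms by (intro L1bI[where B="B * l1 g"] kconv_measurable kconv_l1 kconv_le1 B) (auto simp: L1b_def)
qed

lemma kconv_commute:
  assumes [measurable]: "K \<in> borel_measurable borel" "g \<in> borel_measurable borel"
  shows "kconv K g x = kconv g K x"
  unfolding kconv_def
  using integral_lborel_reflect[of "\<lambda>y. K (x - y) * g y" x] by (simp add: mult.commute)

text \<open>Fubini moves the convolution onto the test function \<open>w\<close>. With
  \<open>w\<close> a reflected kernel this yields associativity; with even and odd kernels it yields
  the adjoint rules for the heat semigroup and its gradient.\<close>

lemma kconv_pairing:
  assumes K: "L1b K" and g: "L1b g" and [measurable]: "w \<in> borel_measurable borel" and w: "\<And>x. \<bar>w x\<bar> \<le> B"
  shows "(LINT x|lborel. kconv K g x * w x) = (LINT y|lborel. g y * (LINT x|lborel. K (x - y) * w x))"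
proof -
  have [measurable]: "K \<in> borel_measurable borel" "g \<in> borel_measurable borel" using K g by auto
  have B: "B \<ge> 0" using w abs_ge_zero order_trans by blast
  have "integrable (lborel \<Otimes>\<^sub>M lborel) (\<lambda>(y, x). B * (K (x - y) * g y))"
    using kconv_pair_integrable[OF L1b_integrable[OF K] L1b_integrable[OF g]]
    by (simp add: case_prod_beta')
  then have P: "integrable (lborel \<Otimes>\<^sub>M lborel) (\<lambda>(y, x). K (x - y) * g y * w x)"
  proof (rule Bochner_Integration.integrable_bound)
    have "\<bar>w x\<bar> * (\<bar>K (x - y)\<bar> * \<bar>g y\<bar>) \<le> B * (\<bar>K (x - y)\<bar> * \<bar>g y\<bar>)" for x y
      using w by (intro mult_right_mono) auto
    then show "AE p in lborel \<Otimes>\<^sub>M lborel. norm (case p of (y, x) \<Rightarrow> K (x - y) * g y * w x) \<le> norm (case p of (y, x) \<Rightarrow> B * (K (x - y) * g y))"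
      using B by (auto simp: abs_mult mult_ac intro!: AE_I2)
  qed simp
  have "(LINT x|lborel. kconv K g x * w x) = (LINT x|lborel. LINT y|lborel. K (x - y) * g y * w x)"
    by (simp add: kconv_def)
  also have "\<dots> = (LINT y|lborel. LINT x|lborel. K (x - y) * g y * w x)"
    by (rule lborel_pair.Fubini_integral[OF P])
  also have "\<dots> = (LINT y|lborel. g y * (LINT x|lborel. K (x - y) * w x))"
    by (subst integral_mult_right_zero[symmetric]) (simp add: mult_ac)
  finally show ?thesis .
qed

lemma kconv_assoc:
  assumes K: "L1b K" and L: "L1b L" and g: "L1b g"
  shows "kconv K (kconv L g) x = kconv (kconv K L) g x"
proof -
  have [measurable]: "K \<in> borel_measurable borel" "g \<in> borel_measurable borel" "L \<in> borel_measurable borel"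
    using K g L by auto
  from K obtain B where B: "\<And>x. \<bar>K x\<bar> \<le> B" by (rule L1b_bound) blast
  have "kconv K (kconv L g) x = (LINT y|lborel. kconv L g y * K (x - y))"
    by (simp add: kconv_def mult.commute)
  also have "\<dots> = (LINT z|lborel. g z * (LINT y|lborel. L (y - z) * K (x - y)))"
    by (rule kconv_pairing[OF L g _ B]) simp
  finally have eq: "kconv K (kconv L g) x = (LINT z|lborel. g z * (LINT y|lborel. L (y - z) * K (x - y)))" .
  have "(LINT y|lborel. L (y - z) * K (x - y)) = kconv K L (x - z)" for z
    using integral_lborel_shift'[of "\<lambda>y. L y * K (x - z - y)" z]
    by (simp add: kconv_def mult.commute algebra_simps)
  then show ?thesis unfolding eq by (simp add: kconv_def[of "kconv K L"] mult.commute)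
qed

lemma kconv_diff_right:
  assumes "integrable lborel g" "integrable lborel h" "L1b K"
  shows "kconv K (\<lambda>y. g y - h y) x = kconv K g x - kconv K h x"
    and "kconv K (\<lambda>y. g y + h y) x = kconv K g x + kconv K h x"
proof -
  from \<open>L1b K\<close> obtain B where B: "\<And>x. \<bar>K x\<bar> \<le> B" by (rule L1b_bound) blast
  have i: "integrable lborel (\<lambda>y. K (x - y) * g y)" "integrable lborel (\<lambda>y. K (x - y) * h y)"
    using assms by (auto intro!: kconv_integrable1[OF _ _ B])
  show "kconv K (\<lambda>y. g y - h y) x = kconv K g x - kconv K h x"
    unfolding kconv_def right_diff_distrib by (rule Bochner_Integration.integral_diff[OF i])
  show "kconv K (\<lambda>y. g y + h y) x = kconv K g x + kconv K h x"
    unfolding kconv_def distrib_left by (rule Bochner_Integration.integral_add[OF i])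
qed

lemma kconv_diff_left:
  assumes "L1b g" "L1b K" "L1b L"
  shows "kconv (\<lambda>y. K y - L y) g x = kconv K g x - kconv L g x"
proof -
  have "kconv (\<lambda>y. K y - L y) g x = kconv g (\<lambda>y. K y - L y) x"
    using assms by (intro kconv_commute) (auto dest!: L1b_measurable)
  also have "\<dots> = kconv g K x - kconv g L x"
    using assms by (intro kconv_diff_right) (auto simp: L1b_integrable)
  also have "\<dots> = kconv K g x - kconv L g x"
    using assms by (intro arg_cong2[where f="(-)"] kconv_commute) (auto dest!: L1b_measurable)
  finally show ?thesis .
qed

lemma kconv_continuous:
  assumes K: "continuous_on UNIV K" "\<And>x. \<bar>K x\<bar> \<le> B" and g: "integrable lborel g"
  shows "continuous_on UNIV (kconv K g)"
proof -
  have [measurable]: "K \<in> borel_measurable borel" "g \<in> borel_measurable borel"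
    using K g by (auto intro: borel_measurable_continuous_onI)
  have "(\<lambda>n. kconv K g (X n)) \<longlonglongrightarrow> kconv K g x" if X: "X \<longlonglongrightarrow> x" for X x
    unfolding kconv_def
  proof (rule integral_dominated_convergence[where w="\<lambda>y. B * \<bar>g y\<bar>"])
    show "integrable lborel (\<lambda>y. B * \<bar>g y\<bar>)" using g by auto
    have "(\<lambda>n. K (X n - y)) \<longlonglongrightarrow> K (x - y)" for y
      using K(1) X by (intro continuous_on_tendsto_compose[of UNIV K] tendsto_intros) auto
    then show "AE y in lborel. (\<lambda>n. K (X n - y) * g y) \<longlonglongrightarrow> K (x - y) * g y"
      by (auto intro!: tendsto_intros AE_I2)
    show "AE y in lborel. norm (K (X n - y) * g y) \<le> B * \<bar>g y\<bar>" for n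
      using K(2) by (auto simp: abs_mult intro!: mult_right_mono AE_I2)
  qed auto
  then show ?thesis by (auto simp: continuous_on_sequentially o_def)
qed

section \<open>Convolution with heat kernels\<close>

lemma dheat_kernel_le:
  fixes x :: "'a::euclidean_space"
  assumes t: "t > 0"
  shows "\<bar>dheat_kernel b t x\<bar> \<le> kernel_const TYPE('a) * norm b * t powr (-1/2) * t powr (- real DIM('a)/2)"
proof -
  have "heat_kernel (2*t) x \<le> t powr (- real DIM('a)/2)"
    using t by (intro order_trans[OF heat_kernel_le] powr_mono2') auto
  then have "kernel_const TYPE('a) * (norm b * t powr (-1/2)) * heat_kernel (2*t) x \<le>
    kernel_const TYPE('a) * (norm b * t powr (-1/2)) * t powr (- real DIM('a)/2)"
    by (intro mult_left_mono) auto
  with dheat_kernel_bound[OF t, of b x] show ?thesis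
    unfolding mult.assoc by (rule order_trans)
qed

lemma ddheat_kernel_le:
  fixes x :: "'a::euclidean_space"
  assumes t: "t > 0"
  shows "\<bar>ddheat_kernel a b t x\<bar> \<le> kernel_const TYPE('a) * norm a * norm b / t * t powr (- real DIM('a)/2)"
proof -
  have "heat_kernel (2*t) x \<le> t powr (- real DIM('a)/2)"
    using t by (intro order_trans[OF heat_kernel_le] powr_mono2') auto
  then have "kernel_const TYPE('a) * (norm a * norm b / t) * heat_kernel (2*t) x \<le>
    kernel_const TYPE('a) * (norm a * norm b / t) * t powr (- real DIM('a)/2)"
    using t by (intro mult_left_mono) auto
  from order_trans[OF ddheat_kernel_bound[OF t, of a b x] this] show ?thesis
    by (simp add: mult.assoc)
qed

lemma L1b_heat_kernel: "t > 0 \<Longrightarrow> L1b (heat_kernel t)"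
  by (rule L1bI) (auto intro: heat_kernel_le)

lemma l1_heat_kernel: "t > 0 \<Longrightarrow> l1 (heat_kernel t :: 'a::euclidean_space \<Rightarrow> real) = 1"
  by (simp add: l1_def)

lemma l1_kernel_bound:
  fixes K :: "'a::euclidean_space \<Rightarrow> real"
  assumes t: "t > 0" and [measurable]: "K \<in> borel_measurable borel"
    and K: "\<And>x. \<bar>K x\<bar> \<le> C * heat_kernel (2*t) x"
  shows "integrable lborel K" "l1 K \<le> C"
  using l1_bounded_le[of "\<lambda>x. C * heat_kernel (2*t) x" K] K t by auto

lemma
  assumes t: "t > 0"
  shows L1b_dheat_kernel: "L1b (dheat_kernel (b::'a::euclidean_space) t)"
    and l1_dheat_kernel: "l1 (dheat_kernel b t) \<le> kernel_const TYPE('a) * norm b * t powr (-1/2)"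
  using t l1_kernel_bound[OF t _ dheat_kernel_bound[OF t]]
  by (auto intro!: L1bI dheat_kernel_le simp: mult_ac)

lemma
  assumes t: "t > 0"
  shows L1b_ddheat_kernel: "L1b (ddheat_kernel (a::'a::euclidean_space) b t)"
    and l1_ddheat_kernel: "l1 (ddheat_kernel a b t) \<le> kernel_const TYPE('a) * norm a * norm b / t"
  using t l1_kernel_bound[OF t _ ddheat_kernel_bound[OF t]]
  by (auto intro!: L1bI ddheat_kernel_le simp: mult_ac)

lemma lipschitz_dir:
  fixes K :: "'a::euclidean_space \<Rightarrow> real"
  assumes der: "\<And>k. ((\<lambda>k. K (x + k *\<^sub>R b)) has_real_derivative D (x + k *\<^sub>R b)) (at k)"
    and D: "\<And>z. \<bar>D z\<bar> \<le> C"
  shows "\<bar>K (x + k *\<^sub>R b) - K x\<bar> \<le> C * \<bar>k\<bar>"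
proof -
  have "norm (K (x + k *\<^sub>R b) - K (x + 0 *\<^sub>R b)) \<le> C * norm (k - 0)"
    by (rule field_differentiable_bound[of UNIV "\<lambda>k. K (x + k *\<^sub>R b)" "\<lambda>k. D (x + k *\<^sub>R b)"])
      (use D in \<open>auto intro: der\<close>)
  then show ?thesis by simp
qed

text \<open>The difference quotients of the kernel are dominated by a global Lipschitz constant, so
  differentiation passes under the integral for any integrable \<open>g\<close>. This turns
  \<open>dir_grad\<close> of a heat flow into a convolution with
  \<open>dheat_kernel\<close>.\<close>

lemma kconv_heat_has_dir_derivative:
  fixes g :: "'a::euclidean_space \<Rightarrow> real"
  assumes t: "t > 0" and g: "integrable lborel g"
  shows "((\<lambda>k. kconv (heat_kernel t) g (x + k *\<^sub>R a)) has_real_derivative kconv (dheat_kernel a t) g (x + k *\<^sub>R a)) (at k)"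
proof -
  have [measurable]: "g \<in> borel_measurable borel" using g by auto
  define C where "C = kernel_const TYPE('a) * norm a * t powr (-1/2) * t powr (- real DIM('a)/2)"
  have lip: "\<bar>heat_kernel t (z + h *\<^sub>R a) - heat_kernel t z\<bar> \<le> C * \<bar>h\<bar>" for z h
    unfolding C_def using t by (intro lipschitz_dir[OF heat_kernel_has_dir_derivative dheat_kernel_le]) auto
  have main: "((\<lambda>h. (kconv (heat_kernel t) g (x + h *\<^sub>R a) - kconv (heat_kernel t) g x) / h) \<longlongrightarrow> kconv (dheat_kernel a t) g x) (at 0)" for x
    unfolding tendsto_at_iff_sequentially
  proof (intro allI impI)
    fix X :: "nat \<Rightarrow> real" assume X: "\<forall>i. X i \<in> UNIV - {0}" "X \<longlonglongrightarrow> 0"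
    define q where "q = (\<lambda>i y. (heat_kernel t (x - y + X i *\<^sub>R a) - heat_kernel t (x - y)) / X i)"
    have i: "integrable lborel (\<lambda>y. heat_kernel t (z - y) * g y)" for z
      using t by (intro kconv_integrable1[OF g]) (auto intro: heat_kernel_le)
    have eq: "(kconv (heat_kernel t) g (x + X i *\<^sub>R a) - kconv (heat_kernel t) g x) / X i = (LINT y|lborel. q i y * g y)" for i
    proof -
      have "kconv (heat_kernel t) g (x + X i *\<^sub>R a) - kconv (heat_kernel t) g x =
          (LINT y|lborel. heat_kernel t (x + X i *\<^sub>R a - y) * g y - heat_kernel t (x - y) * g y)"
        unfolding kconv_def by (rule Bochner_Integration.integral_diff[OF i i, symmetric])
      also have "\<dots> / X i = (LINT y|lborel. (heat_kernel t (x + X i *\<^sub>R a - y) * g y - heat_kernel t (x - y) * g y) / X i)"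
        by (rule integral_divide_zero[symmetric])
      also have "\<dots> = (LINT y|lborel. q i y * g y)"
        by (intro Bochner_Integration.integral_cong refl)
          (simp add: q_def left_diff_distrib diff_divide_distrib diff_add_eq)
      finally show ?thesis .
    qed
    have "(\<lambda>i. LINT y|lborel. q i y * g y) \<longlonglongrightarrow> kconv (dheat_kernel a t) g x"
      unfolding kconv_def
    proof (rule integral_dominated_convergence[where w="\<lambda>y. C * \<bar>g y\<bar>"])
      show "integrable lborel (\<lambda>y. C * \<bar>g y\<bar>)" using g by auto
      have "(\<lambda>i. q i y) \<longlonglongrightarrow> dheat_kernel a t (x - y)" for y
      proof -
        have "((\<lambda>h. (heat_kernel t (x - y + h *\<^sub>R a) - heat_kernel t (x - y + 0 *\<^sub>R a)) / h) \<longlongrightarrow> dheat_kernel a t (x - y + 0 *\<^sub>R a)) (at 0)"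
          using heat_kernel_has_dir_derivative[of t "x - y" a 0] t by (simp add: DERIV_def)
        then show ?thesis using X unfolding tendsto_at_iff_sequentially by (simp add: q_def o_def)
      qed
      then show "AE y in lborel. (\<lambda>i. q i y * g y) \<longlonglongrightarrow> dheat_kernel a t (x - y) * g y"
        by (auto intro!: tendsto_intros AE_I2)
      have "\<bar>q i y\<bar> \<le> C" for i y
        using lip[of "x - y" "X i"] X(1) by (auto simp: q_def abs_divide field_simps)
      then show "AE y in lborel. norm (q i y * g y) \<le> C * \<bar>g y\<bar>" for i
        by (auto simp: abs_mult intro!: mult_right_mono AE_I2)
    qed (auto simp: q_def)
    then show "((\<lambda>h. (kconv (heat_kernel t) g (x + h *\<^sub>R a) - kconv (heat_kernel t) g x) / h) \<circ> X) \<longlonglongrightarrow> kconv (dheat_kernel a t) g x"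
      by (simp add: o_def eq)
  qed
  show ?thesis
    unfolding DERIV_def using main[of "x + k *\<^sub>R a"] by (simp add: algebra_simps)
qed

text \<open>Completing the square in the exponent of a product of two Gaussians, with
  \<open>X\<close>, \<open>Y\<close>, \<open>Z\<close> standing for the inner products x.x, y.y and
  x.y.\<close>

lemma complete_square_aux: 
  fixes X Y Z s t :: real assumes "s > 0" "t > 0"
  shows "(- (X - 2 * Z + Y) / (4 * s)) + (- Y / (4 * t)) = (- X / (4 * (s + t))) + (- (Y - 2 * (t / (s + t)) * Z + (t / (s + t))\<^sup>2 * X) / (4 * (s * t / (s + t))))"
proof -
  define w where "w = s + t"
  have w: "w > 0" "w \<noteq> 0" "s \<noteq> 0" "t \<noteq> 0" using assms by (auto simp: w_def)
  have "(- (X - 2 * Z + Y) / (4 * s)) + (- Y / (4 * t)) - (- X / (4 * w)) - (- (Y - 2 * (t / w) * Z + (t / w)\<^sup>2 * X) / (4 * (s * t / w))) = 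
     (X * (- t * w + s * t + t * t)  + Y * (- t * w - s * w + w * w)) / (4 * s * t * w)"
    using w by (simp add: field_simps power2_eq_square)
  also have "\<dots> = 0" by (simp add: w_def algebra_simps)
  finally show ?thesis by (simp add: w_def)
qed

lemma heat_kernel_semigroup:
  fixes x :: "'a::euclidean_space"
  assumes s: "s > 0" and t: "t > 0"
  shows "kconv (heat_kernel s) (heat_kernel t) x = heat_kernel (s + t) x"
proof -
  \<comment> \<open>As a function of \<open>y\<close> the product of the two kernels is again
    Gaussian: its centre \<open>c\<close> lies on the segment from 0 to \<open>x\<close> at the
    fraction t / (s + t), and its time \<open>r\<close> is half the harmonic mean of
    \<open>s\<close> and \<open>t\<close>.\<close>
  define c where "c = (t / (s + t)) *\<^sub>R x"
  define r where "r = s * t / (s + t)"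
  have r: "r > 0" using s t by (simp add: r_def)
  have *: "heat_kernel s (x - y) * heat_kernel t y = heat_kernel (s + t) x * heat_kernel r (y - c)" for y
  proof -
    have 1: "(4 * pi * s) powr (- real DIM('a) / 2) * (4 * pi * t) powr (- real DIM('a) / 2) =
        (4 * pi * (s + t)) powr (- real DIM('a) / 2) * (4 * pi * r) powr (- real DIM('a) / 2)"
    proof -
      have "(4 * pi * s) * (4 * pi * t) = (4 * pi * (s + t)) * (4 * pi * r)"
        using s t by (simp add: r_def)
      then show ?thesis by (metis powr_mult)
    qed
    have e: "(norm (x - y))\<^sup>2 = x \<bullet> x - 2 * (x \<bullet> y) + y \<bullet> y" "(norm y)\<^sup>2 = y \<bullet> y" "(norm x)\<^sup>2 = x \<bullet> x"
      "(norm (y - c))\<^sup>2 = y \<bullet> y - 2 * (t / (s + t)) * (x \<bullet> y) + (t / (s + t))\<^sup>2 * (x \<bullet> x)"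
      unfolding power2_norm_eq_inner c_def
      by (simp_all add: inner_diff inner_commute power2_eq_square algebra_simps)
    have "(- (norm (x - y))\<^sup>2 / (4 * s)) + (- (norm y)\<^sup>2 / (4 * t)) = (- (norm x)\<^sup>2 / (4 * (s + t))) + (- (norm (y - c))\<^sup>2 / (4 * r))"
      unfolding e r_def by (rule complete_square_aux[OF s t])
    then have "exp (- (norm (x - y))\<^sup>2 / (4 * s)) * exp (- (norm y)\<^sup>2 / (4*t)) = exp (- (norm x)\<^sup>2 / (4*(s+t))) * exp (- (norm (y - c))\<^sup>2 / (4*r))"
      by (simp only: exp_add[symmetric])
    with 1 have "((4 * pi * s) powr (- real DIM('a) / 2) * (4 * pi * t) powr (- real DIM('a) / 2)) *
        (exp (- (norm (x - y))\<^sup>2 / (4 * s)) * exp (- (norm y)\<^sup>2 / (4*t))) =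
      ((4 * pi * (s + t)) powr (- real DIM('a) / 2) * (4 * pi * r) powr (- real DIM('a) / 2)) *
        (exp (- (norm x)\<^sup>2 / (4*(s+t))) * exp (- (norm (y - c))\<^sup>2 / (4*r)))"
      by (simp only:)
    then show ?thesis unfolding heat_kernel_def by (simp only: mult_ac)
  qed
  show ?thesis
    unfolding kconv_def * using r integral_lborel_shift'[of "heat_kernel r" c] by simp
qed

text \<open>Both identities are the directional derivative of \<open>heat_kernel_semigroup\<close>:
  the left side differentiates under the integral, the right side explicitly, and derivatives are
  unique.\<close>

lemma dheat_kernel_semigroup:
  fixes x :: "'a::euclidean_space"
  assumes s: "s > 0" and t: "t > 0"
  shows "kconv (dheat_kernel a s) (heat_kernel t) x = dheat_kernel a (s + t) x"
    and "kconv (heat_kernel s) (dheat_kernel a t) x = dheat_kernel a (s + t) x"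
proof -
  have *: "kconv (dheat_kernel a s) (heat_kernel t) x = dheat_kernel a (s + t) x" if s: "s > 0" and t: "t > 0" for s t
    using kconv_heat_has_dir_derivative[OF s heat_kernel_integrable[OF t], of x a 0]
      heat_kernel_has_dir_derivative[of "s + t" x a 0] s t
    by (auto simp: heat_kernel_semigroup dest: DERIV_unique)
  show "kconv (dheat_kernel a s) (heat_kernel t) x = dheat_kernel a (s + t) x" by (rule *[OF s t])
  show "kconv (heat_kernel s) (dheat_kernel a t) x = dheat_kernel a (s + t) x"
    using *[OF t s] by (subst kconv_commute) (auto simp: add.commute)
qed

lemma ddheat_kernel_semigroup:
  fixes x :: "'a::euclidean_space"
  assumes s: "s > 0" and t: "t > 0"
  shows "kconv (dheat_kernel b s) (dheat_kernel a t) x = ddheat_kernel a b (s + t) x"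
  using kconv_heat_has_dir_derivative[OF s L1b_integrable[OF L1b_dheat_kernel[OF t, of a]], of x b 0]
    dheat_kernel_has_dir_derivative[of "s + t" a x b 0] s t
  by (auto simp: dheat_kernel_semigroup dest: DERIV_unique)

text \<open>Integration by parts without derivatives: the kernel is odd, so transferring it to the
  other factor produces the sign.\<close>

lemma dheat_kernel_pairing:
  assumes t: "t > 0" and g: "L1b g" and w: "L1b w"
  shows "(LINT x|lborel. kconv (dheat_kernel a t) g x * w x) = - (LINT x|lborel. g x * kconv (dheat_kernel a t) w x)"
proof -
  from w obtain B where B: "\<And>x. \<bar>w x\<bar> \<le> B" by (rule L1b_bound) blast
  have eq: "(LINT x|lborel. dheat_kernel a t (x - y) * w x) = - kconv (dheat_kernel a t) w y" for y
    unfolding kconv_def by (subst minus_diff_eq[symmetric], subst dheat_kernel_minus) simp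
  have "(LINT x|lborel. kconv (dheat_kernel a t) g x * w x) = (LINT y|lborel. g y * (LINT x|lborel. dheat_kernel a t (x - y) * w x))"
    using w by (intro kconv_pairing[OF L1b_dheat_kernel[OF t] g _ B]) auto
  then show ?thesis by (simp add: eq)
qed

lemma heat_kernel_pairing:
  assumes t: "t > 0" and g: "L1b g" and w: "L1b w"
  shows "(LINT x|lborel. kconv (heat_kernel t) g x * w x) = (LINT x|lborel. g x * kconv (heat_kernel t) w x)"
proof -
  from w obtain B where B: "\<And>x. \<bar>w x\<bar> \<le> B" by (rule L1b_bound) blast
  have eq: "(LINT x|lborel. heat_kernel t (x - y) * w x) = kconv (heat_kernel t) w y" for y
    unfolding kconv_def by (subst heat_kernel_commute) simp
  have "(LINT x|lborel. kconv (heat_kernel t) g x * w x) = (LINT y|lborel. g y * (LINT x|lborel. heat_kernel t (x - y) * w x))"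
    using w by (intro kconv_pairing[OF L1b_heat_kernel[OF t] g _ B]) auto
  then show ?thesis by (simp add: eq)
qed

section \<open>Increments of kernels\<close>

text \<open>The increment is the integral of the parameter derivative, and Tonelli lets the mass
  bound of \<open>H k\<close> be used separately for each \<open>k\<close>. The parameter is a
  spatial shift in some applications and the time in others.\<close>

lemma l1_increment_le:
  fixes \<Phi> \<Psi> H :: "real \<Rightarrow> 'a::euclidean_space \<Rightarrow> real"
  assumes ab: "\<alpha> \<le> \<beta>" and C: "C \<ge> 0"
    and der: "\<And>k x. \<alpha> \<le> k \<Longrightarrow> k \<le> \<beta> \<Longrightarrow> ((\<lambda>k. \<Phi> k x) has_real_derivative \<Psi> k x) (at k)"
    and cont: "\<And>k x. \<alpha> \<le> k \<Longrightarrow> k \<le> \<beta> \<Longrightarrow> isCont (\<lambda>k. \<Psi> k x) k"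
    and bd: "\<And>k x. \<alpha> \<le> k \<Longrightarrow> k \<le> \<beta> \<Longrightarrow> \<bar>\<Psi> k x\<bar> \<le> C * H k x"
    and [measurable]: "\<Phi> \<alpha> \<in> borel_measurable borel" "\<Phi> \<beta> \<in> borel_measurable borel"
      "(\<lambda>p. H (fst p) (snd p)) \<in> borel_measurable (borel \<Otimes>\<^sub>M borel)"
    and H: "\<And>k. \<alpha> \<le> k \<Longrightarrow> k \<le> \<beta> \<Longrightarrow> (\<integral>\<^sup>+x. ennreal (H k x) \<partial>lborel) \<le> 1"
  shows "integrable lborel (\<lambda>x. \<Phi> \<beta> x - \<Phi> \<alpha> x)" "l1 (\<lambda>x. \<Phi> \<beta> x - \<Phi> \<alpha> x) \<le> C * (\<beta> - \<alpha>)"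
proof -
  have [measurable]: "H k \<in> borel_measurable borel" for k
    using measurable_compose[OF measurable_Pair1'[of k borel borel] assms(8)] by simp
  have *: "ennreal \<bar>\<Phi> \<beta> x - \<Phi> \<alpha> x\<bar> \<le> (\<integral>\<^sup>+k. ennreal C * ennreal (H k x) * indicator {\<alpha>..\<beta>} k \<partial>lborel)" for x
  proof -
    have hb: "has_bochner_integral lborel (\<lambda>k. \<Psi> k x * indicator {\<alpha>..\<beta>} k) (\<Phi> \<beta> x - \<Phi> \<alpha> x)"
      using der cont by (intro has_bochner_integral_FTC_Icc_real[OF ab]) auto
    then have "ennreal \<bar>\<Phi> \<beta> x - \<Phi> \<alpha> x\<bar> \<le> (\<integral>\<^sup>+k. ennreal (norm (\<Psi> k x * indicator {\<alpha>..\<beta>} k)) \<partial>lborel)"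
      using has_bochner_integral_norm_bound[OF hb] by simp
    also have "\<dots> \<le> (\<integral>\<^sup>+k. ennreal C * ennreal (H k x) * indicator {\<alpha>..\<beta>} k \<partial>lborel)"
      using bd C by (intro nn_integral_mono) (auto simp: indicator_def ennreal_mult'[symmetric] intro!: ennreal_leI)
    finally show ?thesis .
  qed
  have "(\<integral>\<^sup>+x. ennreal \<bar>\<Phi> \<beta> x - \<Phi> \<alpha> x\<bar> \<partial>lborel) \<le> (\<integral>\<^sup>+x. \<integral>\<^sup>+k. ennreal C * ennreal (H k x) * indicator {\<alpha>..\<beta>} k \<partial>lborel \<partial>lborel)"
    by (intro nn_integral_mono *)
  also have "\<dots> = (\<integral>\<^sup>+k. \<integral>\<^sup>+x. ennreal C * ennreal (H k x) * indicator {\<alpha>..\<beta>} k \<partial>lborel \<partial>lborel)"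
    by (rule lborel_pair.Fubini') (simp add: case_prod_beta')
  also have "\<dots> = (\<integral>\<^sup>+k. ennreal C * (\<integral>\<^sup>+x. ennreal (H k x) \<partial>lborel) * indicator {\<alpha>..\<beta>} k \<partial>lborel)"
    by (intro nn_integral_cong) (simp add: nn_integral_cmult nn_integral_multc)
  also have "\<dots> \<le> (\<integral>\<^sup>+k. ennreal C * indicator {\<alpha>..\<beta>} k \<partial>lborel)"
    using H mult_left_mono[OF H, of _ "ennreal C"] by (intro nn_integral_mono) (auto simp: indicator_def)
  also have "\<dots> = ennreal (C * (\<beta> - \<alpha>))" using ab C by (simp add: nn_integral_cmult_indicator ennreal_mult)
  finally have "(\<integral>\<^sup>+x. ennreal \<bar>\<Phi> \<beta> x - \<Phi> \<alpha> x\<bar> \<partial>lborel) \<le> ennreal (C * (\<beta> - \<alpha>))" .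
  from l1_le_nn[OF _ this] C ab show "integrable lborel (\<lambda>x. \<Phi> \<beta> x - \<Phi> \<alpha> x)" "l1 (\<lambda>x. \<Phi> \<beta> x - \<Phi> \<alpha> x) \<le> C * (\<beta> - \<alpha>)"
    by auto
qed

lemma heat_kernel_shift_nn:
  assumes "t > 0" shows "(\<integral>\<^sup>+x. ennreal (heat_kernel t (x + b :: 'a::euclidean_space)) \<partial>lborel) \<le> 1"
proof -
  have "integrable lborel (\<lambda>x. heat_kernel t (x + b))" "(LINT x|lborel. heat_kernel t (x + b)) = 1"
    using integral_lborel_shift[of "heat_kernel t" b] integrable_lborel_shift[of "heat_kernel t" b] assms
    by (auto simp: add.commute)
  then show ?thesis by (subst nn_integral_eq_integral) auto
qed

lemma l1_heat_kernel_shift: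
  fixes b :: "'a::euclidean_space"
  assumes t: "t > 0"
  shows "l1 (\<lambda>x. heat_kernel t (x - b) - heat_kernel t x) \<le> kernel_const TYPE('a) * t powr (-1/2) * norm b"
    and "\<bar>heat_kernel t (x - b) - heat_kernel t x\<bar> \<le> kernel_const TYPE('a) * t powr (-1/2) * norm b * t powr (- real DIM('a)/2)"
proof -
  have c: "isCont (\<lambda>k. dheat_kernel (-b) t (x + k *\<^sub>R (-b))) k" for k x
    using t by (auto intro!: continuous_intros continuous_on_interior[of UNIV])
  have h: "(\<integral>\<^sup>+x. ennreal (heat_kernel (2*t) (x + k *\<^sub>R (-b))) \<partial>lborel) \<le> 1" for k
    using t by (intro heat_kernel_shift_nn) auto
  have "l1 (\<lambda>x. heat_kernel t (x + 1 *\<^sub>R (-b)) - heat_kernel t (x + 0 *\<^sub>R (-b))) \<le> kernel_const TYPE('a) * (norm (-b) * t powr (-1/2)) * (1 - 0)"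
    using t h
    by (intro l1_increment_le(2)[where H="\<lambda>k x. heat_kernel (2*t) (x + k *\<^sub>R (-b))" and \<Psi>="\<lambda>k x. dheat_kernel (-b) t (x + k *\<^sub>R (-b))"] c heat_kernel_has_dir_derivative dheat_kernel_bound mult_nonneg_nonneg) auto
  then show "l1 (\<lambda>x. heat_kernel t (x - b) - heat_kernel t x) \<le> kernel_const TYPE('a) * t powr (-1/2) * norm b"
    by (simp add: mult_ac)
  show "\<bar>heat_kernel t (x - b) - heat_kernel t x\<bar> \<le> kernel_const TYPE('a) * t powr (-1/2) * norm b * t powr (- real DIM('a)/2)"
    using lipschitz_dir[of "heat_kernel t" x "-b" "dheat_kernel (-b) t", OF heat_kernel_has_dir_derivative dheat_kernel_le, of 1] t
    by (simp add: mult_ac)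
qed

lemma l1_dheat_kernel_shift:
  fixes b :: "'a::euclidean_space"
  assumes t: "t > 0"
  shows "l1 (\<lambda>x. dheat_kernel a t (x - b) - dheat_kernel a t x) \<le> kernel_const TYPE('a) * norm a / t * norm b"
    and "\<bar>dheat_kernel a t (x - b) - dheat_kernel a t x\<bar> \<le> kernel_const TYPE('a) * norm a / t * norm b * t powr (- real DIM('a)/2)"
proof -
  have c: "isCont (\<lambda>k. ddheat_kernel a (-b) t (x + k *\<^sub>R (-b))) k" for k x
    using t by (auto intro!: continuous_intros continuous_on_interior[of UNIV])
  have h: "(\<integral>\<^sup>+x. ennreal (heat_kernel (2*t) (x + k *\<^sub>R (-b))) \<partial>lborel) \<le> 1" for k
    using t by (intro heat_kernel_shift_nn) auto
  have "l1 (\<lambda>x. dheat_kernel a t (x + 1 *\<^sub>R (-b)) - dheat_kernel a t (x + 0 *\<^sub>R (-b))) \<le> kernel_const TYPE('a) * (norm a * norm (-b) / t) * (1 - 0)"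
    using t h
    by (intro l1_increment_le(2)[where H="\<lambda>k x. heat_kernel (2*t) (x + k *\<^sub>R (-b))" and \<Psi>="\<lambda>k x. ddheat_kernel a (-b) t (x + k *\<^sub>R (-b))"] c dheat_kernel_has_dir_derivative ddheat_kernel_bound mult_nonneg_nonneg divide_nonneg_nonneg) auto
  then show "l1 (\<lambda>x. dheat_kernel a t (x - b) - dheat_kernel a t x) \<le> kernel_const TYPE('a) * norm a / t * norm b"
    by (simp add: mult_ac)
  show "\<bar>dheat_kernel a t (x - b) - dheat_kernel a t x\<bar> \<le> kernel_const TYPE('a) * norm a / t * norm b * t powr (- real DIM('a)/2)"
    using lipschitz_dir[of "dheat_kernel a t" x "-b" "ddheat_kernel a (-b) t", OF dheat_kernel_has_dir_derivative ddheat_kernel_le, of 1] t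
    by (simp add: mult_ac)
qed

lemma l1_heat_kernel_time:
  assumes t: "t > 0" and s: "s \<ge> 0"
  shows "l1 (\<lambda>x::'a::euclidean_space. heat_kernel (t + s) x - heat_kernel t x) \<le> kernel_const TYPE('a) * s / t"
proof -
  have c: "isCont (\<lambda>k. theat_kernel k x) k" if "k > 0" for k and x :: 'a
    using that by (auto intro!: continuous_intros continuous_on_interior[of "{0<..}"] simp: interior_open)
  have b: "\<bar>theat_kernel k x\<bar> \<le> kernel_const TYPE('a) * (1 / t) * heat_kernel (2*k) x" if "t \<le> k" for k and x :: 'a
  proof -
    have "kernel_const TYPE('a) * (1 / k) * heat_kernel (2*k) x \<le> kernel_const TYPE('a) * (1 / t) * heat_kernel (2*k) x"
      using that t less_imp_le[OF kernel_const_pos[where 'a='a]]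
      by (intro mult_right_mono mult_left_mono) (auto simp: field_simps)
    with theat_kernel_bound[of k x] that t show ?thesis by linarith
  qed
  have "l1 (\<lambda>x::'a. heat_kernel (t + s) x - heat_kernel t x) \<le> kernel_const TYPE('a) * (1 / t) * ((t + s) - t)"
    using t s b heat_kernel_nn_integral[where 'a='a]
    by (intro l1_increment_le(2)[where H="\<lambda>k. heat_kernel (2*k)" and \<Psi>=theat_kernel])
      (auto intro!: c heat_kernel_has_time_derivative)
  then show ?thesis by (simp add: mult_ac)
qed

lemma l1_dheat_kernel_time:
  assumes t: "t > 0" and s: "s \<ge> 0"
  shows "l1 (\<lambda>x::'a::euclidean_space. dheat_kernel a (t + s) x - dheat_kernel a t x) \<le> kernel_const TYPE('a) * norm a * t powr (-3/2) * s"
proof -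
  have c: "isCont (\<lambda>k. tdheat_kernel a k x) k" if "k > 0" for k and x :: 'a
    using that by (auto intro!: continuous_intros continuous_on_interior[of "{0<..}"] simp: interior_open)
  have b: "\<bar>tdheat_kernel a k x\<bar> \<le> kernel_const TYPE('a) * (norm a * t powr (-3/2)) * heat_kernel (2*k) x" if "t \<le> k" for k and x :: 'a
  proof -
    have "k powr (-3/2) \<le> t powr (-3/2)" using that t by (intro powr_mono2') auto
    then have "kernel_const TYPE('a) * (norm a * k powr (-3/2)) * heat_kernel (2*k) x \<le> kernel_const TYPE('a) * (norm a * t powr (-3/2)) * heat_kernel (2*k) x"
      using less_imp_le[OF kernel_const_pos[where 'a='a]]
      by (intro mult_right_mono mult_left_mono) auto
    with tdheat_kernel_bound[of k a x] that t show ?thesis by linarith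
  qed
  have "l1 (\<lambda>x::'a. dheat_kernel a (t + s) x - dheat_kernel a t x) \<le> kernel_const TYPE('a) * (norm a * t powr (-3/2)) * ((t + s) - t)"
    using t s b heat_kernel_nn_integral[where 'a='a]
    by (intro l1_increment_le(2)[where H="\<lambda>k. heat_kernel (2*k)" and \<Psi>="tdheat_kernel a"])
      (auto intro!: c dheat_kernel_has_time_derivative)
  then show ?thesis by (simp add: mult_ac)
qed

section \<open>Simultaneous control of the \<open>L\<^sup>1\<close> and the rescaled \<open>L\<^sup>\<infinity>\<close> norm\<close>

text \<open>The function has at most the size of \<open>A\<close> heat kernels at time
  \<open>t\<close>, in L^1 and in sup norm simultaneously. By interpolation this controls t^(n/2 (1
  - 1/q)) times the L^q norm by \<open>A\<close> for every q, which is the form of the final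
  estimate.\<close>

definition nb :: "real \<Rightarrow> real \<Rightarrow> ('a::euclidean_space \<Rightarrow> real) \<Rightarrow> bool" where
  "nb t A g \<longleftrightarrow> g \<in> borel_measurable borel \<and> integrable lborel g \<and> l1 g \<le> A \<and>
     (\<forall>x. \<bar>g x\<bar> \<le> A * t powr (- real DIM('a) / 2))"

lemma nbD:
  assumes "nb t A (g :: 'a::euclidean_space \<Rightarrow> real)"
  shows "g \<in> borel_measurable borel" "integrable lborel g" "l1 g \<le> A"
    "\<bar>g x\<bar> \<le> A * t powr (- real DIM('a) / 2)" "A \<ge> 0" "L1b g"
  using assms order_trans[OF l1_nonneg[of g], of A] by (auto simp: nb_def L1b_def)

lemma nb_mono: "nb t A (g :: 'a::euclidean_space \<Rightarrow> real) \<Longrightarrow> A \<le> B \<Longrightarrow> nb t B g"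
  using mult_right_mono[of A B "t powr (- real DIM('a) / 2)"] unfolding nb_def
  by (auto intro: order_trans)

lemma nb_add: assumes "nb t A g" "nb t B h" shows "nb t (A + B) (\<lambda>x. g x + h x)"
  and nb_diff: "nb t (A + B) (\<lambda>x. g x - h x)"
proof -
  have "\<bar>g x + h x\<bar> \<le> (A + B) * t powr (- real DIM('a) / 2)" "\<bar>g x - h x\<bar> \<le> (A + B) * t powr (- real DIM('a) / 2)" for x
    using nbD(4)[OF assms(1), of x] nbD(4)[OF assms(2), of x] by (simp_all add: distrib_right)
  moreover have "l1 (\<lambda>x. g x + h x) \<le> A + B" "l1 (\<lambda>x. g x - h x) \<le> A + B"
    using l1_triangle[OF nbD(2)[OF assms(1)] nbD(2)[OF assms(2)]] nbD(3)[OF assms(1)] nbD(3)[OF assms(2)] by linarith+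
  ultimately show "nb t (A + B) (\<lambda>x. g x + h x)" "nb t (A + B) (\<lambda>x. g x - h x)"
    using assms by (auto simp: nb_def)
qed

lemma nb_mult:
  assumes g: "nb t A g" and [measurable]: "w \<in> borel_measurable borel" and w: "\<And>x. \<bar>w x\<bar> \<le> D * \<bar>g x\<bar>" and D: "D \<ge> 0"
  shows "nb t (D * A) w"
proof -
  have "integrable lborel (\<lambda>x. D * \<bar>g x\<bar>)" using nbD[OF g] by auto
  from l1_bounded_le[OF this _ w] have "integrable lborel w" "l1 w \<le> D * l1 g" by (auto simp: l1_def)
  moreover have "D * l1 g \<le> D * A" using nbD[OF g] D by (intro mult_left_mono) auto
  moreover have "\<bar>w x\<bar> \<le> D * A * t powr (- real DIM('a) / 2)" for x
    using w[of x] mult_left_mono[OF nbD(4)[OF g, of x] D] by (simp add: mult.assoc)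
  ultimately show ?thesis by (auto simp: nb_def)
qed

text \<open>Passing to the reference time \<open>t\<close> from any \<open>s\<close> not below t / 2
  costs at most 2^(n/2). In Duhamel's integral either the time of the source or the time of the
  kernel is at least t / 2.\<close>

lemma nb_rescale:
  assumes g: "nb s A (g :: 'a::euclidean_space \<Rightarrow> real)" and s: "t / 2 \<le> s" and t: "t > 0"
  shows "nb t (2 powr (real DIM('a) / 2) * A) g"
proof -
  have "s powr (- real DIM('a) / 2) \<le> (t / 2) powr (- real DIM('a) / 2)"
    using s t by (intro powr_mono2') auto
  also have "\<dots> = 2 powr (real DIM('a) / 2) * t powr (- real DIM('a) / 2)"
    using t by (simp add: powr_divide powr_minus field_simps)
  finally have *: "A * s powr (- real DIM('a) / 2) \<le> A * (2 powr (real DIM('a) / 2) * t powr (- real DIM('a) / 2))"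
    using nbD(5)[OF g] by (intro mult_left_mono) auto
  have "1 * A \<le> 2 powr (real DIM('a) / 2) * A"
    using nbD(5)[OF g] by (intro mult_right_mono) (auto simp: ge_one_powr_ge_zero)
  with g * show ?thesis
    unfolding nb_def by (auto simp: mult_ac intro: order_trans)
qed

text \<open>All smoothing is done by the kernel, whose time is at least t / 2. Only the L^1 norm of
  the source enters, so its sup norm may be singular at early times.\<close>

lemma nb_dheat_early:
  assumes t: "t / 2 \<le> \<tau>" "t > 0" and g: "integrable lborel g"
  shows "nb t (2 powr (real DIM('a) / 2) * kernel_const TYPE('a) * norm a * \<tau> powr (-1/2) * l1 g)
    (kconv (dheat_kernel (a :: 'a::euclidean_space) \<tau>) g)"
proof -
  have \<tau>: "\<tau> > 0" using t by auto
  define D where "D = kernel_const TYPE('a) * norm a * \<tau> powr (-1/2)"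
  have [measurable]: "g \<in> borel_measurable borel" using g by auto
  have "\<bar>kconv (dheat_kernel a \<tau>) g x\<bar> \<le> D * \<tau> powr (- real DIM('a) / 2) * l1 g" for x
    using dheat_kernel_le[OF \<tau>] unfolding D_def by (intro kconv_le1[OF g]) auto
  moreover have "l1 (kconv (dheat_kernel a \<tau>) g) \<le> D * l1 g"
    using l1_dheat_kernel[OF \<tau>, of a]
    by (intro order_trans[OF kconv_l1(2)[OF L1b_integrable[OF L1b_dheat_kernel[OF \<tau>]] g]] mult_right_mono) (auto simp: D_def)
  ultimately have "nb \<tau> (D * l1 g) (kconv (dheat_kernel a \<tau>) g)"
    using kconv_l1(1)[OF L1b_integrable[OF L1b_dheat_kernel[OF \<tau>]] g]
    by (auto simp: nb_def mult_ac)
  from nb_rescale[OF this t] show ?thesis by (simp add: D_def mult_ac)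
qed

text \<open>The source already has the right sup size because \<open>s\<close> is at least t / 2.
  The kernel enters through its L^1 norm alone, whose singularity of exponent 1/2 is integrable up
  to kernel time 0.\<close>

lemma nb_dheat_late:
  assumes t: "t / 2 \<le> s" "t > 0" "\<tau> > 0" and g: "nb s A g"
  shows "nb t (2 powr (real DIM('a) / 2) * kernel_const TYPE('a) * norm a * \<tau> powr (-1/2) * A)
    (kconv (dheat_kernel (a :: 'a::euclidean_space) \<tau>) g)"
proof -
  have \<tau>: "\<tau> > 0" using t by auto
  note d = L1b_integrable[OF L1b_dheat_kernel[OF \<tau>], of a]
  define D where "D = kernel_const TYPE('a) * norm a * \<tau> powr (-1/2)"
  have D0: "D \<ge> 0" by (simp add: D_def)
  have lD: "l1 (dheat_kernel a \<tau>) \<le> D" using l1_dheat_kernel[OF \<tau>, of a] by (simp add: D_def)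
  have "\<bar>kconv (dheat_kernel a \<tau>) g x\<bar> \<le> l1 (dheat_kernel a \<tau>) * (A * s powr (- real DIM('a) / 2))" for x
    using nbD[OF g] by (intro kconv_le2[OF d]) auto
  moreover have "l1 (dheat_kernel a \<tau>) * (A * s powr (- real DIM('a) / 2)) \<le> D * (A * s powr (- real DIM('a) / 2))"
    using nbD(5)[OF g] lD by (intro mult_right_mono) auto
  ultimately have "\<bar>kconv (dheat_kernel a \<tau>) g x\<bar> \<le> D * A * s powr (- real DIM('a) / 2)" for x
    by (simp add: mult.assoc) (meson order_trans)
  moreover have "l1 (kconv (dheat_kernel a \<tau>) g) \<le> D * A"
    using nbD(3,5)[OF g] D0 lD
    by (intro order_trans[OF kconv_l1(2)[OF d nbD(2)[OF g]] mult_mono]) auto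
  ultimately have "nb s (D * A) (kconv (dheat_kernel a \<tau>) g)"
    using kconv_l1(1)[OF d nbD(2)[OF g]] by (auto simp: nb_def)
  from nb_rescale[OF this t(1,2)] show ?thesis by (simp add: D_def mult_ac)
qed

lemma nb_heat:
  assumes t: "t > 0" and g: "integrable lborel (g :: 'a::euclidean_space \<Rightarrow> real)"
  shows "nb t (l1 g) (kconv (heat_kernel t) g)"
proof -
  note d = heat_kernel_integrable[OF t]
  have "\<bar>kconv (heat_kernel t) g x\<bar> \<le> t powr (- real DIM('a) / 2) * l1 g" for x
    using heat_kernel_le[OF t] by (intro kconv_le1[OF g]) auto
  moreover have "l1 (kconv (heat_kernel t) g) \<le> l1 g"
    using kconv_l1(2)[OF d g] t by (simp add: l1_heat_kernel)
  ultimately show ?thesis using kconv_l1(1)[OF d g] by (auto simp: nb_def mult_ac)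
qed

text \<open>Writing the difference as the integral of (K(x - y) - K x) * g y, a Lipschitz bound on
  shifts of \<open>K\<close> leaves the first moment of \<open>g\<close>. With the heat kernel this
  gives the expansion of the datum; with the derivative kernel and a source of zero mean it gives an
  additional half power of time.\<close>

lemma nb_moment:
  fixes g K :: "'a::euclidean_space \<Rightarrow> real"
  assumes K: "L1b K" and g: "L1b g" and m: "integrable lborel (\<lambda>y. norm y * g y)" and D: "D \<ge> 0"
    and shift1: "\<And>y. l1 (\<lambda>x. K (x - y) - K x) \<le> D * norm y"
    and shift2: "\<And>x y. \<bar>K (x - y) - K x\<bar> \<le> D * norm y * t powr (- real DIM('a) / 2)"
  shows "nb t (D * (LINT y|lborel. norm y * \<bar>g y\<bar>)) (\<lambda>x. kconv K g x - (LINT y|lborel. g y) * K x)"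
proof -
  have [measurable]: "g \<in> borel_measurable borel" "K \<in> borel_measurable borel" using g K by auto
  from K obtain B where B: "\<And>x. \<bar>K x\<bar> \<le> B" by (rule L1b_bound) blast
  define m1 where "m1 = (LINT y|lborel. norm y * \<bar>g y\<bar>)"
  have mi: "integrable lborel (\<lambda>y. norm y * \<bar>g y\<bar>)"
    using integrable_abs[OF m] by (simp add: abs_mult)
  have m1: "m1 \<ge> 0" by (simp add: m1_def)
  have i1: "integrable lborel (\<lambda>y. K (x - y) * g y)" for x
    by (rule kconv_integrable1[OF L1b_integrable[OF g] _ B]) simp
  have i2: "integrable lborel (\<lambda>y. K x * g y)" for x
    using L1b_integrable[OF g] by simp
  have eq: "kconv K g x - (LINT y|lborel. g y) * K x = (LINT y|lborel. (K (x - y) - K x) * g y)" for x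
  proof -
    have "(LINT y|lborel. (K (x - y) - K x) * g y) = (LINT y|lborel. K (x - y) * g y) - (LINT y|lborel. K x * g y)"
      unfolding left_diff_distrib by (rule Bochner_Integration.integral_diff[OF i1 i2])
    then show ?thesis by (simp add: kconv_def mult.commute)
  qed
  have i3: "integrable lborel (\<lambda>y. (K (x - y) - K x) * g y)" for x
    using Bochner_Integration.integrable_diff[OF i1[of x] i2[of x]] by (simp add: left_diff_distrib)
  have "\<bar>kconv K g x - (LINT y|lborel. g y) * K x\<bar> \<le> (LINT y|lborel. D * t powr (- real DIM('a) / 2) * (norm y * \<bar>g y\<bar>))" for x
    unfolding eq
  proof (intro order_trans[OF integral_abs_bound] integral_mono)
    show "integrable lborel (\<lambda>y. \<bar>(K (x - y) - K x) * g y\<bar>)" using i3 by simp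
    show "\<bar>(K (x - y) - K x) * g y\<bar> \<le> D * t powr (- real DIM('a) / 2) * (norm y * \<bar>g y\<bar>)" for y
      using mult_right_mono[OF shift2[of x y], of "\<bar>g y\<bar>"] by (simp add: abs_mult mult_ac)
  qed (use mi in simp)
  then have sup: "\<bar>kconv K g x - (LINT y|lborel. g y) * K x\<bar> \<le> D * m1 * t powr (- real DIM('a) / 2)" for x
    unfolding integral_mult_right_zero m1_def[symmetric] by (simp only: mult_ac)
  have Ks: "integrable lborel (\<lambda>x. K (x - y) - K x)" for y
    using L1b_integrable[OF K] by (auto simp: integrable_lborel_shift')
  have "(\<integral>\<^sup>+x. ennreal \<bar>LINT y|lborel. (K (x - y) - K x) * g y\<bar> \<partial>lborel) \<le>
      (\<integral>\<^sup>+x. \<integral>\<^sup>+y. ennreal \<bar>(K (x - y) - K x) * g y\<bar> \<partial>lborel \<partial>lborel)"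
    using integral_norm_bound_ennreal[OF i3] by (intro nn_integral_mono) simp
  also have "\<dots> = (\<integral>\<^sup>+y. \<integral>\<^sup>+x. ennreal \<bar>(K (x - y) - K x) * g y\<bar> \<partial>lborel \<partial>lborel)"
    by (rule lborel_pair.Fubini') simp
  also have "\<dots> = (\<integral>\<^sup>+y. ennreal (l1 (\<lambda>x. K (x - y) - K x)) * ennreal \<bar>g y\<bar> \<partial>lborel)"
    using l1_eq_nn[OF Ks] by (intro nn_integral_cong) (simp add: abs_mult ennreal_mult nn_integral_multc)
  also have "\<dots> \<le> (\<integral>\<^sup>+y. ennreal (D * (norm y * \<bar>g y\<bar>)) \<partial>lborel)"
    using mult_right_mono[OF shift1] by (intro nn_integral_mono) (auto simp: ennreal_mult'[symmetric] mult.assoc[symmetric] intro!: ennreal_leI)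
  also have "\<dots> = ennreal (D * m1)"
    using mi D by (subst nn_integral_eq_integral) (auto simp: m1_def)
  finally have "(\<integral>\<^sup>+x. ennreal \<bar>LINT y|lborel. (K (x - y) - K x) * g y\<bar> \<partial>lborel) \<le> ennreal (D * m1)" .
  from l1_le_nn[OF _ this] D m1 sup show ?thesis
    unfolding nb_def m1_def[symmetric] by (auto simp: eq)
qed

section \<open>Integrals over time\<close>

lemma
  fixes F :: "real \<Rightarrow> 'a::euclidean_space \<Rightarrow> real"
  assumes F [measurable]: "(\<lambda>p. F (fst p) (snd p)) \<in> borel_measurable (borel \<Otimes>\<^sub>M borel)"
    and S [measurable]: "S \<in> sets borel"
    and b: "\<And>s. s \<in> S \<Longrightarrow> integrable lborel (F s) \<and> l1 (F s) \<le> b s"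
    and bi: "set_integrable lborel S b"
  shows time_pair_integrable: "integrable (lborel \<Otimes>\<^sub>M lborel) (\<lambda>(s, x). indicator S s * F s x)"
    and time_l1: "integrable lborel (\<lambda>x. LINT s:S|lborel. F s x)" "l1 (\<lambda>x. LINT s:S|lborel. F s x) \<le> (LINT s:S|lborel. b s)"
proof -
  have [measurable]: "F s \<in> borel_measurable borel" for s
    using measurable_compose[OF measurable_Pair1'[of s borel borel] F] by simp
  have [measurable]: "(\<lambda>(s, x). F s x) \<in> borel_measurable (borel \<Otimes>\<^sub>M borel)"
    using F by (simp add: case_prod_beta')
  show P: "integrable (lborel \<Otimes>\<^sub>M lborel) (\<lambda>(s, x). indicator S s * F s x)"
  proof (rule lborel_pair.Fubini_integrable)
    show "(\<lambda>(s, x). indicator S s * F s x) \<in> borel_measurable (lborel \<Otimes>\<^sub>M lborel)"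
      by (simp add: case_prod_beta')
    have "(LINT x|lborel. norm (case (s, x) of (s, x) \<Rightarrow> indicator S s * F s x)) = indicator S s * l1 (F s)" for s
      by (simp add: abs_mult l1_def)
    moreover have "integrable lborel (\<lambda>s. indicator S s * l1 (F s))"
    proof (rule Bochner_Integration.integrable_bound[OF bi[unfolded set_integrable_def]])
      show "AE s in lborel. norm (indicator S s * l1 (F s)) \<le> norm (indicator S s *\<^sub>R b s)"
        using b order_trans[OF l1_nonneg b[THEN conjunct2]] by (auto simp: indicator_def)
      show "(\<lambda>s. indicator S s * l1 (F s)) \<in> borel_measurable lborel"
        unfolding l1_def by measurable
    qed
    ultimately show "integrable lborel (\<lambda>s. LINT x|lborel. norm (case (s, x) of (s, x) \<Rightarrow> indicator S s * F s x))"
      by simp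
    show "AE s in lborel. integrable lborel (\<lambda>x. case (s, x) of (s, x) \<Rightarrow> indicator S s * F s x)"
      using b by (auto simp: indicator_def)
  qed
  show i: "integrable lborel (\<lambda>x. LINT s:S|lborel. F s x)"
    using lborel_pair.integrable_snd[OF P] by (simp add: set_lebesgue_integral_def)
  have Pa: "integrable (lborel \<Otimes>\<^sub>M lborel) (\<lambda>(s, x). \<bar>indicator S s * F s x\<bar>)"
    using integrable_abs[OF P] by (simp add: case_prod_beta')
  have "l1 (\<lambda>x. LINT s:S|lborel. F s x) \<le> (LINT x|lborel. LINT s|lborel. \<bar>indicator S s * F s x\<bar>)"
    unfolding l1_def
    by (intro integral_mono integrable_abs i lborel_pair.integrable_snd[OF Pa])
      (auto simp: set_lebesgue_integral_def intro!: order_trans[OF integral_abs_bound])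
  also have "\<dots> = (LINT s|lborel. LINT x|lborel. \<bar>indicator S s * F s x\<bar>)"
    by (rule lborel_pair.Fubini_integral[OF Pa])
  also have "\<dots> \<le> (LINT s:S|lborel. b s)"
    unfolding set_lebesgue_integral_def
    by (rule integral_mono[OF lborel_pair.integrable_fst[OF Pa] bi[unfolded set_integrable_def]])
      (use b in \<open>auto simp: abs_mult l1_def indicator_def\<close>)
  finally show "l1 (\<lambda>x. LINT s:S|lborel. F s x) \<le> (LINT s:S|lborel. b s)" .
qed

lemma
  fixes F :: "real \<Rightarrow> real"
  assumes [measurable]: "F \<in> borel_measurable borel" "S \<in> sets borel"
    and b: "\<And>s. s \<in> S \<Longrightarrow> \<bar>F s\<bar> \<le> b s" and bi: "set_integrable lborel S b"
  shows set_integrable_dominated: "set_integrable lborel S F"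
    and set_integral_dominated: "\<bar>LINT s:S|lborel. F s\<bar> \<le> (LINT s:S|lborel. b s)"
proof -
  have le: "\<bar>indicator S s *\<^sub>R F s\<bar> \<le> indicator S s *\<^sub>R b s" for s
    using b by (auto simp: indicator_def)
  show i: "set_integrable lborel S F" unfolding set_integrable_def
    by (rule Bochner_Integration.integrable_bound[OF bi[unfolded set_integrable_def]])
      (use order_trans[OF le abs_ge_self] in auto)
  show "\<bar>LINT s:S|lborel. F s\<bar> \<le> (LINT s:S|lborel. b s)"
    unfolding set_lebesgue_integral_def
    by (intro order_trans[OF integral_abs_bound] integral_mono integrable_abs i[unfolded set_integrable_def] bi[unfolded set_integrable_def] le)
qed

lemma nb_time_integral:
  fixes F :: "real \<Rightarrow> 'a::euclidean_space \<Rightarrow> real"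
  assumes F [measurable]: "(\<lambda>p. F (fst p) (snd p)) \<in> borel_measurable (borel \<Otimes>\<^sub>M borel)"
    and S [measurable]: "S \<in> sets borel"
    and b: "\<And>s. s \<in> S \<Longrightarrow> nb t (b s) (F s)" and bi: "set_integrable lborel S b"
  shows "nb t (LINT s:S|lborel. b s) (\<lambda>x. LINT s:S|lborel. F s x)"
proof -
  have i: "integrable lborel (\<lambda>x. LINT s:S|lborel. F s x)" "l1 (\<lambda>x. LINT s:S|lborel. F s x) \<le> (LINT s:S|lborel. b s)"
    by (rule time_l1[OF F S _ bi]; use b in \<open>auto simp: nb_def\<close>)+
  have "\<bar>LINT s:S|lborel. F s x\<bar> \<le> (LINT s:S|lborel. b s * t powr (- real DIM('a) / 2))" for x
    using measurable_compose[OF measurable_Pair2'[of x borel borel] F] b bi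
    by (intro set_integral_dominated) (auto simp: nb_def set_integrable_def mult.assoc[symmetric])
  with i show ?thesis
    by (auto simp: nb_def)
qed

text \<open>Singularities at the left end come from the primitive of the power; those at the right
  end of a window from \<open>r\<close> to \<open>r + t\<close> follow by reflecting
  \<open>s\<close> to \<open>r + t - s\<close>.\<close>

lemma
  fixes \<alpha> t :: real
  assumes "\<alpha> < 1" "t \<ge> 0"
  shows powr_integrable: "set_integrable lborel {0<..<t} (\<lambda>s. s powr (- \<alpha>))"
    and powr_integral: "(LINT s:{0<..<t}|lborel. s powr (- \<alpha>)) = t powr (1 - \<alpha>) / (1 - \<alpha>)"
    and powr_integrable': "set_integrable lborel {r<..<r + t} (\<lambda>s. (r + t - s) powr (- \<alpha>))"
    and powr_integral': "(LINT s:{r<..<r + t}|lborel. (r + t - s) powr (- \<alpha>)) = t powr (1 - \<alpha>) / (1 - \<alpha>)"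
proof -
  have "((\<lambda>x. x powr (- \<alpha>)) has_integral (t powr (- \<alpha> + 1) / (- \<alpha> + 1))) {0..t}"
    using has_integral_powr_from_0[of "- \<alpha>" t] assms by simp
  then have "((\<lambda>x. x powr (- \<alpha>)) has_integral (t powr (1 - \<alpha>) / (1 - \<alpha>))) {0<..<t}"
    unfolding has_integral_Icc_iff_Ioo by (simp add: add.commute)
  then have n: "integral\<^sup>N lborel (\<lambda>x. ennreal (x powr (- \<alpha>)) * indicator {0<..<t} x) = ennreal (t powr (1 - \<alpha>) / (1 - \<alpha>))"
    by (intro nn_integral_has_integral_lebesgue') auto
  define q where "q = (\<lambda>x. indicator {0<..<t} x *\<^sub>R x powr (- \<alpha>))"
  have q0: "q x \<ge> 0" for x by (simp add: q_def)
  have [measurable]: "q \<in> borel_measurable borel" unfolding q_def by measurable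
  have "ennreal (x powr (- \<alpha>)) * indicator {0<..<t} x = ennreal (q x)" for x
    by (auto simp: q_def indicator_def)
  with n have nq: "(\<integral>\<^sup>+x. ennreal (q x) \<partial>lborel) = ennreal (t powr (1 - \<alpha>) / (1 - \<alpha>))" by simp
  show i: "set_integrable lborel {0<..<t} (\<lambda>s. s powr (- \<alpha>))"
    unfolding set_integrable_def q_def[symmetric] by (rule integrableI_nonneg) (auto simp: nq q0)
  show I: "(LINT s:{0<..<t}|lborel. s powr (- \<alpha>)) = t powr (1 - \<alpha>) / (1 - \<alpha>)"
    unfolding set_lebesgue_integral_def q_def[symmetric]
    using assms by (subst integral_eq_nn_integral) (auto simp: nq q0)
  have ind: "indicator {r<..<r + t} s *\<^sub>R (r + t - s) powr (- \<alpha>) = (\<lambda>s. indicator {0<..<t} s *\<^sub>R s powr (- \<alpha>)) (r + t - s)" for s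
    by (auto simp: indicator_def)
  show "set_integrable lborel {r<..<r + t} (\<lambda>s. (r + t - s) powr (- \<alpha>))"
    using i unfolding set_integrable_def ind by (subst integrable_lborel_reflect) auto
  show "(LINT s:{r<..<r + t}|lborel. (r + t - s) powr (- \<alpha>)) = t powr (1 - \<alpha>) / (1 - \<alpha>)"
    using I unfolding set_lebesgue_integral_def ind by (subst integral_lborel_reflect) auto
qed

text \<open>The interval is open because the endpoints are degenerate: at \<open>s = t\<close> the
  kernel has time 0, and at \<open>s = 0\<close> the source may be singular.
  \<open>closed_interval_integral_eq\<close> makes the link with integrals over
  \<open>{0..t}\<close>.\<close>

definition duh :: "'a::euclidean_space \<Rightarrow> (real \<Rightarrow> 'a \<Rightarrow> real) \<Rightarrow> real \<Rightarrow> 'a \<Rightarrow> real" where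
  "duh a g t x = (LINT s:{0<..<t}|lborel. kconv (dheat_kernel a (t - s)) (g s) x)"

lemma kconv_dheat_joint_measurable:
  assumes [measurable]: "(\<lambda>p. g (fst p) (snd p)) \<in> borel_measurable (borel \<Otimes>\<^sub>M borel)"
  shows "(\<lambda>p. kconv (dheat_kernel a (t - fst p)) (g (fst p)) (snd p)) \<in> borel_measurable (borel \<Otimes>\<^sub>M borel)"
proof -
  have [measurable]: "(\<lambda>q. g (fst (fst q)) (snd q)) \<in> borel_measurable ((borel \<Otimes>\<^sub>M borel) \<Otimes>\<^sub>M borel)"
  proof -
    have "(\<lambda>q. (fst (fst q), snd q)) \<in> ((borel \<Otimes>\<^sub>M borel) \<Otimes>\<^sub>M borel) \<rightarrow>\<^sub>M (borel \<Otimes>\<^sub>M borel)" by measurable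
    from measurable_compose[OF this assms] show ?thesis by simp
  qed
  show ?thesis unfolding kconv_def by measurable
qed

lemma nb_duh:
  fixes g :: "real \<Rightarrow> 'a::euclidean_space \<Rightarrow> real"
  assumes g: "(\<lambda>p. g (fst p) (snd p)) \<in> borel_measurable (borel \<Otimes>\<^sub>M borel)"
    and b: "\<And>s. 0 < s \<Longrightarrow> s < t \<Longrightarrow> nb t (b s) (kconv (dheat_kernel a (t - s)) (g s))"
    and bi: "set_integrable lborel {0<..<t} b"
  shows "nb t (LINT s:{0<..<t}|lborel. b s) (duh a g t)"
  unfolding duh_def[abs_def]
  by (rule nb_time_integral[OF kconv_dheat_joint_measurable[OF g] _ _ bi]) (auto intro: b)

lemma half_powr_le:
  assumes "t > 0" "0 \<le> r" "r \<le> 1"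
  shows "(t/2) powr (- r) \<le> 2 * t powr (- r :: real)"
proof -
  have "2 powr r \<le> (2::real) powr 1" using assms by (intro powr_mono) auto
  then have "2 powr r * t powr (-r) \<le> 2 * t powr (-r)" by (intro mult_right_mono) auto
  then show ?thesis using assms by (simp add: powr_divide powr_minus field_simps)
qed

definition duh_const :: "'a::euclidean_space \<Rightarrow> real" where
  "duh_const a = 2 powr (real DIM('a) / 2) * kernel_const TYPE('a) * norm a"

lemma duh_const_nonneg [simp]: "duh_const a \<ge> 0"
  by (simp add: duh_const_def)

lemma nb_dheat_early':
  assumes s: "s \<le> t / 2" "t > 0" and g: "integrable lborel g" "l1 g \<le> A"
  shows "nb t (duh_const a * (2 * t powr (-1/2)) * A) (kconv (dheat_kernel (a :: 'a::euclidean_space) (t - s)) g)"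
proof -
  have "(t - s) powr (-1/2) \<le> (t/2) powr (- (1/2))" using s by (simp, intro powr_mono2') auto
  also have "\<dots> \<le> 2 * t powr (-1/2)" using half_powr_le[of t "1/2"] s by simp
  finally have "duh_const a * (t - s) powr (-1/2) * l1 g \<le> duh_const a * (2 * t powr (-1/2)) * A"
    using g by (intro mult_mono) auto
  moreover have "nb t (duh_const a * (t - s) powr (-1/2) * l1 g) (kconv (dheat_kernel a (t - s)) g)"
    unfolding duh_const_def using s g by (intro nb_dheat_early) auto
  ultimately show ?thesis by (rule nb_mono[rotated])
qed

text \<open>The first summand majorises the early half of the time interval and the second the late
  half. Adding them gives one majorant for the whole interval, so the time integral itself need not
  be cut at t / 2.\<close>

lemma nb_dheat_powr:
  fixes g :: "'a::euclidean_space \<Rightarrow> real"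
  assumes s: "0 < s" "s < t" and n: "nb s (D * s powr (- \<alpha>)) g" and \<alpha>: "0 \<le> \<alpha>" "\<alpha> < 1" and D: "D \<ge> 0"
  shows "nb t (duh_const a * D * (2 * t powr (-1/2)) * s powr (- \<alpha>) + duh_const a * D * (2 * t powr (- \<alpha>)) * (t - s) powr (- (1/2)))
    (kconv (dheat_kernel a (t - s)) g)" (is "nb t ?b _")
proof (cases "s \<le> t / 2")
  case True
  have "nb t (duh_const a * (2 * t powr (-1/2)) * (D * s powr (- \<alpha>))) (kconv (dheat_kernel a (t - s)) g)"
    using True s nbD[OF n] by (intro nb_dheat_early') auto
  then show ?thesis by (rule nb_mono) (use D in \<open>simp add: mult_ac\<close>)
next
  case False
  have t: "t > 0" using s by simp
  have "s powr (-\<alpha>) \<le> (t/2) powr (-\<alpha>)" using False t \<alpha> by (intro powr_mono2') auto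
  also have "\<dots> \<le> 2 * t powr (-\<alpha>)" using half_powr_le[of t \<alpha>] \<alpha> t by simp
  finally have "duh_const a * (t - s) powr (-1/2) * (D * s powr (-\<alpha>)) \<le> duh_const a * (t - s) powr (-1/2) * (D * (2 * t powr (-\<alpha>)))"
    using D by (intro mult_left_mono) auto
  also have "\<dots> \<le> ?b" using D by simp
  finally have le: "duh_const a * (t - s) powr (-1/2) * (D * s powr (-\<alpha>)) \<le> ?b" .
  show ?thesis
    using nb_dheat_late[of t s "t - s" _ g a] n False t s
    by (intro nb_mono[OF _ le]) (auto simp: duh_const_def)
qed

lemma
  fixes t \<alpha> A C :: real
  assumes t: "t > 0" and \<alpha>: "\<alpha> < 1"
  shows powr_sum_integrable: "set_integrable lborel {0<..<t} (\<lambda>s. A * s powr (- \<alpha>) + C * (t - s) powr (- (1/2)))"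
    and powr_sum_integral: "(LINT s:{0<..<t}|lborel. A * s powr (- \<alpha>) + C * (t - s) powr (- (1/2))) =
      A * (t powr (1 - \<alpha>) / (1 - \<alpha>)) + C * (2 * t powr (1/2))"
proof -
  have i: "set_integrable lborel {0<..<t} (\<lambda>s. s powr (- \<alpha>))" "set_integrable lborel {0<..<t} (\<lambda>s. (t - s) powr (- (1/2)))"
    using powr_integrable[of \<alpha> t] powr_integrable'[of "1/2" t 0] \<alpha> t by auto
  show "set_integrable lborel {0<..<t} (\<lambda>s. A * s powr (- \<alpha>) + C * (t - s) powr (- (1/2)))"
    by (intro set_integral_add set_integrable_mult_right i)
  show "(LINT s:{0<..<t}|lborel. A * s powr (- \<alpha>) + C * (t - s) powr (- (1/2))) =
      A * (t powr (1 - \<alpha>) / (1 - \<alpha>)) + C * (2 * t powr (1/2))"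
    using powr_integral[of \<alpha> t] powr_integral'[of "1/2" t 0] \<alpha> t
    by (subst set_integral_add) (auto intro!: set_integrable_mult_right i)
qed

text \<open>The derivative kernel gains half a power of time on integration. In the constant, 2 / (1
  - \<alpha>) is the early half with the singularity of the source at 0, and 4 is the late half with
  the singularity of the kernel at \<open>t\<close>.\<close>

lemma nb_duh_powr:
  fixes g :: "real \<Rightarrow> 'a::euclidean_space \<Rightarrow> real"
  assumes g: "(\<lambda>p. g (fst p) (snd p)) \<in> borel_measurable (borel \<Otimes>\<^sub>M borel)" and t: "t > 0"
    and nb: "\<And>s. 0 < s \<Longrightarrow> s < t \<Longrightarrow> nb s (D * s powr (- \<alpha>)) (g s)" and \<alpha>: "0 \<le> \<alpha>" "\<alpha> < 1" and D: "D \<ge> 0"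
  shows "nb t (duh_const a * (2 / (1 - \<alpha>) + 4) * D * t powr (1/2 - \<alpha>)) (duh a g t)"
    and "set_integrable lborel {0<..<t} (\<lambda>s. kconv (dheat_kernel a (t - s)) (g s) x)"
proof -
  note b = nb_dheat_powr[OF _ _ nb \<alpha> D, of _ t a]
  note bi = powr_sum_integrable[OF t \<alpha>(2), of "duh_const a * D * (2 * t powr (-1/2))" "duh_const a * D * (2 * t powr (- \<alpha>))"]
  have "t powr (-1/2) * t powr (1 - \<alpha>) = t powr (1/2 - \<alpha>)" "t powr (- \<alpha>) * t powr (1/2) = t powr (1/2 - \<alpha>)"
    by (simp_all flip: powr_add)
  then have I: "duh_const a * D * (2 * t powr (-1/2)) * (t powr (1 - \<alpha>) / (1 - \<alpha>)) + duh_const a * D * (2 * t powr (- \<alpha>)) * (2 * t powr (1/2)) =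
      duh_const a * (2 / (1 - \<alpha>) + 4) * D * t powr (1/2 - \<alpha>)"
    using \<alpha> by (simp add: algebra_simps)
  show "nb t (duh_const a * (2 / (1 - \<alpha>) + 4) * D * t powr (1/2 - \<alpha>)) (duh a g t)"
    using nb_duh[OF g b bi] unfolding powr_sum_integral[OF t \<alpha>(2)] I by simp
  have bi': "set_integrable lborel {0<..<t} (\<lambda>s. (duh_const a * D * (2 * t powr (-1/2)) * s powr (- \<alpha>) +
      duh_const a * D * (2 * t powr (- \<alpha>)) * (t - s) powr (- (1/2))) * t powr (- real DIM('a) / 2))"
    using bi by (intro set_integrable_mult_left)
  show "set_integrable lborel {0<..<t} (\<lambda>s. kconv (dheat_kernel a (t - s)) (g s) x)"
    using measurable_compose[OF measurable_Pair2'[of x borel borel] kconv_dheat_joint_measurable[OF g, of a t]] nbD(4)[OF b]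
    by (intro set_integrable_dominated[OF _ _ _ bi']) auto
qed

section \<open>The power nonlinearity\<close>

definition pw :: "real \<Rightarrow> real \<Rightarrow> real" where
  "pw \<kappa> \<xi> = \<bar>\<xi>\<bar> powr \<kappa> * \<xi>"

lemma pw_measurable [measurable]: "pw \<kappa> \<in> borel_measurable borel"
  unfolding pw_def by measurable

lemma pw_0 [simp]: "pw \<kappa> 0 = 0" by (simp add: pw_def)

lemma abs_pw: "\<bar>pw \<kappa> x\<bar> = \<bar>x\<bar> powr \<kappa> * \<bar>x\<bar>" by (simp add: pw_def abs_mult)

lemma abs_powr_pw_has_derivative_nonzero:
  assumes "\<xi> \<noteq> 0"
  shows "(pw \<kappa> has_real_derivative (\<kappa> + 1) * \<bar>\<xi>\<bar> powr \<kappa>) (at \<xi>)"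
    and "((\<lambda>\<xi>. \<bar>\<xi>\<bar> powr r) has_real_derivative r * \<bar>\<xi>\<bar> powr (r - 1) * sgn \<xi>) (at \<xi>)"
proof -
  have "\<xi> > 0 \<or> \<xi> < 0" using assms by auto
  then have D: "((\<lambda>\<xi>. \<bar>\<xi>\<bar> powr r) has_real_derivative r * \<bar>\<xi>\<bar> powr (r - 1) * sgn \<xi>) (at \<xi>)" for r
  proof
    assume "\<xi> > 0"
    then have "((\<lambda>\<xi>. \<xi> powr r) has_real_derivative r * \<bar>\<xi>\<bar> powr (r - 1) * sgn \<xi>) (at \<xi>)"
      by (auto intro!: derivative_eq_intros)
    then show ?thesis
      by (rule has_field_derivative_transform_within_open[where S="{0<..}"]) (use \<open>\<xi> > 0\<close> in auto)
  next
    assume "\<xi> < 0"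
    then have "((\<lambda>\<xi>. (- \<xi>) powr r) has_real_derivative r * \<bar>\<xi>\<bar> powr (r - 1) * sgn \<xi>) (at \<xi>)"
      by (auto intro!: derivative_eq_intros)
    then show ?thesis
      by (rule has_field_derivative_transform_within_open[where S="{..<0}"]) (use \<open>\<xi> < 0\<close> in auto)
  qed
  from D show "((\<lambda>\<xi>. \<bar>\<xi>\<bar> powr r) has_real_derivative r * \<bar>\<xi>\<bar> powr (r - 1) * sgn \<xi>) (at \<xi>)" .
  have "\<bar>\<xi>\<bar> powr \<kappa> = \<bar>\<xi>\<bar> powr (\<kappa> - 1) * \<bar>\<xi>\<bar>" using assms by (simp add: powr_diff)
  then have eq: "\<kappa> * \<bar>\<xi>\<bar> powr (\<kappa> - 1) * sgn \<xi> * \<xi> + 1 * \<bar>\<xi>\<bar> powr \<kappa> = (\<kappa> + 1) * \<bar>\<xi>\<bar> powr \<kappa>"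
    by (simp add: algebra_simps sgn_if)
  show "(pw \<kappa> has_real_derivative (\<kappa> + 1) * \<bar>\<xi>\<bar> powr \<kappa>) (at \<xi>)"
    using DERIV_cong[OF DERIV_mult[OF D[of \<kappa>] DERIV_ident] eq] unfolding pw_def[abs_def] by simp
qed

lemma pw_has_derivative:
  assumes k: "\<kappa> > 0"
  shows "(pw \<kappa> has_real_derivative (\<kappa> + 1) * \<bar>\<xi>\<bar> powr \<kappa>) (at \<xi>)"
proof (cases "\<xi> = 0")
  case True
  have "((\<lambda>h. \<bar>h\<bar> powr \<kappa>) \<longlongrightarrow> \<bar>0\<bar> powr \<kappa>) (at (0::real))"
    using k by (intro tendsto_powr' tendsto_rabs tendsto_ident_at tendsto_const) auto
  then have "((\<lambda>h. \<bar>h\<bar> powr \<kappa>) \<longlongrightarrow> 0) (at (0::real))" by simp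
  then have "((\<lambda>h. (pw \<kappa> (0 + h) - pw \<kappa> 0) / h) \<longlongrightarrow> 0) (at 0)"
    by (rule Lim_transform_eventually) (auto simp: pw_def eventually_at_filter)
  then show ?thesis using True by (simp add: DERIV_def)
qed (rule abs_powr_pw_has_derivative_nonzero)

text \<open>The primitive that makes the flux of the nonlinearity a total derivative in
  \<open>pw_dheat_orthogonal\<close>.\<close>

lemma pw_antiderivative:
  assumes k: "\<kappa> > 0"
  shows "((\<lambda>\<xi>. \<bar>\<xi>\<bar> powr (\<kappa> + 2) / (\<kappa> + 2)) has_real_derivative pw \<kappa> \<xi>) (at \<xi>)"
proof (cases "\<xi> = 0")
  case True
  have "((\<lambda>h. pw \<kappa> h / (\<kappa> + 2)) \<longlongrightarrow> pw \<kappa> 0 / (\<kappa> + 2)) (at (0::real))"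
    using DERIV_isCont[OF pw_has_derivative[OF k, of 0]] k by (intro tendsto_divide tendsto_const) (auto simp: isCont_def)
  then have "((\<lambda>h. (\<bar>0 + h\<bar> powr (\<kappa> + 2) / (\<kappa> + 2) - \<bar>0\<bar> powr (\<kappa> + 2) / (\<kappa> + 2)) / h) \<longlongrightarrow> pw \<kappa> 0 / (\<kappa> + 2)) (at 0)"
  proof (rule Lim_transform_eventually)
    have "pw \<kappa> h / (\<kappa> + 2) = (\<bar>0 + h\<bar> powr (\<kappa> + 2) / (\<kappa> + 2) - \<bar>0\<bar> powr (\<kappa> + 2) / (\<kappa> + 2)) / h" if "h \<noteq> 0" for h
    proof -
      have "\<bar>h\<bar> powr (\<kappa> + 2) = \<bar>h\<bar> powr \<kappa> * (h * h)"
        using that by (simp add: powr_add power2_eq_square)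
      then show ?thesis using that k by (simp add: pw_def)
    qed
    then show "\<forall>\<^sub>F h in at 0. pw \<kappa> h / (\<kappa> + 2) = (\<bar>0 + h\<bar> powr (\<kappa> + 2) / (\<kappa> + 2) - \<bar>0\<bar> powr (\<kappa> + 2) / (\<kappa> + 2)) / h"
      by (auto simp: eventually_at_filter)
  qed
  then show ?thesis using True by (simp add: DERIV_def)
next
  case False
  have "\<bar>\<xi>\<bar> powr (\<kappa> + 1) * sgn \<xi> = pw \<kappa> \<xi>"
    using False by (simp add: pw_def powr_add sgn_if)
  then show ?thesis
    using DERIV_cdivide[OF abs_powr_pw_has_derivative_nonzero(2)[OF False, of "\<kappa> + 2"], of "\<kappa> + 2"] k
    by (simp add: add.commute)
qed

lemma pw_lipschitz:
  assumes k: "\<kappa> > 0" and "\<bar>\<xi>\<bar> \<le> m" "\<bar>\<eta>\<bar> \<le> m"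
  shows "\<bar>pw \<kappa> \<xi> - pw \<kappa> \<eta>\<bar> \<le> (\<kappa> + 1) * m powr \<kappa> * \<bar>\<xi> - \<eta>\<bar>"
proof -
  have "norm (pw \<kappa> \<xi> - pw \<kappa> \<eta>) \<le> (\<kappa> + 1) * m powr \<kappa> * norm (\<xi> - \<eta>)"
  proof (rule field_differentiable_bound[of "{-m..m}" "pw \<kappa>" "\<lambda>\<xi>. (\<kappa> + 1) * \<bar>\<xi>\<bar> powr \<kappa>"])
    show "(pw \<kappa> has_real_derivative (\<kappa> + 1) * \<bar>z\<bar> powr \<kappa>) (at z within {-m..m})" for z
      using pw_has_derivative[OF k] by (rule DERIV_subset) auto
    show "norm ((\<kappa> + 1) * \<bar>z\<bar> powr \<kappa>) \<le> (\<kappa> + 1) * m powr \<kappa>" if "z \<in> {-m..m}" for z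
      using that k by (auto simp: abs_mult intro!: powr_mono2)
  qed (use assms in auto)
  then show ?thesis by simp
qed

lemma powr_diff_le:
  assumes "0 \<le> y" "y \<le> x" "0 < \<gamma>" "\<gamma> \<le> 1"
  shows "x powr \<gamma> - y powr \<gamma> \<le> (x - y) powr (\<gamma>::real)"
proof (cases "x = 0")
  case False
  then have x: "x > 0" using assms by auto
  have *: "r \<le> r powr \<gamma>" if "0 \<le> r" "r \<le> 1" for r :: real
    using powr_mono'[of \<gamma> 1 r] that assms by (cases "r = 0") auto
  \<comment> \<open>The two ratios lie in the unit interval and add up to 1, and a power with
    exponent at most 1 only increases each of them.\<close>
  have "1 \<le> (y/x) powr \<gamma> + ((x - y)/x) powr \<gamma>"
    using *[of "y/x"] *[of "(x-y)/x"] assms x by (auto simp: diff_divide_distrib)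
  then have "x powr \<gamma> * 1 \<le> x powr \<gamma> * ((y/x) powr \<gamma> + ((x - y)/x) powr \<gamma>)"
    by (intro mult_left_mono) auto
  also have "\<dots> = y powr \<gamma> + (x - y) powr \<gamma>"
    using x assms by (simp add: powr_divide distrib_left)
  finally show ?thesis by simp
qed (use assms in auto)

text \<open>Factoring x^\<kappa> - y^\<kappa> as a difference of squares leaves the exponent
  \<kappa>/2, which is at most 1. This treats \<kappa> below and above 1 together.\<close>

lemma abs_powr_diff_le:
  assumes k: "0 < \<kappa>" "\<kappa> \<le> 2" and "0 \<le> x" "x \<le> m" "0 \<le> y" "y \<le> (m::real)"
  shows "\<bar>x powr \<kappa> - y powr \<kappa>\<bar> \<le> 2 * m powr (\<kappa>/2) * \<bar>x - y\<bar> powr (\<kappa>/2)"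
proof -
  have *: "\<bar>x powr \<kappa> - y powr \<kappa>\<bar> \<le> 2 * m powr (\<kappa>/2) * \<bar>x - y\<bar> powr (\<kappa>/2)"
    if "0 \<le> y" "y \<le> x" "x \<le> m" for x y
  proof -
    have "x powr \<kappa> - y powr \<kappa> = (x powr (\<kappa>/2) - y powr (\<kappa>/2)) * (x powr (\<kappa>/2) + y powr (\<kappa>/2))"
      by (simp add: algebra_simps flip: powr_add)
    also have "\<dots> \<le> (x - y) powr (\<kappa>/2) * (m powr (\<kappa>/2) + m powr (\<kappa>/2))"
      using that k by (intro mult_mono powr_diff_le add_mono powr_mono2) auto
    finally show ?thesis using that k powr_mono2[of \<kappa> y x] by (simp add: algebra_simps)
  qed
  show ?thesis
    using *[of y x] *[of x y] assms by (cases "y \<le> x") (auto simp: abs_minus_commute)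
qed

text \<open>\<kappa> may be smaller than 1, where the nonlinearity has no second derivative at 0.
  Its derivative is still Hoelder continuous of exponent \<kappa>/2 on bounded sets, so the
  first-order Taylor remainder has order 1 + \<kappa>/2, enough for a gain over linear size.\<close>

lemma pw_taylor:
  assumes k: "0 < \<kappa>" "\<kappa> \<le> 2" and m: "\<bar>\<xi>\<bar> \<le> m" "\<bar>\<eta>\<bar> \<le> m"
  shows "\<bar>pw \<kappa> \<xi> - pw \<kappa> \<eta> - (\<kappa> + 1) * \<bar>\<eta>\<bar> powr \<kappa> * (\<xi> - \<eta>)\<bar> \<le> 2 * (\<kappa> + 1) * m powr (\<kappa>/2) * \<bar>\<xi> - \<eta>\<bar> powr (\<kappa>/2) * \<bar>\<xi> - \<eta>\<bar>"
proof -
  define h where "h = (\<lambda>z. pw \<kappa> z - (\<kappa> + 1) * \<bar>\<eta>\<bar> powr \<kappa> * z)"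
  have "norm (h \<xi> - h \<eta>) \<le> (2 * (\<kappa> + 1) * m powr (\<kappa>/2) * \<bar>\<xi> - \<eta>\<bar> powr (\<kappa>/2)) * norm (\<xi> - \<eta>)"
  proof (rule field_differentiable_bound[of "closed_segment \<eta> \<xi>" h "\<lambda>z. (\<kappa> + 1) * \<bar>z\<bar> powr \<kappa> - (\<kappa> + 1) * \<bar>\<eta>\<bar> powr \<kappa>"])
    show "(h has_real_derivative (\<kappa> + 1) * \<bar>z\<bar> powr \<kappa> - (\<kappa> + 1) * \<bar>\<eta>\<bar> powr \<kappa>) (at z within closed_segment \<eta> \<xi>)" for z
      unfolding h_def using k
      by (auto intro!: derivative_eq_intros DERIV_subset[OF pw_has_derivative])
    fix z assume z: "z \<in> closed_segment \<eta> \<xi>"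
    then have z': "\<bar>z\<bar> \<le> m" "\<bar>z - \<eta>\<bar> \<le> \<bar>\<xi> - \<eta>\<bar>" using m by (auto simp: closed_segment_eq_real_ivl split: if_splits)
    have "\<bar>\<bar>z\<bar> powr \<kappa> - \<bar>\<eta>\<bar> powr \<kappa>\<bar> \<le> 2 * m powr (\<kappa>/2) * \<bar>\<bar>z\<bar> - \<bar>\<eta>\<bar>\<bar> powr (\<kappa>/2)"
      using k m z' by (intro abs_powr_diff_le) auto
    also have "\<dots> \<le> 2 * m powr (\<kappa>/2) * \<bar>\<xi> - \<eta>\<bar> powr (\<kappa>/2)"
      using k z' by (intro mult_left_mono powr_mono2) auto
    finally have "(\<kappa> + 1) * \<bar>\<bar>z\<bar> powr \<kappa> - \<bar>\<eta>\<bar> powr \<kappa>\<bar> \<le> (\<kappa> + 1) * (2 * m powr (\<kappa>/2) * \<bar>\<xi> - \<eta>\<bar> powr (\<kappa>/2))"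
      using k by (intro mult_left_mono) auto
    then show "norm ((\<kappa> + 1) * \<bar>z\<bar> powr \<kappa> - (\<kappa> + 1) * \<bar>\<eta>\<bar> powr \<kappa>) \<le> 2 * (\<kappa> + 1) * m powr (\<kappa>/2) * \<bar>\<xi> - \<eta>\<bar> powr (\<kappa>/2)"
      unfolding right_diff_distrib[symmetric] real_norm_def abs_mult using k
      by (simp only: abs_of_pos mult_ac)
  qed auto
  then show ?thesis by (simp add: h_def algebra_simps)
qed

section \<open>Time integrals against test functions, the vanishing flux, and semigroup rules for
  convolutions\<close>

lemma time_integral_pairing:
  fixes F :: "real \<Rightarrow> 'a::euclidean_space \<Rightarrow> real"
  assumes F: "(\<lambda>p. F (fst p) (snd p)) \<in> borel_measurable (borel \<Otimes>\<^sub>M borel)"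
    and S: "S \<in> sets borel"
    and b: "\<And>s. s \<in> S \<Longrightarrow> integrable lborel (F s) \<and> l1 (F s) \<le> b s"
    and bi: "set_integrable lborel S b"
    and [measurable]: "w \<in> borel_measurable borel" and w: "\<And>x. \<bar>w x\<bar> \<le> C"
  shows "(LINT x|lborel. (LINT s:S|lborel. F s x) * w x) = (LINT s:S|lborel. (LINT x|lborel. F s x * w x))"
proof -
  note P = time_pair_integrable[OF F S b bi]
  have [measurable]: "(\<lambda>(s, x). indicator S s * F s x) \<in> borel_measurable (lborel \<Otimes>\<^sub>M lborel)"
    using P by (rule borel_measurable_integrable)
  have C: "C \<ge> 0" using w abs_ge_zero order_trans by blast
  have "integrable (lborel \<Otimes>\<^sub>M lborel) (\<lambda>p. C * (case p of (s, x) \<Rightarrow> indicator S s * F s x))"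
    using P by (intro integrable_mult_right) auto
  then have Q: "integrable (lborel \<Otimes>\<^sub>M lborel) (\<lambda>(s, x). indicator S s * F s x * w x)"
  proof (rule Bochner_Integration.integrable_bound)
    have "(\<lambda>p. (case p of (s, x) \<Rightarrow> indicator S s * F s x) * w (snd p)) \<in> borel_measurable (lborel \<Otimes>\<^sub>M lborel)"
      by measurable
    then show "(\<lambda>(s, x). indicator S s * F s x * w x) \<in> borel_measurable (lborel \<Otimes>\<^sub>M lborel)"
      by (simp add: case_prod_beta')
    have "\<bar>w x\<bar> * \<bar>indicator S s * F s x\<bar> \<le> C * \<bar>indicator S s * F s x\<bar>" for x s
      using w by (intro mult_right_mono) auto
    then show "AE p in lborel \<Otimes>\<^sub>M lborel. norm (case p of (s, x) \<Rightarrow> indicator S s * F s x * w x) \<le> norm (C * (case p of (s, x) \<Rightarrow> indicator S s * F s x))"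
      using C by (intro AE_I2) (auto simp: abs_mult mult_ac)
  qed
  have "(LINT x|lborel. (LINT s:S|lborel. F s x) * w x) = (LINT x|lborel. LINT s|lborel. indicator S s * F s x * w x)"
    by (simp add: set_lebesgue_integral_def)
  also have "\<dots> = (LINT s|lborel. LINT x|lborel. indicator S s * F s x * w x)"
    by (rule lborel_pair.Fubini_integral[OF Q])
  also have "\<dots> = (LINT s:S|lborel. (LINT x|lborel. F s x * w x))"
    by (simp add: set_lebesgue_integral_def mult.assoc)
  finally show ?thesis .
qed

lemma kconv_time_integral:
  fixes F :: "real \<Rightarrow> 'a::euclidean_space \<Rightarrow> real"
  assumes F: "(\<lambda>p. F (fst p) (snd p)) \<in> borel_measurable (borel \<Otimes>\<^sub>M borel)"
    and S: "S \<in> sets borel"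
    and b: "\<And>s. s \<in> S \<Longrightarrow> integrable lborel (F s) \<and> l1 (F s) \<le> b s"
    and bi: "set_integrable lborel S b" and L: "L1b L"
  shows "kconv L (\<lambda>x. LINT s:S|lborel. F s x) x = (LINT s:S|lborel. kconv L (F s) x)"
proof -
  from L obtain C where C: "\<And>x. \<bar>L x\<bar> \<le> C" by (rule L1b_bound) blast
  have [measurable]: "L \<in> borel_measurable borel" using L by auto
  show ?thesis
    using time_integral_pairing[OF F S b bi, of "\<lambda>y. L (x - y)" C] C
    by (simp add: kconv_def mult.commute)
qed

text \<open>The integrand is the derivative along \<open>a\<close> of |z|^(\<kappa> + 2) / (\<kappa>
  + 2). Translation invariance takes the place of a divergence theorem: the increment of this
  function under a shift by \<open>a\<close> has integral zero, and it is the average over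
  \<open>k\<close> between 0 and 1 of translates of the integrand, all of which have the same
  integral.\<close>

lemma pw_dheat_orthogonal:
  fixes w :: "'a::euclidean_space \<Rightarrow> real"
  assumes t: "t > 0" and w: "L1b w" and k: "\<kappa> > 0"
  shows "(LINT x|lborel. pw \<kappa> (kconv (heat_kernel t) w x) * kconv (dheat_kernel a t) w x) = 0"
proof -
  define z where "z = kconv (heat_kernel t) w"
  define z' where "z' = kconv (dheat_kernel a t) w"
  define q where "q = (\<lambda>x. pw \<kappa> (z x) * z' x)"
  define \<Phi> where "\<Phi> = (\<lambda>x. \<bar>z x\<bar> powr (\<kappa> + 2) / (\<kappa> + 2))"
  have zL: "L1b z" "L1b z'" unfolding z_def z'_def
    by (intro kconv_L1b L1b_heat_kernel L1b_dheat_kernel t w)+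
  have [measurable]: "z \<in> borel_measurable borel" "z' \<in> borel_measurable borel" using zL by auto
  have cz: "continuous_on UNIV z" unfolding z_def using t w heat_kernel_le[OF t]
    by (intro kconv_continuous[where B="t powr (- real DIM('a) / 2)"]) (auto intro!: continuous_intros simp: L1b_integrable)
  have cz': "continuous_on UNIV z'" unfolding z'_def
    using t w by (intro kconv_continuous[OF _ dheat_kernel_le[OF t]]) (auto intro!: continuous_intros simp: L1b_integrable)
  have cpw: "continuous_on UNIV (pw \<kappa>)"
    using DERIV_isCont[OF pw_has_derivative[OF k]] by (auto intro: continuous_at_imp_continuous_on)
  have cq: "continuous_on UNIV q" unfolding q_def
    by (intro continuous_intros continuous_on_compose2[OF cpw cz] cz') auto
  from zL(1) obtain m where m: "m \<ge> 0" "\<And>x. \<bar>z x\<bar> \<le> m" by (rule L1b_bound) auto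
  have qi: "integrable lborel q" unfolding q_def
  proof (rule integrable_mult_bounded(2)[OF L1b_integrable[OF zL(2)]])
    show "\<bar>pw \<kappa> (z x)\<bar> \<le> m powr \<kappa> * m" for x
      unfolding abs_pw using m k by (intro mult_mono powr_mono2) auto
  qed simp
  have \<Phi>i: "integrable lborel \<Phi>"
  proof (rule l1_bounded_le(1)[where h="\<lambda>x. m powr (\<kappa> + 1) * \<bar>z x\<bar>"])
    show "integrable lborel (\<lambda>x. m powr (\<kappa> + 1) * \<bar>z x\<bar>)" using L1b_integrable[OF zL(1)] by auto
    show "\<bar>\<Phi> x\<bar> \<le> m powr (\<kappa> + 1) * \<bar>z x\<bar>" for x
    proof -
      have "\<bar>\<Phi> x\<bar> \<le> \<bar>z x\<bar> powr (\<kappa> + 2)" unfolding \<Phi>_def using k by (simp add: field_simps)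
      also have "\<dots> = \<bar>z x\<bar> powr (\<kappa> + 1) * \<bar>z x\<bar>"
      proof -
        have "\<bar>z x\<bar> powr ((\<kappa> + 1) + 1) = \<bar>z x\<bar> powr (\<kappa> + 1) * \<bar>z x\<bar>"
          by (subst powr_add) simp
        then show ?thesis by (simp add: add.assoc)
      qed
      also have "\<dots> \<le> m powr (\<kappa> + 1) * \<bar>z x\<bar>" using m k by (intro mult_right_mono powr_mono2) auto
      finally show ?thesis .
    qed
  qed (simp add: \<Phi>_def)
  have [measurable]: "q \<in> borel_measurable borel" "\<Phi> \<in> borel_measurable borel" using qi \<Phi>i by auto
  have dz: "((\<lambda>k. z (x + k *\<^sub>R a)) has_real_derivative z' (x + k *\<^sub>R a)) (at k)" for x k
    unfolding z_def z'_def by (rule kconv_heat_has_dir_derivative[OF t L1b_integrable[OF w]])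
  have d\<Phi>: "((\<lambda>k. \<Phi> (x + k *\<^sub>R a)) has_real_derivative q (x + k *\<^sub>R a)) (at k)" for x k
    unfolding \<Phi>_def q_def by (rule DERIV_chain2[OF pw_antiderivative[OF k] dz])
  have ftc: "(LINT k|lborel. q (x + k *\<^sub>R a) * indicator {0..1} k) = \<Phi> (x + a) - \<Phi> x" for x
  proof -
    have "isCont (\<lambda>k. q (x + k *\<^sub>R a)) k" for k
      by (intro continuous_on_interior[of UNIV]) (auto intro!: continuous_on_compose2[OF cq] continuous_intros)
    from integral_FTC_Icc_real[of 0 1 "\<lambda>k. \<Phi> (x + k *\<^sub>R a)" "\<lambda>k. q (x + k *\<^sub>R a)", OF _ d\<Phi> this]
    show ?thesis by simp
  qed
  have qs: "integrable lborel (\<lambda>x. q (x + c))" "(LINT x|lborel. q (x + c)) = (LINT x|lborel. q x)"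
    "(LINT x|lborel. \<bar>q (x + c)\<bar>) = (LINT x|lborel. \<bar>q x\<bar>)" for c
    using integral_lborel_shift[of q c] integrable_lborel_shift[of q c] integral_lborel_shift[of "\<lambda>x. \<bar>q x\<bar>" c] qi
    by (auto simp: add.commute)
  have P: "integrable (lborel \<Otimes>\<^sub>M lborel) (\<lambda>(k, x). q (x + k *\<^sub>R a) * indicator {0..1} k)"
  proof (rule lborel_pair.Fubini_integrable)
    show "integrable lborel (\<lambda>k. LINT x|lborel. norm (case (k, x) of (k, x) \<Rightarrow> q (x + k *\<^sub>R a) * indicator {0..1::real} k))"
      by (simp add: abs_mult qs(3))
    show "AE k in lborel. integrable lborel (\<lambda>x. case (k, x) of (k, x) \<Rightarrow> q (x + k *\<^sub>R a) * indicator {0..1::real} k)"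
      by (simp add: qs(1))
  qed measurable
  have "0 = (LINT x|lborel. \<Phi> (x + a) - \<Phi> x)"
    using integral_lborel_shift[of \<Phi> a] integrable_lborel_shift[of \<Phi> a] \<Phi>i
    by (simp add: add.commute)
  also have "\<dots> = (LINT x|lborel. LINT k|lborel. q (x + k *\<^sub>R a) * indicator {0..1} k)"
    by (simp add: ftc)
  also have "\<dots> = (LINT k|lborel. LINT x|lborel. q (x + k *\<^sub>R a) * indicator {0..1} k)"
    by (rule lborel_pair.Fubini_integral[OF P])
  also have "\<dots> = (LINT x|lborel. q x)"
    by (simp add: qs(2))
  finally show ?thesis by (simp add: q_def z_def z'_def)
qed

lemma
  assumes t: "t > 0" and g: "L1b g"
  shows kconv_heat_heat: "s > 0 \<Longrightarrow> kconv (heat_kernel s) (kconv (heat_kernel t) g) x = kconv (heat_kernel (s + t)) g x"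
    and kconv_heat_dheat: "s > 0 \<Longrightarrow> kconv (heat_kernel s) (kconv (dheat_kernel a t) g) x = kconv (dheat_kernel a (s + t)) g x"
    and kconv_dheat_heat: "s > 0 \<Longrightarrow> kconv (dheat_kernel a s) (kconv (heat_kernel t) g) x = kconv (dheat_kernel a (s + t)) g x"
    and kconv_dheat_dheat: "s > 0 \<Longrightarrow> kconv (dheat_kernel b s) (kconv (dheat_kernel a t) g) x = kconv (ddheat_kernel a b (s + t)) g x"
proof -
  assume s: "s > 0"
  have e: "kconv (heat_kernel s) (heat_kernel t) = heat_kernel (s + t)"
    "kconv (heat_kernel s) (dheat_kernel a t) = dheat_kernel a (s + t)"
    "kconv (dheat_kernel a s) (heat_kernel t) = dheat_kernel a (s + t)"
    "kconv (dheat_kernel b s) (dheat_kernel a t) = ddheat_kernel a b (s + t)"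
    by (auto simp: heat_kernel_semigroup[OF s t] dheat_kernel_semigroup[OF s t] ddheat_kernel_semigroup[OF s t] fun_eq_iff)
  note L = L1b_heat_kernel[OF s] L1b_heat_kernel[OF t] L1b_dheat_kernel[OF s] L1b_dheat_kernel[OF t]
  show "kconv (heat_kernel s) (kconv (heat_kernel t) g) x = kconv (heat_kernel (s + t)) g x"
    "kconv (heat_kernel s) (kconv (dheat_kernel a t) g) x = kconv (dheat_kernel a (s + t)) g x"
    "kconv (dheat_kernel a s) (kconv (heat_kernel t) g) x = kconv (dheat_kernel a (s + t)) g x"
    "kconv (dheat_kernel b s) (kconv (dheat_kernel a t) g) x = kconv (ddheat_kernel a b (s + t)) g x"
    using kconv_assoc[OF L(1) L(2) g] kconv_assoc[OF L(1) L(4) g] kconv_assoc[OF L(3) L(2) g] kconv_assoc[OF L(3) L(4) g]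
    by (simp_all add: e)
qed

section \<open>Mild solutions\<close>

text \<open>A regular representative of the solution: jointly Borel, with Duhamel's formula and the
  bounds valid at every point and positive time, and with one \<open>M\<close> for the L^1 and the
  sup norm. \<open>mild_representative\<close> extracts it from
  \<open>global_solution\<close>.\<close>

locale mild_solution =
  fixes a :: "'a::euclidean_space" and \<kappa> M :: real and v :: "real \<Rightarrow> 'a \<Rightarrow> real" and w0 :: "'a \<Rightarrow> real"
  assumes kappa: "\<kappa> = 3 / (2 * real DIM('a))"
    and M: "M > 0"
    and v_joint [measurable]: "(\<lambda>p. v (fst p) (snd p)) \<in> borel_measurable (borel \<Otimes>\<^sub>M borel)"
    and v_integrable: "\<And>t. t > 0 \<Longrightarrow> integrable lborel (v t)"
    and v_l1: "\<And>t. t > 0 \<Longrightarrow> l1 (v t) \<le> M"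
    and v_bound: "\<And>t x. t > 0 \<Longrightarrow> \<bar>v t x\<bar> \<le> M"
    and w0: "L1b w0" and w0_moment: "integrable lborel (\<lambda>y. norm y * w0 y)"
    and duhamel: "\<And>t x. t > 0 \<Longrightarrow> v t x = kconv (heat_kernel t) w0 x + duh a (\<lambda>s y. pw \<kappa> (v s y)) t x"
begin

definition g where "g s y = pw \<kappa> (v s y)"
definition B where "B = M powr \<kappa> * M"
definition cD where "cD = kernel_const TYPE('a) * norm a"

lemma k0: "\<kappa> > 0" and k2: "\<kappa> \<le> 2"
proof -
  have n: "real DIM('a) \<ge> 1" using DIM_positive[where 'a='a] by linarith
  then show "\<kappa> > 0" unfolding kappa by auto
  have "3 / (2 * real DIM('a)) \<le> 3 / (2 * 1)" using n by (intro divide_left_mono) auto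
  then show "\<kappa> \<le> 2" unfolding kappa by linarith
qed

lemma B0: "B > 0" and cD0: "cD \<ge> 0"
  using M by (simp_all add: B_def cD_def)

lemma v_measurable [measurable]: "v t \<in> borel_measurable borel"
  using measurable_compose[OF measurable_Pair1'[of t borel borel] v_joint] by simp

lemma g_joint [measurable]: "(\<lambda>p. g (fst p) (snd p)) \<in> borel_measurable (borel \<Otimes>\<^sub>M borel)"
  unfolding g_def by measurable

lemma g_measurable [measurable]: "g t \<in> borel_measurable borel"
  unfolding g_def by measurable

lemma v_L1b: "t > 0 \<Longrightarrow> L1b (v t)"
  by (rule L1bI[OF _ v_integrable v_bound]) auto

lemma g_bound: "t > 0 \<Longrightarrow> \<bar>g t x\<bar> \<le> B"
  unfolding g_def abs_pw B_def using v_bound k0 M by (intro mult_mono powr_mono2) auto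

lemma
  assumes "t > 0"
  shows g_integrable: "integrable lborel (g t)" and g_l1: "l1 (g t) \<le> B"
proof -
  have "\<bar>g t x\<bar> \<le> M powr \<kappa> * \<bar>v t x\<bar>" for x
    unfolding g_def abs_pw using v_bound[OF assms] k0 by (intro mult_right_mono powr_mono2) auto
  moreover have "integrable lborel (\<lambda>x. M powr \<kappa> * \<bar>v t x\<bar>)" using v_integrable[OF assms] by auto
  ultimately have "integrable lborel (g t)" "l1 (g t) \<le> M powr \<kappa> * l1 (v t)"
    using l1_bounded_le[of "\<lambda>x. M powr \<kappa> * \<bar>v t x\<bar>" "g t"] by (auto simp: l1_def)
  moreover have "M powr \<kappa> * l1 (v t) \<le> B" unfolding B_def using v_l1[OF assms] by (intro mult_left_mono) auto
  ultimately show "integrable lborel (g t)" "l1 (g t) \<le> B" by auto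
qed

lemma g_L1b: "t > 0 \<Longrightarrow> L1b (g t)"
  by (rule L1bI[OF _ g_integrable g_bound]) auto

lemma kconv_g_bounds:
  assumes "s > 0" and K: "L1b K" "l1 K \<le> c"
  shows "integrable lborel (kconv K (g s))" "l1 (kconv K (g s)) \<le> c * B" "\<bar>kconv K (g s) x\<bar> \<le> c * B"
proof -
  have c: "c \<ge> 0" using l1_nonneg[of K] K by linarith
  note gs = g_L1b[OF assms(1)] g_l1[OF assms(1)] g_bound[OF assms(1)]
  show "integrable lborel (kconv K (g s))" using kconv_l1(1)[OF L1b_integrable[OF K(1)] L1b_integrable[OF gs(1)]] .
  have "l1 (kconv K (g s)) \<le> l1 K * l1 (g s)" using kconv_l1(2)[OF L1b_integrable[OF K(1)] L1b_integrable[OF gs(1)]] .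
  also have "\<dots> \<le> c * B" using gs K c by (intro mult_mono) auto
  finally show "l1 (kconv K (g s)) \<le> c * B" .
  have "\<bar>kconv K (g s) x\<bar> \<le> l1 K * B" using gs by (intro kconv_le2[OF L1b_integrable[OF K(1)]]) auto
  also have "\<dots> \<le> c * B" using K B0 by (intro mult_right_mono) auto
  finally show "\<bar>kconv K (g s) x\<bar> \<le> c * B" .
qed

lemmas kconv_dg_bounds = kconv_g_bounds[OF _ L1b_dheat_kernel l1_dheat_kernel, of _ _ a, folded cD_def]

text \<open>The part of Duhamel's integral produced between \<open>r\<close> and
  \<open>r + h\<close> and observed at \<open>r + h\<close>; it is the deviation of the solution
  from the heat flow restarted at \<open>r\<close>.\<close>

definition W where "W r h x = (LINT s:{r<..<r + h}|lborel. kconv (dheat_kernel a (r + h - s)) (g s) x)"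

lemma dg_joint [measurable]: "(\<lambda>p. kconv (dheat_kernel a (t - fst p)) (g (fst p)) (snd p)) \<in> borel_measurable (borel \<Otimes>\<^sub>M borel)"
  by (rule kconv_dheat_joint_measurable) measurable

lemma dg_meas [measurable]: "(\<lambda>s. kconv (dheat_kernel a (t - s)) (g s) x) \<in> borel_measurable borel"
  using measurable_compose[OF measurable_Pair2'[of x borel borel] dg_joint[of t]] by simp

lemma half_integrable: "h \<ge> 0 \<Longrightarrow> set_integrable lborel {r<..<r + h} (\<lambda>s. cD * (r + h - s) powr (-1/2) * B)"
  and half_integral: "h \<ge> 0 \<Longrightarrow> (LINT s:{r<..<r + h}|lborel. cD * (r + h - s) powr (-1/2) * B) = 2 * cD * B * h powr (1/2)"
  using powr_integrable'[of "1/2" h r] powr_integral'[of "1/2" h r]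
  by auto

lemma dg_integrable:
  assumes r: "r \<ge> 0" "h \<ge> 0" and u: "r + h \<le> u"
  shows "set_integrable lborel {r<..<r + h} (\<lambda>s. kconv (dheat_kernel a (u - s)) (g s) x)"
proof (rule set_integrable_dominated[OF _ _ _ half_integrable[OF r(2)]])
  fix s assume s: "s \<in> {r<..<r + h}"
  have "\<bar>kconv (dheat_kernel a (u - s)) (g s) x\<bar> \<le> cD * (u - s) powr (-1/2) * B"
    using s u r by (intro kconv_dg_bounds) auto
  also have "\<dots> \<le> cD * (r + h - s) powr (-1/2) * B"
    using s u r B0 cD0 by (intro mult_right_mono mult_left_mono powr_mono2') auto
  finally show "\<bar>kconv (dheat_kernel a (u - s)) (g s) x\<bar> \<le> cD * (r + h - s) powr (-1/2) * B" .
qed auto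

lemma
  assumes r: "r \<ge> 0" "h \<ge> 0"
  shows W_integrable: "integrable lborel (W r h)" and W_l1: "l1 (W r h) \<le> 2 * cD * B * h powr (1/2)"
proof -
  have *: "integrable lborel (kconv (dheat_kernel a (r + h - s)) (g s)) \<and> l1 (kconv (dheat_kernel a (r + h - s)) (g s)) \<le> cD * (r + h - s) powr (-1/2) * B"
    if "s \<in> {r<..<r + h}" for s
    using that r kconv_dg_bounds[of s "r + h - s"] by auto
  show "integrable lborel (W r h)" "l1 (W r h) \<le> 2 * cD * B * h powr (1/2)"
    using time_l1[OF dg_joint _ * half_integrable] r half_integral[of h r] by (auto simp: W_def[abs_def] mult_ac)
qed

lemma kconv_W:
  assumes r: "r \<ge> 0" "h \<ge> 0" and L: "L1b L"
  shows "kconv L (W r h) x = (LINT s:{r<..<r + h}|lborel. kconv L (kconv (dheat_kernel a (r + h - s)) (g s)) x)"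
proof -
  have *: "integrable lborel (kconv (dheat_kernel a (r + h - s)) (g s)) \<and> l1 (kconv (dheat_kernel a (r + h - s)) (g s)) \<le> cD * (r + h - s) powr (-1/2) * B"
    if "s \<in> {r<..<r + h}" for s
    using that r kconv_dg_bounds[of s "r + h - s"] by auto
  show ?thesis
    unfolding W_def[abs_def] by (rule kconv_time_integral[OF dg_joint _ * half_integrable[OF r(2)] L]) auto
qed

lemma duhamel_W: "t > 0 \<Longrightarrow> v t x = kconv (heat_kernel t) w0 x + W 0 t x"
  using duhamel by (simp add: W_def duh_def g_def[abs_def])

text \<open>Applying the heat semigroup over time \<open>h\<close> to Duhamel's formula at
  \<open>t\<close> advances every kernel by \<open>h\<close>, so the history before \<open>t\<close>
  is reproduced exactly and only the window after \<open>t\<close> remains.\<close>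

lemma restart:
  assumes t: "t > 0" and h: "h > 0"
  shows "v (t + h) x = kconv (heat_kernel h) (v t) x + W t h x"
proof -
  have vt: "v t = (\<lambda>x. kconv (heat_kernel t) w0 x + W 0 t x)" using duhamel_W[OF t] by auto
  have "kconv (heat_kernel h) (v t) x = kconv (heat_kernel h) (kconv (heat_kernel t) w0) x + kconv (heat_kernel h) (W 0 t) x"
    unfolding vt using t h
    by (intro kconv_diff_right(2) W_integrable L1b_heat_kernel L1b_integrable kconv_L1b w0) auto
  also have "kconv (heat_kernel h) (kconv (heat_kernel t) w0) x = kconv (heat_kernel (t + h)) w0 x"
    using kconv_heat_heat[OF t w0 h] by (simp add: add.commute)
  also have "kconv (heat_kernel h) (W 0 t) x = (LINT s:{0<..<t}|lborel. kconv (heat_kernel h) (kconv (dheat_kernel a (t - s)) (g s)) x)"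
    using kconv_W[of 0 t "heat_kernel h" x] t h by (simp add: L1b_heat_kernel)
  also have "\<dots> = (LINT s:{0<..<t}|lborel. kconv (dheat_kernel a (t + h - s)) (g s) x)"
    using h by (intro set_lebesgue_integral_cong) (auto simp: kconv_heat_dheat g_L1b add.commute add_diff_eq)
  finally have 1: "kconv (heat_kernel h) (v t) x = kconv (heat_kernel (t + h)) w0 x + (LINT s:{0<..<t}|lborel. kconv (dheat_kernel a (t + h - s)) (g s) x)" .
  \<comment> \<open>The single time \<open>s = t\<close> belongs to neither of the two open windows
    and is a null set.\<close>
  have "W 0 (t + h) x = (LINT s:{0<..<t} \<union> {t<..<t + h}|lborel. kconv (dheat_kernel a (t + h - s)) (g s) x)"
    unfolding W_def set_lebesgue_integral_def
  proof (rule integral_cong_AE)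
    show "AE s in lborel. indicat_real {0<..<0 + (t + h)} s *\<^sub>R kconv (dheat_kernel a (0 + (t + h) - s)) (g s) x =
         indicat_real ({0<..<t} \<union> {t<..<t + h}) s *\<^sub>R kconv (dheat_kernel a (t + h - s)) (g s) x"
      using AE_lborel_singleton[of t] by eventually_elim (use t h in \<open>auto simp: indicator_def\<close>)
  qed auto
  also have "\<dots> = (LINT s:{0<..<t}|lborel. kconv (dheat_kernel a (t + h - s)) (g s) x) + W t h x"
    unfolding W_def using t h dg_integrable[of 0 t "t + h" x] dg_integrable[of t h "t + h" x]
    by (intro set_integral_Un) auto
  finally show ?thesis using 1 duhamel_W[of "t + h" x] t h by simp
qed

lemma restart_l1:
  assumes t: "t > 0" and h: "h > 0"
  shows "l1 (\<lambda>x. v (t + h) x - kconv (heat_kernel h) (v t) x) \<le> 2 * cD * B * h powr (1/2)"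
  using W_l1[of t h] t h by (simp add: restart[OF t h])

lemma kconv_restart:
  assumes t: "t > 0" and h: "h > 0" and L: "L1b L"
  shows "kconv L (v (t + h)) x = kconv L (kconv (heat_kernel h) (v t)) x +
    (LINT s:{t<..<t + h}|lborel. kconv L (kconv (dheat_kernel a (t + h - s)) (g s)) x)"
proof -
  have vt: "v (t + h) = (\<lambda>x. kconv (heat_kernel h) (v t) x + W t h x)" using restart[OF t h] by auto
  have "kconv L (v (t + h)) x = kconv L (kconv (heat_kernel h) (v t)) x + kconv L (W t h) x"
    unfolding vt using t h L
    by (intro kconv_diff_right(2) W_integrable L1b_heat_kernel L1b_integrable[OF kconv_L1b] v_L1b) auto
  with kconv_W[of t h L x] t h L show ?thesis by simp
qed

section \<open>Energy decay\<close>

definition C3 where "C3 = cD * M + 4 * (kernel_const TYPE('a) * norm a * norm a) * B"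

lemma C3_nonneg: "C3 \<ge> 0"
  using M B0 cD0 by (simp add: C3_def)

text \<open>The sup bound on \<open>v t\<close> alone would only give the exponent 1/2. Restarting
  one time unit earlier makes the heat part harmless, and in the Duhamel part the two derivative
  kernels compose to a second derivative at time \<sigma> + \<tau>, of L^1 size 1 / (\<sigma> +
  \<tau>). Splitting this with weights 1/4 and 3/4 leaves an integrable singularity in \<tau>; its
  integral over the unit window is the factor 4 in \<open>C3\<close>.\<close>

lemma dheat_v_bound:
  assumes t: "t \<ge> 2" and \<sigma>: "0 < \<sigma>" "\<sigma> \<le> 1"
  shows "\<bar>kconv (dheat_kernel a \<sigma>) (v t) x\<bar> \<le> C3 * \<sigma> powr (-1/4)"
proof -
  define r where "r = t - 1"
  have r: "r > 0" "t = r + 1" using t by (auto simp: r_def)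
  have s1: "\<sigma> powr (-1/4) \<ge> 1" using powr_mono'[of "-1/4" 0 \<sigma>] \<sigma> by simp
  have 1: "\<bar>kconv (dheat_kernel a \<sigma>) (kconv (heat_kernel 1) (v r)) x\<bar> \<le> cD * M * \<sigma> powr (-1/4)"
  proof -
    have "kconv (dheat_kernel a \<sigma>) (kconv (heat_kernel 1) (v r)) x = kconv (dheat_kernel a (\<sigma> + 1)) (v r) x"
      using kconv_dheat_heat[of 1 "v r" \<sigma> a x] r \<sigma> v_L1b by simp
    also have "\<bar>\<dots>\<bar> \<le> l1 (dheat_kernel a (\<sigma> + 1)) * M"
      using \<sigma> r v_bound by (intro kconv_le2 L1b_integrable[OF L1b_dheat_kernel]) auto
    also have "\<dots> \<le> (cD * (\<sigma> + 1) powr (-1/2)) * M"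
      using \<sigma> M l1_dheat_kernel[of "\<sigma> + 1" a] by (intro mult_right_mono) (auto simp: cD_def)
    also have "\<dots> \<le> (cD * 1) * M"
      using \<sigma> M cD0 powr_mono2'[of "-1/2" 1 "\<sigma> + 1"] by (intro mult_right_mono mult_left_mono) auto
    also have "\<dots> \<le> cD * M * \<sigma> powr (-1/4)"
      using mult_left_mono[OF s1, of "cD * M"] cD0 M by simp
    finally show ?thesis .
  qed
  define c where "c = kernel_const TYPE('a) * norm a * norm a * B * \<sigma> powr (-1/4)"
  have 2: "\<bar>LINT s:{r<..<r + 1}|lborel. kconv (dheat_kernel a \<sigma>) (kconv (dheat_kernel a (r + 1 - s)) (g s)) x\<bar>
      \<le> (LINT s:{r<..<r + 1}|lborel. c * (r + 1 - s) powr (-(3/4)))"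
  proof -
    have eq: "(LINT s:{r<..<r + 1}|lborel. kconv (dheat_kernel a \<sigma>) (kconv (dheat_kernel a (r + 1 - s)) (g s)) x) =
        (LINT s:{r<..<r + 1}|lborel. kconv (ddheat_kernel a a (\<sigma> + (r + 1 - s))) (g s) x)"
      using r \<sigma> by (intro set_lebesgue_integral_cong) (auto simp: kconv_dheat_dheat g_L1b)
    show ?thesis unfolding eq
    proof (rule set_integral_dominated)
      have [measurable]: "(\<lambda>q. g (fst q) (snd q)) \<in> borel_measurable (borel \<Otimes>\<^sub>M borel)" by measurable
      show "(\<lambda>s. kconv (ddheat_kernel a a (\<sigma> + (r + 1 - s))) (g s) x) \<in> borel_measurable borel"
        unfolding kconv_def by measurable
      show "set_integrable lborel {r<..<r + 1} (\<lambda>s. c * (r + 1 - s) powr (-(3/4)))"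
        using powr_integrable'[of "3/4" 1 r] by auto
      fix s assume s: "s \<in> {r<..<r + 1}"
      define \<tau> where "\<tau> = r + 1 - s"
      have \<tau>: "\<tau> > 0" "\<sigma> + \<tau> > 0" using s \<sigma> by (auto simp: \<tau>_def)
      have "\<sigma> powr (1/4) * \<tau> powr (3/4) \<le> (\<sigma> + \<tau>) powr (1/4) * (\<sigma> + \<tau>) powr (3/4)"
        using \<tau> \<sigma> by (intro mult_mono powr_mono2) auto
      also have "\<dots> = \<sigma> + \<tau>" using \<tau> by (simp flip: powr_add)
      finally have le: "1 / (\<sigma> + \<tau>) \<le> \<sigma> powr (-1/4) * \<tau> powr (-(3/4))"
        using \<tau> \<sigma> by (simp add: powr_minus field_simps)
      have "\<bar>kconv (ddheat_kernel a a (\<sigma> + \<tau>)) (g s) x\<bar> \<le> (kernel_const TYPE('a) * norm a * norm a / (\<sigma> + \<tau>)) * B"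
        using s r \<tau> by (intro kconv_g_bounds L1b_ddheat_kernel l1_ddheat_kernel) auto
      also have "\<dots> = (kernel_const TYPE('a) * norm a * norm a * B) * (1 / (\<sigma> + \<tau>))" by simp
      also have "\<dots> \<le> (kernel_const TYPE('a) * norm a * norm a * B) * (\<sigma> powr (-1/4) * \<tau> powr (-(3/4)))"
        using B0 by (intro mult_left_mono le) auto
      finally show "\<bar>kconv (ddheat_kernel a a (\<sigma> + (r + 1 - s))) (g s) x\<bar> \<le> c * (r + 1 - s) powr (-(3/4))"
        by (simp add: \<tau>_def c_def mult.assoc)
    qed auto
  qed
  also have "\<dots> = 4 * c" using powr_integral'[of "3/4" 1 r] by simp
  finally have 3: "\<bar>LINT s:{r<..<r + 1}|lborel. kconv (dheat_kernel a \<sigma>) (kconv (dheat_kernel a (r + 1 - s)) (g s)) x\<bar> \<le> 4 * c" .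
  have "kconv (dheat_kernel a \<sigma>) (v t) x = kconv (dheat_kernel a \<sigma>) (kconv (heat_kernel 1) (v r)) x +
     (LINT s:{r<..<r + 1}|lborel. kconv (dheat_kernel a \<sigma>) (kconv (dheat_kernel a (r + 1 - s)) (g s)) x)"
    unfolding r(2) using r \<sigma> by (intro kconv_restart L1b_dheat_kernel) auto
  with 1 3 have "\<bar>kconv (dheat_kernel a \<sigma>) (v t) x\<bar> \<le> cD * M * \<sigma> powr (-1/4) + 4 * c" by linarith
  then show ?thesis by (simp add: C3_def c_def algebra_simps)
qed

definition C2 where "C2 = kernel_const TYPE('a) * M + 16 * cD * B"

lemma C2_nonneg: "C2 \<ge> 0"
  using M B0 cD0 by (simp add: C2_def)

text \<open>Interpolation between two bounds: the triangle inequality, good when \<tau> is at most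
  \<sigma>, and the time derivative, good otherwise. The exponent 7/8 stays below 1 so that the
  singularity can be integrated in \<tau>.\<close>

lemma l1_dheat_time_holder:
  assumes "\<tau> > 0" "0 < \<sigma>"
  shows "l1 (\<lambda>x. dheat_kernel a (\<sigma> + \<tau>) x - dheat_kernel a \<tau> x) \<le> 2 * cD * \<sigma> powr (3/8) * \<tau> powr (-(7/8))"
proof (cases "\<tau> \<le> \<sigma>")
  case True
  have "l1 (\<lambda>x. dheat_kernel a (\<sigma> + \<tau>) x - dheat_kernel a \<tau> x) \<le> l1 (dheat_kernel a (\<sigma> + \<tau>)) + l1 (dheat_kernel a \<tau>)"
    using assms by (intro l1_triangle L1b_integrable[OF L1b_dheat_kernel]) auto
  also have "\<dots> \<le> cD * (\<sigma> + \<tau>) powr (-1/2) + cD * \<tau> powr (-1/2)"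
    using assms l1_dheat_kernel[of "\<sigma> + \<tau>" a] l1_dheat_kernel[of \<tau> a] by (auto simp: cD_def)
  also have "\<dots> \<le> cD * \<tau> powr (-1/2) + cD * \<tau> powr (-1/2)"
    using assms cD0 by (intro add_mono mult_left_mono powr_mono2') auto
  also have "\<tau> powr (-1/2) = \<tau> powr (3/8) * \<tau> powr (-(7/8))" by (simp flip: powr_add)
  also have "cD * (\<tau> powr (3/8) * \<tau> powr (-(7/8))) + cD * (\<tau> powr (3/8) * \<tau> powr (-(7/8))) = 2 * cD * \<tau> powr (3/8) * \<tau> powr (-(7/8))" by simp
  also have "\<dots> \<le> 2 * cD * \<sigma> powr (3/8) * \<tau> powr (-(7/8))"
    using assms cD0 True by (intro mult_right_mono mult_left_mono powr_mono2) auto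
  finally show ?thesis .
next
  case False
  have "l1 (\<lambda>x. dheat_kernel a (\<sigma> + \<tau>) x - dheat_kernel a \<tau> x) \<le> cD * \<tau> powr (-3/2) * \<sigma>"
    using l1_dheat_kernel_time[of \<tau> \<sigma> a] assms by (simp add: cD_def add.commute)
  also have "\<dots> = cD * \<tau> powr (-3/2) * (\<sigma> powr (3/8) * \<sigma> powr (5/8))" using assms by (simp flip: powr_add)
  also have "cD * \<tau> powr (-3/2) * (\<sigma> powr (3/8) * \<sigma> powr (5/8)) \<le> cD * \<tau> powr (-3/2) * (\<sigma> powr (3/8) * \<tau> powr (5/8))"
    using assms cD0 False by (intro mult_left_mono powr_mono2) auto
  also have "\<dots> = cD * \<sigma> powr (3/8) * (\<tau> powr (-3/2) * \<tau> powr (5/8))" by simp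
  also have "\<tau> powr (-3/2) * \<tau> powr (5/8) = \<tau> powr (-(7/8))" by (simp flip: powr_add)
  also have "cD * \<sigma> powr (3/8) * \<tau> powr (-(7/8)) \<le> 2 * cD * \<sigma> powr (3/8) * \<tau> powr (-(7/8))"
    using cD0 by (intro mult_right_mono) auto
  finally show ?thesis .
qed

text \<open>After restarting one time unit earlier, the extra heat flow only changes the kernels:
  from time 1 to 1 + \<sigma> in the heat part, and by a Hoelder increment of order \<sigma>^(3/8)
  in the Duhamel part. The 16 in \<open>C2\<close> is the factor 2 of
  \<open>l1_dheat_time_holder\<close> times the integral 8 of \<tau>^(-7/8) over the unit
  interval.\<close>

lemma heat_v_time_holder:
  assumes t: "t \<ge> 2" and \<sigma>: "0 < \<sigma>" "\<sigma> \<le> 1"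
  shows "l1 (\<lambda>x. kconv (heat_kernel \<sigma>) (v t) x - v t x) \<le> C2 * \<sigma> powr (3/8)"
proof -
  define r where "r = t - 1"
  have r: "r > 0" "t = r + 1" using t by (auto simp: r_def)
  define K1 where "K1 = (\<lambda>x. heat_kernel (\<sigma> + 1) x - heat_kernel 1 (x::'a))"
  define Kd where "Kd = (\<lambda>s x. dheat_kernel a (\<sigma> + (r + 1 - s)) x - dheat_kernel a (r + 1 - s) x)"
  define F where "F = (\<lambda>s x. kconv (Kd s) (g s) x)"
  have K1: "L1b K1" unfolding K1_def using \<sigma> by (intro L1b_diff L1b_heat_kernel) auto
  have Kd: "L1b (Kd s)" if "s < r + 1" for s unfolding Kd_def using \<sigma> that by (intro L1b_diff L1b_dheat_kernel) auto
  have eq: "kconv (heat_kernel \<sigma>) (v t) x - v t x = kconv K1 (v r) x + (LINT s:{r<..<r + 1}|lborel. F s x)" for x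
  proof -
    have "(LINT s:{r<..<r + 1}|lborel. kconv (heat_kernel \<sigma>) (kconv (dheat_kernel a (r + 1 - s)) (g s)) x) =
       (LINT s:{r<..<r + 1}|lborel. kconv (dheat_kernel a (\<sigma> + (r + 1) - s)) (g s) x)"
      using \<sigma> r by (intro set_lebesgue_integral_cong) (auto simp: kconv_heat_dheat g_L1b add_diff_eq)
    then have "kconv (heat_kernel \<sigma>) (v t) x - v t x = kconv (heat_kernel (\<sigma> + 1)) (v r) x - kconv (heat_kernel 1) (v r) x +
       ((LINT s:{r<..<r + 1}|lborel. kconv (dheat_kernel a (\<sigma> + (r + 1) - s)) (g s) x) - W r 1 x)"
      using kconv_restart[of r 1 "heat_kernel \<sigma>" x] restart[of r 1 x] r \<sigma> kconv_heat_heat[of 1 "v r" \<sigma> x]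
      by (simp add: L1b_heat_kernel v_L1b)
    also have "kconv (heat_kernel (\<sigma> + 1)) (v r) x - kconv (heat_kernel 1) (v r) x = kconv K1 (v r) x"
      unfolding K1_def using \<sigma> r by (intro kconv_diff_left[symmetric] v_L1b L1b_heat_kernel) auto
    also have "(LINT s:{r<..<r + 1}|lborel. kconv (dheat_kernel a (\<sigma> + (r + 1) - s)) (g s) x) - W r 1 x =
      (LINT s:{r<..<r + 1}|lborel. kconv (dheat_kernel a (\<sigma> + (r + 1) - s)) (g s) x - kconv (dheat_kernel a (r + 1 - s)) (g s) x)"
      unfolding W_def using r \<sigma> by (intro set_integral_diff(2)[symmetric] dg_integrable) auto
    also have "\<dots> = (LINT s:{r<..<r + 1}|lborel. F s x)"
      unfolding F_def Kd_def using r \<sigma>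
      by (intro set_lebesgue_integral_cong) (auto simp: kconv_diff_left g_L1b L1b_dheat_kernel add_diff_eq)
    finally show ?thesis .
  qed
  have Fj: "(\<lambda>p. F (fst p) (snd p)) \<in> borel_measurable (borel \<Otimes>\<^sub>M borel)"
  proof -
    have [measurable]: "(\<lambda>q. g (fst (fst q)) (snd q)) \<in> borel_measurable ((borel \<Otimes>\<^sub>M borel) \<Otimes>\<^sub>M borel)"
    proof -
      have "(\<lambda>q. (fst (fst q), snd q)) \<in> ((borel \<Otimes>\<^sub>M borel) \<Otimes>\<^sub>M borel) \<rightarrow>\<^sub>M (borel \<Otimes>\<^sub>M borel)" by measurable
      from measurable_compose[OF this g_joint] show ?thesis by simp
    qed
    show ?thesis unfolding F_def kconv_def Kd_def by measurable
  qed
  define b where "b = (\<lambda>s. (2 * cD * \<sigma> powr (3/8) * B) * (r + 1 - s) powr (-(7/8)))"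
  have bi: "set_integrable lborel {r<..<r + 1} b" "(LINT s:{r<..<r + 1}|lborel. b s) = 16 * cD * B * \<sigma> powr (3/8)"
    unfolding b_def using powr_integrable'[of "7/8" 1 r] powr_integral'[of "7/8" 1 r] by auto
  have Fb: "integrable lborel (F s) \<and> l1 (F s) \<le> b s" if s: "s \<in> {r<..<r + 1}" for s
  proof -
    have "l1 (Kd s) \<le> 2 * cD * \<sigma> powr (3/8) * (r + 1 - s) powr (-(7/8))"
      unfolding Kd_def using s \<sigma> by (intro l1_dheat_time_holder) auto
    from kconv_g_bounds[OF _ Kd this, of s] s r show ?thesis by (auto simp: F_def b_def mult_ac)
  qed
  have time: "integrable lborel (\<lambda>x. LINT s:{r<..<r + 1}|lborel. F s x)"
    "l1 (\<lambda>x. LINT s:{r<..<r + 1}|lborel. F s x) \<le> 16 * cD * B * \<sigma> powr (3/8)"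
    using time_l1[OF Fj _ Fb bi(1)] bi(2) by auto
  have "l1 (kconv K1 (v r)) \<le> l1 K1 * l1 (v r)"
    using r by (intro kconv_l1(2) L1b_integrable K1 v_L1b) auto
  also have "\<dots> \<le> (kernel_const TYPE('a) * \<sigma>) * M"
    using l1_heat_kernel_time[of 1 \<sigma>, where 'a='a] \<sigma> v_l1[OF r(1)]
    by (intro mult_mono) (auto simp: K1_def add.commute)
  also have "\<dots> \<le> (kernel_const TYPE('a) * \<sigma> powr (3/8)) * M"
    using powr_mono'[of "3/8" 1 \<sigma>] \<sigma> M by (intro mult_right_mono mult_left_mono) auto
  finally have l: "l1 (kconv K1 (v r)) \<le> (kernel_const TYPE('a) * \<sigma> powr (3/8)) * M" .
  have "l1 (\<lambda>x. kconv (heat_kernel \<sigma>) (v t) x - v t x) \<le> l1 (kconv K1 (v r)) + l1 (\<lambda>x. LINT s:{r<..<r + 1}|lborel. F s x)"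
    unfolding eq using r K1 by (intro l1_triangle(1) time L1b_integrable kconv_L1b v_L1b) auto
  also have "\<dots> \<le> C2 * \<sigma> powr (3/8)" using l time(2) by (simp add: C2_def algebra_simps)
  finally show ?thesis .
qed

lemma heat_v_bound: "t > 0 \<Longrightarrow> \<tau> > 0 \<Longrightarrow> \<bar>kconv (heat_kernel \<tau>) (v t) x\<bar> \<le> M"
  using kconv_le2[of "heat_kernel \<tau>" "v t" M x] v_bound[of t] by (simp add: l1_heat_kernel)

lemma heat_v_L1b: "t > 0 \<Longrightarrow> \<tau> > 0 \<Longrightarrow> L1b (kconv (heat_kernel \<tau>) (v t))"
  by (intro kconv_L1b L1b_heat_kernel v_L1b)

lemma l1_kconv_heat_le:
  assumes "\<tau> > 0" "integrable lborel (\<phi> :: 'a \<Rightarrow> real)"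
  shows "l1 (kconv (heat_kernel \<tau>) \<phi>) \<le> l1 \<phi>"
  using kconv_l1(2)[of "heat_kernel \<tau>" \<phi>] assms by (simp add: l1_heat_kernel)

text \<open>By \<open>pw_dheat_orthogonal\<close> the flux of the mollified solution vanishes, so only the
  difference between the solution and its mollification contributes.\<close>

lemma flux_bound:
  assumes r: "r \<ge> 2" and s: "s > 0" and \<tau>: "0 < \<tau>" "\<tau> \<le> 1"
  shows "\<bar>LINT x|lborel. g s x * kconv (dheat_kernel a \<tau>) (v r) x\<bar> \<le>
    (\<kappa> + 1) * M powr \<kappa> * C3 * \<tau> powr (-1/4) * l1 (\<lambda>x. v s x - kconv (heat_kernel \<tau>) (v r) x)"
proof -
  have r0: "r > 0" using r by auto
  define z where "z = kconv (heat_kernel \<tau>) (v r)"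
  define z' where "z' = kconv (dheat_kernel a \<tau>) (v r)"
  have zL: "L1b z" "L1b z'" unfolding z_def z'_def using r0 \<tau>
    by (auto intro!: kconv_L1b L1b_heat_kernel L1b_dheat_kernel v_L1b)
  have [measurable]: "z \<in> borel_measurable borel" "z' \<in> borel_measurable borel" using zL by auto
  have zM: "\<bar>z x\<bar> \<le> M" for x unfolding z_def using r0 \<tau> by (intro heat_v_bound)
  have zb: "\<bar>z' x\<bar> \<le> C3 * \<tau> powr (-1/4)" for x unfolding z'_def by (rule dheat_v_bound[OF r \<tau>])
  have pwz: "\<bar>pw \<kappa> (z x)\<bar> \<le> B" for x unfolding abs_pw B_def using zM k0 M by (intro mult_mono powr_mono2) auto
  have i: "integrable lborel (\<lambda>x. g s x * z' x)" "integrable lborel (\<lambda>x. pw \<kappa> (z x) * z' x)"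
    by (auto intro!: integrable_mult_bounded(2)[OF L1b_integrable[OF zL(2)] _ g_bound[OF s]]
       integrable_mult_bounded(2)[OF L1b_integrable[OF zL(2)] _ pwz])
  have d: "L1b (\<lambda>x. v s x - z x)" using zL s by (intro L1b_diff v_L1b)
  have lip: "\<bar>g s x - pw \<kappa> (z x)\<bar> \<le> (\<kappa> + 1) * M powr \<kappa> * \<bar>v s x - z x\<bar>" for x
    unfolding g_def using v_bound[OF s] zM by (intro pw_lipschitz k0)
  have "integrable lborel (\<lambda>x. (\<kappa> + 1) * M powr \<kappa> * \<bar>v s x - z x\<bar>)" using L1b_integrable[OF d] by auto
  from l1_bounded_le[OF this _ lip] have l: "integrable lborel (\<lambda>x. g s x - pw \<kappa> (z x))"
     "l1 (\<lambda>x. g s x - pw \<kappa> (z x)) \<le> (\<kappa> + 1) * M powr \<kappa> * l1 (\<lambda>x. v s x - z x)"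
    by (auto simp: l1_def)
  have "(LINT x|lborel. g s x * z' x) = (LINT x|lborel. g s x * z' x) - (LINT x|lborel. pw \<kappa> (z x) * z' x)"
    unfolding z_def z'_def using pw_dheat_orthogonal[OF \<tau>(1) v_L1b[OF r0] k0] by simp
  also have "\<dots> = (LINT x|lborel. (g s x - pw \<kappa> (z x)) * z' x)"
    unfolding left_diff_distrib by (rule Bochner_Integration.integral_diff[OF i, symmetric])
  finally have "\<bar>LINT x|lborel. g s x * z' x\<bar> \<le> l1 (\<lambda>x. g s x - pw \<kappa> (z x)) * (C3 * \<tau> powr (-1/4))"
    using integrable_mult_bounded(3)[OF l(1) L1b_measurable[OF zL(2)] zb] by simp
  also have "\<dots> \<le> ((\<kappa> + 1) * M powr \<kappa> * l1 (\<lambda>x. v s x - z x)) * (C3 * \<tau> powr (-1/4))"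
    using l C3_nonneg by (intro mult_right_mono) auto
  finally show ?thesis by (simp add: z_def z'_def mult_ac)
qed

section \<open>Distance between the solution and its mollifications within one time step\<close>

definition C5 where "C5 = 2 * C2 + 2 * cD * B"

lemma C5_nonneg: "C5 \<ge> 0"
  using C2_nonneg B0 cD0 by (simp add: C5_def)

lemma powr_doubling: "0 < \<sigma> \<Longrightarrow> (2 * \<sigma>) powr (3/8) \<le> 2 * \<sigma> powr (3/8 :: real)"
  using powr_mono[of "3/8" 1 "2::real"] by (simp add: powr_mult mult_right_mono)

text \<open>The intermediary is the heat flow of \<open>v s\<close> over time
  \<open>2 * \<sigma>\<close>. Replacing \<open>v s\<close> by it is controlled by
  \<open>heat_v_time_holder\<close>; the remaining error is a Duhamel remainder over time \<sigma>,
  contracted by the heat semigroup.\<close>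

lemma v_near_heat1:
  assumes s: "s \<ge> 2" and \<sigma>: "0 < \<sigma>" "\<sigma> \<le> h" "h \<le> 1/2"
  shows "l1 (\<lambda>x. v s x - kconv (heat_kernel \<sigma>) (v (s + \<sigma>)) x) \<le> C5 * h powr (3/8)"
proof -
  have s0: "s > 0" using s by auto
  have L: "L1b (\<lambda>x. kconv (heat_kernel \<sigma>) (v s) x - v (s + \<sigma>) x)"
    using s0 \<sigma> by (intro L1b_diff heat_v_L1b v_L1b) auto
  have eq: "v s x - kconv (heat_kernel \<sigma>) (v (s + \<sigma>)) x =
     (v s x - kconv (heat_kernel (2 * \<sigma>)) (v s) x) + kconv (heat_kernel \<sigma>) (\<lambda>x. kconv (heat_kernel \<sigma>) (v s) x - v (s + \<sigma>) x) x" for x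
  proof -
    have "kconv (heat_kernel \<sigma>) (\<lambda>x. kconv (heat_kernel \<sigma>) (v s) x - v (s + \<sigma>) x) x =
      kconv (heat_kernel \<sigma>) (kconv (heat_kernel \<sigma>) (v s)) x - kconv (heat_kernel \<sigma>) (v (s + \<sigma>)) x"
      using s0 \<sigma> by (intro kconv_diff_right L1b_integrable heat_v_L1b v_L1b L1b_heat_kernel) auto
    also have "kconv (heat_kernel \<sigma>) (kconv (heat_kernel \<sigma>) (v s)) x = kconv (heat_kernel (2 * \<sigma>)) (v s) x"
      using kconv_heat_heat[of \<sigma> "v s" \<sigma> x] s0 \<sigma> v_L1b by simp
    finally show ?thesis by simp
  qed
  have "l1 (\<lambda>x. v s x - kconv (heat_kernel \<sigma>) (v (s + \<sigma>)) x) \<le> l1 (\<lambda>x. v s x - kconv (heat_kernel (2 * \<sigma>)) (v s) x) + l1 (kconv (heat_kernel \<sigma>) (\<lambda>x. kconv (heat_kernel \<sigma>) (v s) x - v (s + \<sigma>) x))"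
    unfolding eq using s0 \<sigma> L by (intro l1_triangle(1) L1b_integrable L1b_diff kconv_L1b v_L1b L1b_heat_kernel) auto
  also have "\<dots> \<le> C2 * (2 * \<sigma>) powr (3/8) + 2 * cD * B * \<sigma> powr (1/2)"
  proof (rule add_mono)
    show "l1 (\<lambda>x. v s x - kconv (heat_kernel (2 * \<sigma>)) (v s) x) \<le> C2 * (2 * \<sigma>) powr (3/8)"
      using heat_v_time_holder[OF s, of "2 * \<sigma>"] \<sigma> by (subst l1_minus_commute) auto
    show "l1 (kconv (heat_kernel \<sigma>) (\<lambda>x. kconv (heat_kernel \<sigma>) (v s) x - v (s + \<sigma>) x)) \<le> 2 * cD * B * \<sigma> powr (1/2)"
      using restart_l1[OF s0 \<sigma>(1)] \<sigma> L1b_integrable[OF L]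
      by (intro order_trans[OF l1_kconv_heat_le]) (auto simp: l1_minus_commute)
  qed
  also have "\<dots> \<le> C2 * (2 * h powr (3/8)) + 2 * cD * B * h powr (3/8)"
  proof (intro add_mono mult_left_mono)
    have "\<sigma> powr (3/8) \<le> h powr (3/8)" using \<sigma> by (intro powr_mono2) auto
    then show "(2 * \<sigma>) powr (3/8) \<le> 2 * h powr (3/8)" using powr_doubling[OF \<sigma>(1)] by linarith
    have "\<sigma> powr (1/2) \<le> \<sigma> powr (3/8)" using \<sigma> by (intro powr_mono') auto
    also have "\<dots> \<le> h powr (3/8)" using \<sigma> by (intro powr_mono2) auto
    finally show "\<sigma> powr (1/2) \<le> h powr (3/8)" .
  qed (use C2_nonneg B0 cD0 in auto)
  also have "\<dots> = C5 * h powr (3/8)" by (simp add: C5_def algebra_simps)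
  finally show ?thesis .
qed

text \<open>The counterpart of \<open>v_near_heat1\<close> for the second flux term of
  \<open>energy_step\<close>, where the mollified function is the solution at the start of the
  step.\<close>

lemma v_near_heat2:
  assumes t: "t \<ge> 2" and \<sigma>: "0 < \<sigma>" "0 < r" "\<sigma> + r = h" "h \<le> 1/2"
  shows "l1 (\<lambda>x. v (t + r) x - kconv (heat_kernel (\<sigma> + h)) (v t) x) \<le> C5 * h powr (3/8)"
proof -
  have t0: "t > 0" using t by auto
  have L: "L1b (\<lambda>x. v t x - kconv (heat_kernel (2 * \<sigma>)) (v t) x)"
    using t0 \<sigma> by (intro L1b_diff heat_v_L1b v_L1b) auto
  have eq: "v (t + r) x - kconv (heat_kernel (\<sigma> + h)) (v t) x =
     (v (t + r) x - kconv (heat_kernel r) (v t) x) + kconv (heat_kernel r) (\<lambda>x. v t x - kconv (heat_kernel (2 * \<sigma>)) (v t) x) x" for x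
  proof -
    have "kconv (heat_kernel r) (\<lambda>x. v t x - kconv (heat_kernel (2 * \<sigma>)) (v t) x) x =
      kconv (heat_kernel r) (v t) x - kconv (heat_kernel r) (kconv (heat_kernel (2 * \<sigma>)) (v t)) x"
      using t0 \<sigma> by (intro kconv_diff_right L1b_integrable heat_v_L1b v_L1b L1b_heat_kernel) auto
    also have "kconv (heat_kernel r) (kconv (heat_kernel (2 * \<sigma>)) (v t)) x = kconv (heat_kernel (r + 2 * \<sigma>)) (v t) x"
      using kconv_heat_heat[of "2 * \<sigma>" "v t" r x] t0 \<sigma> v_L1b by simp
    \<comment> \<open>The intermediate mollification over \<open>2 * \<sigma>\<close> was chosen so
      that the total heat time is exactly the one required.\<close>
    also have "r + 2 * \<sigma> = \<sigma> + h" using \<sigma> by simp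
    finally show ?thesis by simp
  qed
  have "l1 (\<lambda>x. v (t + r) x - kconv (heat_kernel (\<sigma> + h)) (v t) x) \<le> l1 (\<lambda>x. v (t + r) x - kconv (heat_kernel r) (v t) x) + l1 (kconv (heat_kernel r) (\<lambda>x. v t x - kconv (heat_kernel (2 * \<sigma>)) (v t) x))"
    unfolding eq using t0 \<sigma> L by (intro l1_triangle(1) L1b_integrable L1b_diff kconv_L1b v_L1b L1b_heat_kernel) auto
  also have "\<dots> \<le> 2 * cD * B * r powr (1/2) + C2 * (2 * \<sigma>) powr (3/8)"
  proof (rule add_mono)
    show "l1 (\<lambda>x. v (t + r) x - kconv (heat_kernel r) (v t) x) \<le> 2 * cD * B * r powr (1/2)"
      using restart_l1[OF t0 \<sigma>(2)] by simp
    show "l1 (kconv (heat_kernel r) (\<lambda>x. v t x - kconv (heat_kernel (2 * \<sigma>)) (v t) x)) \<le> C2 * (2 * \<sigma>) powr (3/8)"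
      using heat_v_time_holder[OF t, of "2 * \<sigma>"] \<sigma> L1b_integrable[OF L]
      by (intro order_trans[OF l1_kconv_heat_le]) (auto simp: l1_minus_commute)
  qed
  also have "\<dots> \<le> 2 * cD * B * h powr (3/8) + C2 * (2 * h powr (3/8))"
  proof (intro add_mono mult_left_mono)
    have "\<sigma> powr (3/8) \<le> h powr (3/8)" using \<sigma> by (intro powr_mono2) auto
    then show "(2 * \<sigma>) powr (3/8) \<le> 2 * h powr (3/8)" using powr_doubling[OF \<sigma>(1)] by linarith
    have "r powr (1/2) \<le> r powr (3/8)" using \<sigma> by (intro powr_mono') auto
    also have "\<dots> \<le> h powr (3/8)" using \<sigma> by (intro powr_mono2) auto
    finally show "r powr (1/2) \<le> h powr (3/8)" .
  qed (use C2_nonneg B0 cD0 in auto)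
  also have "\<dots> = C5 * h powr (3/8)" by (simp add: C5_def algebra_simps)
  finally show ?thesis .
qed

section \<open>The energy over one short time step\<close>

definition E where "E t = (LINT x|lborel. (v t x)\<^sup>2)"

text \<open>The 2 counts the two flux terms in \<open>energy_step\<close>, and 4/3 comes from
  integrating the singularity of exponent 1/4 over the step.\<close>

definition C7 where "C7 = 2 * ((\<kappa> + 1) * M powr \<kappa> * C3 * C5) * (4/3)"

lemma square_integrable:
  assumes w: "L1b (w :: 'a \<Rightarrow> real)"
  shows "integrable lborel (\<lambda>x. (w x)\<^sup>2)"
proof -
  from w obtain m where m: "\<And>x. \<bar>w x\<bar> \<le> m" by (rule L1b_bound) blast
  show ?thesis unfolding power2_eq_square
    by (rule integrable_mult_bounded(1)[OF L1b_integrable[OF w] L1b_measurable[OF w] m])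
qed

text \<open>With \<open>e\<close> the heat flow of \<open>v t\<close>, the difference of the squares
  of \<open>v (t + h)\<close> and \<open>e\<close> is the Duhamel remainder times their sum. Moving
  the derivative kernel onto this sum produces fluxes of \<open>g s\<close> against gradients of
  mollified solutions. By \<open>flux_bound\<close> these are small, since \<open>v s\<close>
  differs from both mollifications by order h^(3/8) in L^1.\<close>

lemma energy_step:
  assumes t: "t \<ge> 2" and h: "0 < h" "h \<le> 1/2"
  shows "E (t + h) \<le> (LINT x|lborel. (kconv (heat_kernel h) (v t) x)\<^sup>2) + C7 * h powr (9/8)"
proof -
  have t0: "t > 0" using t by auto
  define e where "e = kconv (heat_kernel h) (v t)"
  define w where "w = (\<lambda>x. v (t + h) x + e x)"
  have eL: "L1b e" unfolding e_def using t0 h by (intro heat_v_L1b)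
  have vL: "L1b (v (t + h))" using t0 h by (intro v_L1b) auto
  have wL: "L1b w" unfolding w_def by (intro L1b_add eL vL)
  from wL obtain m where m: "\<And>x. \<bar>w x\<bar> \<le> m" by (rule L1b_bound) blast
  define F where "F = (\<lambda>s x. kconv (dheat_kernel a (t + h - s)) (g s) x)"
  define D where "D = (\<kappa> + 1) * M powr \<kappa> * C3 * C5 * h powr (3/8)"
  have D0: "D \<ge> 0" unfolding D_def using k0 C3_nonneg C5_nonneg by auto
  have "E (t + h) - (LINT x|lborel. (e x)\<^sup>2) = (LINT x|lborel. W t h x * w x)"
  proof -
    have "W t h x * w x = (v (t + h) x)\<^sup>2 - (e x)\<^sup>2" for x
      using restart[OF t0 h(1), of x] by (simp add: w_def e_def power2_eq_square algebra_simps)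
    then show ?thesis unfolding E_def
      using Bochner_Integration.integral_diff[OF square_integrable[OF vL] square_integrable[OF eL]] by simp
  qed
  also have "\<dots> = (LINT s:{t<..<t + h}|lborel. (LINT x|lborel. F s x * w x))"
  proof -
    have *: "integrable lborel (F s) \<and> l1 (F s) \<le> cD * (t + h - s) powr (-1/2) * B"
      if "s \<in> {t<..<t + h}" for s
      using that t0 h kconv_dg_bounds[of s "t + h - s"] by (auto simp: F_def)
    have Fj: "(\<lambda>p. F (fst p) (snd p)) \<in> borel_measurable (borel \<Otimes>\<^sub>M borel)"
      unfolding F_def by measurable
    have "W t h x = (LINT s:{t<..<t + h}|lborel. F s x)" for x by (simp add: W_def F_def)
    then show ?thesis
      using time_integral_pairing[OF Fj _ * half_integrable L1b_measurable[OF wL] m] h by simp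
  qed
  also have "\<dots> \<le> (LINT s:{t<..<t + h}|lborel. 2 * D * (t + h - s) powr (-(1/4)))"
  proof (rule order_trans[OF abs_ge_self set_integral_dominated])
    show "(\<lambda>s. LINT x|lborel. F s x * w x) \<in> borel_measurable borel"
    proof -
      have [measurable]: "w \<in> borel_measurable borel" using wL by auto
      have [measurable]: "(\<lambda>p. F (fst p) (snd p)) \<in> borel_measurable (borel \<Otimes>\<^sub>M borel)"
        unfolding F_def by measurable
      show ?thesis by measurable
    qed
    show "set_integrable lborel {t<..<t + h} (\<lambda>s. 2 * D * (t + h - s) powr (-(1/4)))"
      using powr_integrable'[of "1/4" h t] h by auto
    fix s assume s: "s \<in> {t<..<t + h}"
    define \<sigma> where "\<sigma> = t + h - s"
    define r where "r = s - t"
    have \<sigma>: "0 < \<sigma>" "\<sigma> \<le> h" "0 < r" "\<sigma> + r = h" "s = t + r" "s + \<sigma> = t + h" "s > 0" "\<sigma> + h \<le> 1" "\<sigma> \<le> 1"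
      using s h t by (auto simp: \<sigma>_def r_def)
    have F: "F s = kconv (dheat_kernel a \<sigma>) (g s)" by (simp add: F_def \<sigma>_def)
    have i: "integrable lborel (\<lambda>x. g s x * kconv (dheat_kernel a \<sigma>) (v (t + h)) x)"
      "integrable lborel (\<lambda>x. g s x * kconv (dheat_kernel a (\<sigma> + h)) (v t) x)"
    proof -
      have "L1b (kconv (dheat_kernel a \<sigma>) (v (t + h)))" using \<sigma> by (intro kconv_L1b L1b_dheat_kernel vL)
      from integrable_mult_bounded(2)[OF L1b_integrable[OF this] g_measurable g_bound[OF \<sigma>(7)]]
      show "integrable lborel (\<lambda>x. g s x * kconv (dheat_kernel a \<sigma>) (v (t + h)) x)" .
      have "L1b (kconv (dheat_kernel a (\<sigma> + h)) (v t))" using \<sigma> h by (intro kconv_L1b L1b_dheat_kernel v_L1b t0) auto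
      from integrable_mult_bounded(2)[OF L1b_integrable[OF this] g_measurable g_bound[OF \<sigma>(7)]]
      show "integrable lborel (\<lambda>x. g s x * kconv (dheat_kernel a (\<sigma> + h)) (v t) x)" .
    qed
    \<comment> \<open>The derivative now falls on \<open>w\<close>. Its two summands become the
      mollifications of \<open>v (t + h)\<close> over \<sigma> and of \<open>v t\<close> over
      \<sigma> + h, the two shapes that \<open>flux_bound\<close> accepts.\<close>
    have "(LINT x|lborel. F s x * w x) = - (LINT x|lborel. g s x * kconv (dheat_kernel a \<sigma>) w x)"
      unfolding F by (rule dheat_kernel_pairing[OF \<sigma>(1) g_L1b[OF \<sigma>(7)] wL])
    also have "kconv (dheat_kernel a \<sigma>) w = (\<lambda>x. kconv (dheat_kernel a \<sigma>) (v (t + h)) x + kconv (dheat_kernel a (\<sigma> + h)) (v t) x)"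
    proof
      fix x
      have "kconv (dheat_kernel a \<sigma>) w x = kconv (dheat_kernel a \<sigma>) (v (t + h)) x + kconv (dheat_kernel a \<sigma>) e x"
        unfolding w_def using \<sigma> by (intro kconv_diff_right(2) L1b_integrable vL eL L1b_dheat_kernel) auto
      also have "kconv (dheat_kernel a \<sigma>) e x = kconv (dheat_kernel a (\<sigma> + h)) (v t) x"
        unfolding e_def using \<sigma> h by (intro kconv_dheat_heat v_L1b t0) auto
      finally show "kconv (dheat_kernel a \<sigma>) w x = kconv (dheat_kernel a \<sigma>) (v (t + h)) x + kconv (dheat_kernel a (\<sigma> + h)) (v t) x" .
    qed
    also have "(LINT x|lborel. g s x * (kconv (dheat_kernel a \<sigma>) (v (t + h)) x + kconv (dheat_kernel a (\<sigma> + h)) (v t) x)) =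
      (LINT x|lborel. g s x * kconv (dheat_kernel a \<sigma>) (v (t + h)) x) + (LINT x|lborel. g s x * kconv (dheat_kernel a (\<sigma> + h)) (v t) x)"
      unfolding distrib_left by (rule Bochner_Integration.integral_add[OF i])
    finally have eq: "(LINT x|lborel. F s x * w x) = - ((LINT x|lborel. g s x * kconv (dheat_kernel a \<sigma>) (v (t + h)) x) + (LINT x|lborel. g s x * kconv (dheat_kernel a (\<sigma> + h)) (v t) x))" .
    have c: "(\<kappa> + 1) * M powr \<kappa> * C3 \<ge> 0" using k0 C3_nonneg by auto
    have "\<bar>LINT x|lborel. g s x * kconv (dheat_kernel a \<sigma>) (v (t + h)) x\<bar> \<le>
        (\<kappa> + 1) * M powr \<kappa> * C3 * \<sigma> powr (-1/4) * l1 (\<lambda>x. v s x - kconv (heat_kernel \<sigma>) (v (t + h)) x)"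
      using t h \<sigma> by (intro flux_bound) auto
    also have "\<dots> \<le> (\<kappa> + 1) * M powr \<kappa> * C3 * \<sigma> powr (-1/4) * (C5 * h powr (3/8))"
    proof (rule mult_left_mono)
      have "s \<ge> 2" using s t by simp
      from v_near_heat1[OF this \<sigma>(1,2) h(2)]
      show "l1 (\<lambda>x. v s x - kconv (heat_kernel \<sigma>) (v (t + h)) x) \<le> C5 * h powr (3/8)" by (simp only: \<sigma>(6))
    qed (use c in auto)
    also have "\<dots> = D * \<sigma> powr (-(1/4))" by (simp add: D_def)
    finally have 1: "\<bar>LINT x|lborel. g s x * kconv (dheat_kernel a \<sigma>) (v (t + h)) x\<bar> \<le> D * \<sigma> powr (-(1/4))" .
    have "\<bar>LINT x|lborel. g s x * kconv (dheat_kernel a (\<sigma> + h)) (v t) x\<bar> \<le>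
        (\<kappa> + 1) * M powr \<kappa> * C3 * (\<sigma> + h) powr (-1/4) * l1 (\<lambda>x. v s x - kconv (heat_kernel (\<sigma> + h)) (v t) x)"
      using t h \<sigma> by (intro flux_bound) auto
    also have "\<dots> \<le> (\<kappa> + 1) * M powr \<kappa> * C3 * \<sigma> powr (-1/4) * (C5 * h powr (3/8))"
    proof (intro mult_mono mult_left_mono)
      show "l1 (\<lambda>x. v s x - kconv (heat_kernel (\<sigma> + h)) (v t) x) \<le> C5 * h powr (3/8)"
        using v_near_heat2[OF t \<sigma>(1,3,4) h(2)] by (simp only: \<sigma>(5))
      show "(\<sigma> + h) powr (-1/4) \<le> \<sigma> powr (-1/4)" using \<sigma>(1) h(1) by (intro powr_mono2') auto
    qed (use k0 C3_nonneg in auto)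
    also have "\<dots> = D * \<sigma> powr (-(1/4))" by (simp add: D_def)
    finally have 2: "\<bar>LINT x|lborel. g s x * kconv (dheat_kernel a (\<sigma> + h)) (v t) x\<bar> \<le> D * \<sigma> powr (-(1/4))" .
    show "\<bar>LINT x|lborel. F s x * w x\<bar> \<le> 2 * D * (t + h - s) powr (-(1/4))"
      unfolding eq \<sigma>_def[symmetric] using 1 2 by linarith
  qed auto
  also have "\<dots> = 2 * D * (h powr (3/4) / (3/4))"
    using powr_integral'[of "1/4" h t] h by simp
  also have "\<dots> = C7 * (h powr (3/8) * h powr (3/4))" by (simp add: C7_def D_def)
  also have "h powr (3/8) * h powr (3/4) = h powr (9/8)" by (simp flip: powr_add)
  finally show ?thesis by (simp add: e_def)
qed

text \<open>Self-adjointness and the semigroup law turn the energy at half time into the inner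
  product of \<open>w\<close> with its heat flow at full time; Cauchy-Schwarz then gives
  log-convexity at the midpoint.\<close>

lemma heat_energy_midpoint:
  assumes w: "L1b (w :: 'a \<Rightarrow> real)" and \<sigma>: "\<sigma> > 0"
  shows "(LINT x|lborel. (kconv (heat_kernel (\<sigma>/2)) w x)\<^sup>2)\<^sup>2 \<le> (LINT x|lborel. (w x)\<^sup>2) * (LINT x|lborel. (kconv (heat_kernel \<sigma>) w x)\<^sup>2)"
proof -
  define z where "z = kconv (heat_kernel (\<sigma>/2)) w"
  define y where "y = kconv (heat_kernel \<sigma>) w"
  have L: "L1b z" "L1b y" unfolding z_def y_def using \<sigma> by (auto intro!: kconv_L1b L1b_heat_kernel w)
  have zz: "kconv (heat_kernel (\<sigma>/2)) z x = y x" for x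
    unfolding z_def y_def using kconv_heat_heat[of "\<sigma>/2" w "\<sigma>/2" x] w \<sigma> by simp
  have "(LINT x|lborel. (z x)\<^sup>2) = (LINT x|lborel. kconv (heat_kernel (\<sigma>/2)) w x * z x)"
    by (simp add: z_def power2_eq_square)
  also have "\<dots> = (LINT x|lborel. w x * y x)"
    using heat_kernel_pairing[of "\<sigma>/2" w z] w L \<sigma> by (simp add: zz)
  finally have e: "(LINT x|lborel. (z x)\<^sup>2) = (LINT x|lborel. w x * y x)" .
  define A where "A = (LINT x|lborel. (w x)\<^sup>2)"
  define C where "C = (LINT x|lborel. (y x)\<^sup>2)"
  define P where "P = (LINT x|lborel. w x * y x)"
  from L(2) obtain m where m: "\<And>x. \<bar>y x\<bar> \<le> m" by (rule L1b_bound) blast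
  have i: "integrable lborel (\<lambda>x. (w x)\<^sup>2)" "integrable lborel (\<lambda>x. (y x)\<^sup>2)" "integrable lborel (\<lambda>x. w x * y x)"
    using square_integrable[OF w] square_integrable[OF L(2)] L1b_measurable[OF L(2)]
    by (auto intro!: integrable_mult_bounded(1)[OF L1b_integrable[OF w] _ m])
  have quad: "0 \<le> A * c\<^sup>2 + 2 * c * P + C" for c
  proof -
    have "0 \<le> (LINT x|lborel. (c * w x + y x)\<^sup>2)" by simp
    also have "\<dots> = (LINT x|lborel. c\<^sup>2 * (w x)\<^sup>2 + 2 * c * (w x * y x) + (y x)\<^sup>2)"
      by (intro Bochner_Integration.integral_cong refl) (simp add: power2_eq_square algebra_simps)
    also have "\<dots> = c\<^sup>2 * A + 2 * c * P + C"
      using i by (simp add: A_def P_def C_def)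
    finally show ?thesis by (simp add: mult.commute)
  qed
  have "P\<^sup>2 \<le> A * C"
  proof (cases "A = 0")
    case True
    have "P = 0"
    proof (rule ccontr)
      assume "P \<noteq> 0"
      \<comment> \<open>With \<open>A = 0\<close> the quadratic form is affine in \<open>c\<close>;
        this witness gives it the value -1.\<close>
      with quad[of "- (C + 1) / (2 * P)"] True show False by (simp add: field_simps)
    qed
    then show ?thesis using True by simp
  next
    case False
    moreover have "A \<ge> 0" by (simp add: A_def)
    ultimately have A: "A > 0" by simp
    from quad[of "- P / A"] A have "0 \<le> C - P\<^sup>2 / A" by (simp add: field_simps power2_eq_square)
    with A show ?thesis by (simp add: field_simps)
  qed
  then show ?thesis unfolding A_def C_def P_def e[symmetric] by (simp add: z_def y_def)
qed

text \<open>Repeated halving converts a loss factor \<beta> over the long time \<open>H\<close> into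
  the factor \<beta>^(1/2^k) over \<open>H / 2 ^ k\<close>. For fixed \<beta> < 1 the resulting loss
  is of first order in the step, so it outweighs the error of order h^(9/8) in
  \<open>energy_step\<close>.\<close>

lemma heat_energy_dyadic:
  assumes w: "L1b (w :: 'a \<Rightarrow> real)" and H: "H > 0" and \<beta>: "\<beta> > 0"
    and e0: "(LINT x|lborel. (w x)\<^sup>2) \<le> A" and eH: "(LINT x|lborel. (kconv (heat_kernel H) w x)\<^sup>2) \<le> A * \<beta>" and A: "A \<ge> 0"
  shows "(LINT x|lborel. (kconv (heat_kernel (H / 2 ^ k)) w x)\<^sup>2) \<le> A * \<beta> powr (1 / 2 ^ k)"
proof (induction k)
  case 0
  then show ?case using eH \<beta> by simp
next
  case (Suc k)
  define y where "y = (LINT x|lborel. (kconv (heat_kernel (H / 2 ^ Suc k)) w x)\<^sup>2)"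
  have "y\<^sup>2 \<le> (LINT x|lborel. (w x)\<^sup>2) * (LINT x|lborel. (kconv (heat_kernel (H / 2 ^ k)) w x)\<^sup>2)"
    using heat_energy_midpoint[OF w, of "H / 2^k"] H by (simp add: y_def mult.commute)
  also have "\<dots> \<le> A * (A * \<beta> powr (1 / 2 ^ k))" using Suc e0 A by (intro mult_mono) auto
  also have "\<dots> = (A * \<beta> powr (1 / 2 ^ Suc k))\<^sup>2"
  proof -
    have "(\<beta> powr (1 / 2 ^ Suc k))\<^sup>2 = \<beta> powr (1 / 2 ^ k)"
      using \<beta> by (simp add: power2_eq_square flip: powr_add)
    then show ?thesis by (simp add: power_mult_distrib power2_eq_square)
  qed
  finally have "y \<le> A * \<beta> powr (1 / 2 ^ Suc k)"
    by (rule power2_le_imp_le) (simp add: A)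
  then show ?case by (simp only: y_def)
qed

section \<open>Decay of the energy over long times\<close>

lemma E_nonneg: "E t \<ge> 0" by (simp add: E_def)

text \<open>The square integral is at most the L^1 norm times the sup norm, and the heat flow over
  time \<open>H\<close> has both under control.\<close>

lemma heat_energy_le:
  assumes t: "t > 0" and H: "H > 0"
  shows "(LINT x|lborel. (kconv (heat_kernel H) (v t) x)\<^sup>2) \<le> M\<^sup>2 * H powr (- real DIM('a) / 2)"
proof -
  have nb: "nb H (l1 (v t)) (kconv (heat_kernel H) (v t))" using H v_integrable[OF t] by (rule nb_heat)
  have "(LINT x|lborel. (kconv (heat_kernel H) (v t) x)\<^sup>2) \<le> l1 (kconv (heat_kernel H) (v t)) * (l1 (v t) * H powr (- real DIM('a) / 2))"
    using integrable_mult_bounded(3)[OF nbD(2)[OF nb] nbD(1)[OF nb] nbD(4)[OF nb]] by (simp add: power2_eq_square)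
  also have "\<dots> \<le> M * (M * H powr (- real DIM('a) / 2))"
    using nbD(3)[OF nb] v_l1[OF t] M by (intro mult_mono) auto
  finally show ?thesis by (simp add: power2_eq_square)
qed

text \<open>The threshold \<open>A\<close> is e times the universal bound for the heat energy after
  time \<open>H\<close>. Above it, the heat flow over \<open>H\<close> loses at least the factor
  1/e, so the dyadic step loses exp(-1/2^k). Below it, \<beta> = 1 merely says that the heat energy
  stays below \<open>A\<close>.\<close>

lemma energy_decay_step:
  assumes t: "t \<ge> 2" and H: "H > 0" and h: "h = H / 2 ^ k" "h \<le> 1/2"
    and A: "A = exp 1 * M\<^sup>2 * H powr (- real DIM('a) / 2)"
  shows "E (t + h) \<le> max A (exp (- 1 / 2 ^ k) * E t) + C7 * h powr (9/8)"
proof -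
  have t0: "t > 0" using t by auto
  have A0: "A > 0" using M H by (simp add: A)
  have A1: "A * exp (-1) = M\<^sup>2 * H powr (- real DIM('a) / 2)" by (simp add: A mult_ac flip: exp_add)
  have h0: "h > 0" using h H by simp
  have "(LINT x|lborel. (kconv (heat_kernel h) (v t) x)\<^sup>2) \<le> max A (exp (- 1 / 2 ^ k) * E t)"
  proof (cases "E t \<le> A")
    case True
    have "A * exp (-1) \<le> A * 1" using A0 by (intro mult_left_mono) auto
    then have "(LINT x|lborel. (kconv (heat_kernel h) (v t) x)\<^sup>2) \<le> A * 1 powr (1 / 2 ^ k)"
      unfolding h(1) using heat_energy_le[OF t0 H] A1 True A0
      by (intro heat_energy_dyadic[OF v_L1b[OF t0] H]) (auto simp: E_def)
    then show ?thesis by simp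
  next
    case False
    have "A * exp (-1) \<le> E t * exp (-1)" using False by (intro mult_right_mono) auto
    then have "(LINT x|lborel. (kconv (heat_kernel h) (v t) x)\<^sup>2) \<le> E t * exp (-1) powr (1 / 2 ^ k)"
      unfolding h(1) using heat_energy_le[OF t0 H] A1 E_nonneg
      by (intro heat_energy_dyadic[OF v_L1b[OF t0] H]) (auto simp: E_def)
    then show ?thesis by (simp add: exp_powr_real mult.commute)
  qed
  with energy_step[OF t h0 h(2)] show ?thesis by linarith
qed

lemma C7_nonneg: "C7 \<ge> 0"
  using k0 C3_nonneg C5_nonneg by (simp add: C7_def)

text \<open>One step of the iteration: damping by a factor at most 1 keeps the threshold
  \<open>A\<close> and does not amplify the error \<open>J\<close> accumulated so far.\<close>

lemma max_iter:
  assumes "\<rho> * x = y" "0 \<le> \<rho>" "\<rho> \<le> 1" "0 \<le> A" "0 \<le> J" "0 \<le> (\<epsilon>::real)"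
  shows "max A (\<rho> * (max A x + J)) + \<epsilon> \<le> max A y + (J + \<epsilon>)"
proof -
  have "\<rho> * A \<le> 1 * A" "\<rho> * J \<le> 1 * J" using assms by (intro mult_right_mono; simp)+
  moreover have "\<rho> * max A x \<le> max A y"
    using assms(1) \<open>\<rho> * A \<le> 1 * A\<close> by (cases "A \<le> x") auto
  ultimately show ?thesis using assms by (simp add: distrib_left)
qed

lemma energy_decay_iter:
  assumes t: "t \<ge> 2" and H: "H > 0" and h: "h = H / 2 ^ k" "h \<le> 1/2"
    and A: "A = exp 1 * M\<^sup>2 * H powr (- real DIM('a) / 2)"
  shows "E (t + real j * h) \<le> max A (exp (- real j / 2 ^ k) * E t) + real j * (C7 * h powr (9/8))"
proof (induction j)
  case (Suc j)
  define \<epsilon> where "\<epsilon> = C7 * h powr (9/8)"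
  define \<rho> where "\<rho> = exp (- 1 / 2 ^ k :: real)"
  have e0: "\<epsilon> \<ge> 0" using C7_nonneg by (simp add: \<epsilon>_def)
  have \<rho>: "0 < \<rho>" "\<rho> \<le> 1" by (auto simp: \<rho>_def)
  have h0: "h > 0" using h H by simp
  have A0: "A > 0" using M H by (simp add: A)
  have "E (t + real (Suc j) * h) = E ((t + real j * h) + h)" by (simp add: algebra_simps)
  also have "\<dots> \<le> max A (\<rho> * E (t + real j * h)) + \<epsilon>"
    unfolding \<rho>_def \<epsilon>_def using t h0 by (intro energy_decay_step[OF _ H h A]) (auto intro: order_trans)
  also have "\<dots> \<le> max A (\<rho> * (max A (exp (- real j / 2 ^ k) * E t) + real j * \<epsilon>)) + \<epsilon>"
    using Suc \<rho> by (intro add_right_mono max.mono mult_left_mono order_refl) (auto simp: \<epsilon>_def)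
  also have "\<dots> \<le> max A (exp (- real (Suc j) / 2 ^ k) * E t) + (real j * \<epsilon> + \<epsilon>)"
  proof (rule max_iter)
    have "(- 1 / 2 ^ k) + (- real j / 2 ^ k) = - real (Suc j) / (2 ^ k :: real)"
      by (simp add: add_divide_distrib diff_divide_distrib)
    then have "\<rho> * exp (- real j / 2 ^ k) = exp (- real (Suc j) / 2 ^ k)"
      unfolding \<rho>_def exp_add[symmetric] by (simp only:)
    then show "\<rho> * (exp (- real j / 2 ^ k) * E t) = exp (- real (Suc j) / 2 ^ k) * E t"
      by (simp only: mult.assoc[symmetric])
  qed (use \<rho> A0 e0 in auto)
  also have "real j * \<epsilon> + \<epsilon> = real (Suc j) * (C7 * h powr (9/8))" by (simp add: \<epsilon>_def distrib_right)
  finally show ?case .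
qed simp

text \<open>Letting the time step tend to 0 removes the error, since \<open>9/8 > 1\<close>.\<close>

lemma energy_decay:
  assumes t: "t \<ge> 2" and H: "H > 0"
  shows "E (t + real L * H) \<le> max (exp 1 * M\<^sup>2 * H powr (- real DIM('a) / 2)) (exp (- real L) * E t)"
proof -
  define A where "A = exp 1 * M\<^sup>2 * H powr (- real DIM('a) / 2)"
  define h where "h = (\<lambda>k::nat. H / 2 ^ k)"
  have h0: "h \<longlonglongrightarrow> 0"
    unfolding h_def using tendsto_mult[OF tendsto_const[of H] LIMSEQ_power_zero[of "1/2::real"]]
    by (simp add: power_divide)
  have "eventually (\<lambda>k. h k < 1/2) sequentially" using order_tendstoD(2)[OF h0, of "1/2"] by simp
  then have ev: "eventually (\<lambda>k. E (t + real L * H) \<le> max A (exp (- real L) * E t) + real L * H * C7 * h k powr (1/8)) sequentially"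
  proof eventually_elim
    case (elim k)
    have hp: "h k > 0" using H by (simp add: h_def)
    have "E (t + real (L * 2 ^ k) * h k) \<le> max A (exp (- real (L * 2 ^ k) / 2 ^ k) * E t) + real (L * 2 ^ k) * (C7 * h k powr (9/8))"
      using elim by (intro energy_decay_iter[OF t H _ _ A_def]) (auto simp: h_def)
    moreover have e1: "real (L * 2 ^ k) * h k = real L * H" by (simp add: h_def)
    moreover have e2: "- real (L * 2 ^ k) / 2 ^ k = - real L" by simp
    moreover have e3: "real (L * 2 ^ k) * (C7 * h k powr (9/8)) = real L * H * C7 * h k powr (1/8)"
    proof -
      have "h k powr (9/8) = h k powr 1 * h k powr (1/8)" by (subst powr_add[symmetric]) simp
      then show ?thesis using H by (simp add: h_def)
    qed
    ultimately show ?case by (simp only: e1 e2 e3)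
  qed
  have "(\<lambda>k. h k powr (1/8)) \<longlonglongrightarrow> 0 powr (1/8)"
    using H by (intro tendsto_powr' h0 tendsto_const) (auto simp: h_def)
  then have "(\<lambda>k. max A (exp (- real L) * E t) + real L * H * C7 * h k powr (1/8)) \<longlonglongrightarrow> max A (exp (- real L) * E t) + real L * H * C7 * 0"
    by (intro tendsto_intros) simp
  from tendsto_lowerbound[OF this ev] show ?thesis by (simp add: A_def)
qed

lemma E_le: "t > 0 \<Longrightarrow> E t \<le> M\<^sup>2"
proof -
  assume t: "t > 0"
  have "E t \<le> l1 (v t) * M"
    using integrable_mult_bounded(3)[OF v_integrable[OF t] v_measurable v_bound[OF t]] by (simp add: E_def power2_eq_square)
  also have "\<dots> \<le> M * M" using v_l1[OF t] M by (intro mult_right_mono) auto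
  finally show ?thesis by (simp add: power2_eq_square)
qed

text \<open>Induction over dyadic ranges of \<open>t\<close>. The first summand of \<open>C\<close>
  covers times up to 4 through the trivial bound \<open>E_le\<close>; the second covers the case in
  which the energy has dropped to the threshold of \<open>energy_decay\<close>.\<close>

lemma energy_rate:
  obtains C where "C > 0" "\<And>t. t \<ge> 2 \<Longrightarrow> E t \<le> C * t powr (- real DIM('a) / 2)"
proof -
  define n where "n = real DIM('a)"
  have n1: "n \<ge> 1" using DIM_positive[where 'a='a] unfolding n_def by linarith
  define C where "C = M\<^sup>2 * 4 powr (n/2) + exp 1 * M\<^sup>2 * (2 * n) powr (n/2)"
  have di: "x / inverse y = y * x" for x y :: real by (simp add: divide_simps)
  have C: "C > 0" using M n1 by (auto simp: C_def intro!: add_pos_nonneg)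
  have *: "E t \<le> C * t powr (- n / 2)" if "2 \<le> t" "t \<le> 2 ^ (k + 2)" for t k
    using that
  proof (induction k arbitrary: t)
    case 0
    have "E t \<le> M\<^sup>2" using 0 by (intro E_le) auto
    also have "\<dots> = M\<^sup>2 * 4 powr (n/2) * 4 powr (- n/2)" by (simp add: powr_minus)
    also have "\<dots> \<le> C * t powr (- n/2)"
      using 0 n1 M by (intro mult_mono powr_mono2') (auto simp: C_def)
    finally show ?case .
  next
    case (Suc k)
    show ?case
    proof (cases "t \<le> 4")
      case True
      have "E t \<le> M\<^sup>2" using Suc by (intro E_le) auto
      also have "\<dots> = M\<^sup>2 * 4 powr (n/2) * 4 powr (- n/2)" by (simp add: powr_minus)
      also have "\<dots> \<le> C * t powr (- n/2)"
        using Suc True n1 M by (intro mult_mono powr_mono2') (auto simp: C_def)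
      finally show ?thesis .
    next
      case False
      define s where "s = t / 2"
      \<comment> \<open>The second half of the time is divided into as many pieces as the dimension.
        Their joint loss exp(-n) compensates the factor 2^(n/2) that arises in passing from
        \<open>s\<close> to \<open>t = 2 * s\<close>, which a single loss of 1/e would fail to do in
        high dimension.\<close>
      define H where "H = s / n"
      have s: "s \<ge> 2" "s \<le> 2 ^ (k + 2)" "t = s + real DIM('a) * H" "H > 0"
        using False Suc.prems n1 by (auto simp: s_def H_def n_def)
      have "E t \<le> max (exp 1 * M\<^sup>2 * H powr (- n / 2)) (exp (- n) * E s)"
        unfolding s(3) n_def by (rule energy_decay[OF s(1,4)])
      also have "\<dots> \<le> C * t powr (- n/2)"
      proof (rule max.boundedI)
        have Ht: "H = t / (2 * n)" by (simp add: H_def s_def)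
        have "H powr (- n/2) = (2 * n) powr (n/2) * t powr (- n/2)"
        proof -
          have "H powr (- n/2) = t powr (- n/2) / (2 * n) powr (- n/2)" unfolding Ht by (rule powr_divide)
          also have "(2 * n) powr (- n/2) = inverse ((2 * n) powr (n/2))" using powr_minus[of "2 * n" "n/2"] by simp
          finally show ?thesis by (simp only: di)
        qed
        then have "exp 1 * M\<^sup>2 * H powr (- n / 2) = (exp 1 * M\<^sup>2 * (2 * n) powr (n/2)) * t powr (- n/2)" by simp
        also have "\<dots> \<le> C * t powr (- n/2)" by (intro mult_right_mono) (auto simp: C_def)
        finally show "exp 1 * M\<^sup>2 * H powr (- n / 2) \<le> C * t powr (- n/2)" .
        have "exp (- n) * E s \<le> exp (- n) * (C * s powr (- n/2))"
          using Suc.IH[OF s(1,2)] by (intro mult_left_mono) auto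
        also have "s powr (- n/2) = 2 powr (n/2) * t powr (- n/2)"
        proof -
          have "s powr (- n/2) = t powr (- n/2) / 2 powr (- n/2)" unfolding s_def by (rule powr_divide)
          also have "2 powr (- n/2) = inverse (2 powr (n/2))" using powr_minus[of 2 "n/2"] by simp
          finally show ?thesis by (simp only: di)
        qed
        also have "exp (- n) * (C * (2 powr (n/2) * t powr (- n/2))) = (exp (- n) * 2 powr (n/2)) * (C * t powr (- n/2))" by simp
        also have "\<dots> \<le> 1 * (C * t powr (- n/2))"
        proof (rule mult_right_mono)
          have "2 powr (n/2) \<le> exp 1 powr (n/2)" using n1 exp_ge_add_one_self[of 1] by (intro powr_mono2) auto
          also have "\<dots> = exp (n/2)" by (simp add: exp_powr_real)
          also have "\<dots> \<le> exp n" using n1 by simp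
          finally show "exp (- n) * 2 powr (n/2) \<le> 1" by (simp add: exp_minus field_simps)
        qed (use C in auto)
        finally show "exp (- n) * E s \<le> C * t powr (- n/2)" by simp
      qed
      finally show ?thesis .
    qed
  qed
  have "E t \<le> C * t powr (- n / 2)" if "t \<ge> 2" for t
  proof -
    obtain k where "t < 2 ^ k" using real_arch_pow[of 2 t] by auto
    also have "(2::real) ^ k \<le> 2 ^ (k + 2)" by (intro power_increasing) auto
    finally show ?thesis using that *[of t k] by simp
  qed
  with C that show thesis by (simp add: n_def)
qed

end

section \<open>Decay in the supremum norm\<close>

text \<open>Since \<kappa> is at most 2, values above the free threshold \<mu> are controlled by
  their square. This is how the energy enters the estimate of the nonlinearity.\<close>

lemma powr_interpolate:
  assumes k: "0 < \<kappa>" "\<kappa> \<le> 2" and l: "\<mu> > 0"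
  shows "\<bar>x\<bar> powr \<kappa> \<le> \<mu> powr \<kappa> + \<mu> powr (\<kappa> - 2) * (x::real)\<^sup>2"
proof (cases "\<bar>x\<bar> \<le> \<mu>")
  case True
  then have "\<bar>x\<bar> powr \<kappa> \<le> \<mu> powr \<kappa>" using k by (intro powr_mono2) auto
  then show ?thesis by (simp add: add_increasing2)
next
  case False
  then have x: "\<bar>x\<bar> > 0" using l by auto
  have "\<bar>x\<bar> powr \<kappa> = \<bar>x\<bar> powr (\<kappa> - 2) * \<bar>x\<bar> powr 2" by (subst powr_add[symmetric]) simp
  also have "\<bar>x\<bar> powr 2 = x\<^sup>2" using x by (simp add: powr_realpow[of _ 2, simplified])
  also have "\<bar>x\<bar> powr (\<kappa> - 2) * x\<^sup>2 \<le> \<mu> powr (\<kappa> - 2) * x\<^sup>2"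
    using False l k by (intro mult_right_mono powr_mono2') auto
  finally show ?thesis by (simp add: add_increasing)
qed

lemma powr_ratio: "x powr (n/2) * y powr (- n/2) = (x / y) powr (n / 2 :: real)"
proof -
  have "y powr (- n/2) = inverse (y powr (n/2))" using powr_minus[of y "n/2"] by simp
  then show ?thesis unfolding powr_divide by (simp only: divide_inverse)
qed

context mild_solution
begin

lemma n1: "real DIM('a) \<ge> 1"
  using DIM_positive[where 'a='a] by linarith

lemma kappa_n: "real DIM('a) * \<kappa> = 3/2"
  unfolding kappa using n1 by simp

text \<open>Only the last factor of the nonlinearity is estimated by the sup bound \<open>Y\<close>;
  the \<kappa>-th power is estimated by the energy. The result is linear in \<open>Y\<close>, decays
  in \<open>s\<close>, and has a singularity of exponent 7/8 in \<sigma>, which is still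
  integrable.\<close>

lemma dheat_g_sup:
  assumes s: "s > 0" and \<sigma>: "\<sigma> > 0" and Y: "\<And>y. \<bar>v s y\<bar> \<le> Y"
    and CE: "E s \<le> CE * s powr (- real DIM('a) / 2)"
  shows "\<bar>kconv (dheat_kernel a \<sigma>) (g s) x\<bar> \<le> Y * (cD * (1 + CE) * s powr (-(3/8)) * \<sigma> powr (-(7/8)))"
proof -
  define n where "n = real DIM('a)"
  \<comment> \<open>This threshold balances the two terms of \<open>powr_interpolate\<close>:
    \<mu>^(-2) equals (s \<sigma>)^(n/2) and cancels exactly the decay of the energy in
    \<open>s\<close> and the sup size of the kernel in \<sigma>.\<close>
  define \<mu> where "\<mu> = (s * \<sigma>) powr (- n / 4)"
  have l: "\<mu> > 0" using s \<sigma> by (simp add: \<mu>_def)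
  have lk: "\<mu> powr \<kappa> = s powr (-(3/8)) * \<sigma> powr (-(3/8))"
  proof -
    have "\<mu> powr \<kappa> = (s * \<sigma>) powr (- (n * \<kappa>) / 4)" by (simp add: \<mu>_def powr_powr)
    also have "\<dots> = (s * \<sigma>) powr (-(3/8))" by (simp only: n_def kappa_n) simp
    finally show ?thesis by (simp add: powr_mult)
  qed
  have l2: "\<mu> powr (\<kappa> - 2) = \<mu> powr \<kappa> * (s powr (n/2) * \<sigma> powr (n/2))"
  proof -
    have "\<mu> powr (\<kappa> - 2) = \<mu> powr \<kappa> * \<mu> powr (-2)" by (subst powr_add[symmetric]) simp
    also have "\<mu> powr (-2) = (s * \<sigma>) powr (n/2)" by (simp add: \<mu>_def powr_powr)
    finally show ?thesis by (simp add: powr_mult)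
  qed
  have Y0: "Y \<ge> 0" using Y[of 0] by linarith
  define d where "d = dheat_kernel a \<sigma>"
  have dL: "L1b d" unfolding d_def by (rule L1b_dheat_kernel[OF \<sigma>])
  have [measurable]: "d \<in> borel_measurable borel" using dL by auto
  define c where "c = cD * \<sigma> powr (-1/2)"
  have dl1: "l1 d \<le> c" unfolding d_def c_def cD_def by (rule l1_dheat_kernel[OF \<sigma>])
  have dsup: "\<bar>d z\<bar> \<le> c * \<sigma> powr (- n / 2)" for z unfolding d_def c_def cD_def n_def by (rule dheat_kernel_le[OF \<sigma>])
  have c0: "c \<ge> 0" using cD0 by (simp add: c_def)
  have vi: "integrable lborel (\<lambda>y. (v s y)\<^sup>2)" by (rule square_integrable[OF v_L1b[OF s]])
  have di: "integrable lborel (\<lambda>y. \<bar>d (x - y)\<bar>)"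
    using integrable_lborel_reflect[of d x] L1b_integrable[OF dL] by auto
  have dvi: "integrable lborel (\<lambda>y. \<bar>d (x - y)\<bar> * (v s y)\<^sup>2)"
    by (rule integrable_mult_bounded(2)[OF vi, where B="c * \<sigma> powr (- n / 2)"]) (use dsup in auto)
  have gi: "integrable lborel (\<lambda>y. d (x - y) * g s y)"
    by (rule kconv_integrable1[OF g_integrable[OF s] _ dsup]) simp
  have le: "\<bar>d (x - y) * g s y\<bar> \<le> Y * (\<mu> powr \<kappa> * \<bar>d (x - y)\<bar> + \<mu> powr (\<kappa> - 2) * (\<bar>d (x - y)\<bar> * (v s y)\<^sup>2))" for y
  proof -
    have "\<bar>d (x - y) * g s y\<bar> = \<bar>d (x - y)\<bar> * (\<bar>v s y\<bar> powr \<kappa> * \<bar>v s y\<bar>)" by (simp add: abs_mult g_def abs_pw)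
    also have "\<dots> \<le> \<bar>d (x - y)\<bar> * ((\<mu> powr \<kappa> + \<mu> powr (\<kappa> - 2) * (v s y)\<^sup>2) * Y)"
      using Y by (intro mult_left_mono mult_mono powr_interpolate k0 k2 l) auto
    finally show ?thesis by (simp add: algebra_simps)
  qed
  have "\<bar>kconv d (g s) x\<bar> \<le> (LINT y|lborel. Y * (\<mu> powr \<kappa> * \<bar>d (x - y)\<bar> + \<mu> powr (\<kappa> - 2) * (\<bar>d (x - y)\<bar> * (v s y)\<^sup>2)))"
    unfolding kconv_def
    by (intro order_trans[OF integral_abs_bound] integral_mono le integrable_abs gi integrable_mult_right impI Bochner_Integration.integrable_add di dvi)
  also have "\<dots> = Y * (\<mu> powr \<kappa> * (LINT y|lborel. \<bar>d (x - y)\<bar>) + \<mu> powr (\<kappa> - 2) * (LINT y|lborel. \<bar>d (x - y)\<bar> * (v s y)\<^sup>2))"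
    using di dvi by simp
  also have "\<dots> \<le> Y * (\<mu> powr \<kappa> * c + \<mu> powr (\<kappa> - 2) * (c * \<sigma> powr (- n / 2) * (CE * s powr (- n / 2))))"
  proof (intro mult_left_mono add_mono Y0)
    show "(LINT y|lborel. \<bar>d (x - y)\<bar>) \<le> c"
      using integral_lborel_reflect[of "\<lambda>y. \<bar>d y\<bar>" x] dl1 by (simp add: l1_def)
    have "(LINT y|lborel. \<bar>d (x - y)\<bar> * (v s y)\<^sup>2) \<le> (LINT y|lborel. c * \<sigma> powr (- n / 2) * (v s y)\<^sup>2)"
      using dsup by (intro integral_mono dvi integrable_mult_right impI vi mult_right_mono) auto
    also have "\<dots> = c * \<sigma> powr (- n / 2) * E s" by (simp add: E_def)
    also have "\<dots> \<le> c * \<sigma> powr (- n / 2) * (CE * s powr (- n / 2))"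
      using CE c0 by (intro mult_left_mono) (auto simp: n_def)
    finally show "(LINT y|lborel. \<bar>d (x - y)\<bar> * (v s y)\<^sup>2) \<le> c * \<sigma> powr (- n / 2) * (CE * s powr (- n / 2))" .
  qed auto
  also have "\<dots> = Y * (c * \<mu> powr \<kappa> * (1 + CE))"
  proof -
    have one: "s powr (n/2) * s powr (- n/2) = 1" "\<sigma> powr (n/2) * \<sigma> powr (- n/2) = 1"
      using s \<sigma> by (simp_all flip: powr_add)
    have "\<mu> powr (\<kappa> - 2) * (c * \<sigma> powr (- n / 2) * (CE * s powr (- n / 2))) = \<mu> powr \<kappa> * c * CE"
    proof -
      have "\<mu> powr (\<kappa> - 2) * (c * \<sigma> powr (- n / 2) * (CE * s powr (- n / 2))) =
          \<mu> powr \<kappa> * c * CE * (s powr (n/2) * s powr (- n/2)) * (\<sigma> powr (n/2) * \<sigma> powr (- n/2))"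
        unfolding l2 by (simp only: mult_ac)
      then show ?thesis by (simp only: one mult_1_right)
    qed
    then have "\<mu> powr \<kappa> * c + \<mu> powr (\<kappa> - 2) * (c * \<sigma> powr (- n / 2) * (CE * s powr (- n / 2))) = c * \<mu> powr \<kappa> * (1 + CE)"
      by (simp only: distrib_left distrib_right mult_1_left mult_1_right mult_ac)
    then show ?thesis by (simp only:)
  qed
  also have "c * \<mu> powr \<kappa> * (1 + CE) = cD * (1 + CE) * s powr (-(3/8)) * (\<sigma> powr (-1/2) * \<sigma> powr (-(3/8)))"
    by (simp add: c_def lk mult_ac)
  also have "\<sigma> powr (-1/2) * \<sigma> powr (-(3/8)) = \<sigma> powr (-(7/8))" by (simp flip: powr_add)
  finally show ?thesis by (simp add: d_def)
qed

text \<open>Restarting at t / 2 gives the optimal heat part plus a Duhamel part that is linear in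
  the assumed bound \<open>Y\<close> but carries the additional factor (t/2)^(-1/4), so it can be
  absorbed for large times. The 8 is the constant in the integral of \<sigma>^(-7/8).\<close>

lemma sup_step:
  assumes CE: "\<And>t. t \<ge> 2 \<Longrightarrow> E t \<le> CE * t powr (- real DIM('a) / 2)" "CE \<ge> 0"
    and t: "t \<ge> 4" and Y: "\<And>s x. 2 \<le> s \<Longrightarrow> s \<le> t \<Longrightarrow> \<bar>v s x\<bar> \<le> Y * s powr (- real DIM('a) / 2)" "Y \<ge> 0"
  shows "\<bar>v t x\<bar> \<le> 2 powr (real DIM('a) / 2) * (M + 8 * (1 + CE) * cD * Y * (t/2) powr (-(1/4))) * t powr (- real DIM('a) / 2)"
proof -
  define n where "n = real DIM('a)"
  define r where "r = t / 2"
  have r: "r \<ge> 2" "t = r + r" "r > 0" using t by (auto simp: r_def)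
  have "\<bar>kconv (heat_kernel r) (v r) x\<bar> \<le> l1 (v r) * r powr (- n / 2)"
    using nbD(4)[OF nb_heat[OF r(3) v_integrable[OF r(3)]]] by (simp add: n_def)
  also have "\<dots> \<le> M * r powr (- n / 2)" using v_l1[OF r(3)] by (intro mult_right_mono) auto
  finally have 1: "\<bar>kconv (heat_kernel r) (v r) x\<bar> \<le> M * r powr (- n / 2)" .
  define c where "c = Y * r powr (- n / 2) * (cD * (1 + CE) * r powr (-(3/8)))"
  have "\<bar>W r r x\<bar> \<le> (LINT s:{r<..<r + r}|lborel. c * (r + r - s) powr (-(7/8)))"
    unfolding W_def
  proof (rule set_integral_dominated)
    show "set_integrable lborel {r<..<r + r} (\<lambda>s. c * (r + r - s) powr (-(7/8)))"
      using powr_integrable'[of "7/8" r r] r by auto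
    fix s assume s: "s \<in> {r<..<r + r}"
    have sr: "s powr (- n/2) \<le> r powr (- n/2)" "s powr (-(3/8)) \<le> r powr (-(3/8))"
      using s r by (auto simp: n_def intro!: powr_mono2')
    have "\<bar>kconv (dheat_kernel a (r + r - s)) (g s) x\<bar> \<le> (Y * s powr (- n / 2)) * (cD * (1 + CE) * s powr (-(3/8)) * (r + r - s) powr (-(7/8)))"
      using s r Y by (intro dheat_g_sup CE) (auto simp: n_def)
    also have "\<dots> \<le> (Y * r powr (- n / 2)) * (cD * (1 + CE) * r powr (-(3/8)) * (r + r - s) powr (-(7/8)))"
      using sr Y(2) CE(2) cD0 by (intro mult_mono mult_left_mono mult_right_mono) auto
    finally show "\<bar>kconv (dheat_kernel a (r + r - s)) (g s) x\<bar> \<le> c * (r + r - s) powr (-(7/8))"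
      by (simp add: c_def mult_ac)
  qed auto
  also have "\<dots> = c * (8 * r powr (1/8))" using powr_integral'[of "7/8" r r] r by simp
  also have "\<dots> = 8 * (1 + CE) * cD * Y * (r powr (-(3/8)) * r powr (1/8)) * r powr (- n / 2)"
    by (simp add: c_def mult_ac)
  also have "r powr (-(3/8)) * r powr (1/8) = r powr (-(1/4))" by (simp flip: powr_add)
  finally have 2: "\<bar>W r r x\<bar> \<le> 8 * (1 + CE) * cD * Y * r powr (-(1/4)) * r powr (- n / 2)" .
  have "v t x = kconv (heat_kernel r) (v r) x + W r r x"
    unfolding r(2) using r by (intro restart) auto
  with 1 2 have "\<bar>v t x\<bar> \<le> M * r powr (- n / 2) + 8 * (1 + CE) * cD * Y * r powr (-(1/4)) * r powr (- n / 2)"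
    by linarith
  also have "\<dots> = (M + 8 * (1 + CE) * cD * Y * r powr (-(1/4))) * r powr (- n / 2)" by (simp add: distrib_right)
  also have "r powr (- n/2) = 2 powr (n/2) * t powr (- n/2)"
  proof -
    have "r powr (- n/2) = t powr (- n/2) / 2 powr (- n/2)" unfolding r_def by (rule powr_divide)
    also have "2 powr (- n/2) = inverse (2 powr (n/2))" using powr_minus[of 2 "n/2"] by simp
    finally show ?thesis by (simp add: field_simps)
  qed
  finally show ?thesis by (simp add: n_def r_def mult_ac)
qed

text \<open>For large times \<open>sup_step\<close> halves the constant \<open>Y\<close>, up to
  fixed terms. Absorption requires a finite constant to begin with, so on each bounded time range
  one starts from the bound \<open>M\<close> and iterates the halving infinitely often; the limit no
  longer depends on the range.\<close>

lemma v_nb: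
  obtains Cv where "Cv \<ge> 0" "\<And>t. t > 0 \<Longrightarrow> nb t Cv (v t)"
proof -
  define n where "n = real DIM('a)"
  obtain CE where CE: "CE > 0" "\<And>t. t \<ge> 2 \<Longrightarrow> E t \<le> CE * t powr (- real DIM('a) / 2)" by (rule energy_rate) blast
  define q where "q = 2 powr (n/2) * (8 * (1 + CE) * cD) + 1"
  have q: "q \<ge> 1" using CE cD0 by (simp add: q_def)
  \<comment> \<open>The fourth power inverts the exponent 1/4 of \<open>sup_step\<close>: beyond
    time 2 R the coefficient of \<open>Y\<close> is at most 1/2.\<close>
  define R where "R = (2 * q) ^ 4"
  have R: "R \<ge> 16"
  proof -
    have "(2::real) ^ 4 \<le> (2 * q) ^ 4" using q by (intro power_mono) auto
    then show ?thesis by (simp add: R_def)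
  qed
  have Rp: "R powr (-(1/4)) = 1 / (2 * q)"
  proof -
    have "R = (2 * q) powr 4" using q by (simp add: R_def powr_realpow[of "2 * q" 4, simplified])
    then have "R powr (-(1/4)) = (2 * q) powr (-1)" by (simp add: powr_powr)
    then show ?thesis using q by (simp add: powr_minus field_simps)
  qed
  define Y0 where "Y0 = M * (2 * R) powr (n/2)"
  define C0 where "C0 = 2 powr (n/2) * M"
  \<comment> \<open>The fixed point of the map sending Y to Y0 + C0 + Y / 2.\<close>
  define D where "D = 2 * (Y0 + C0)"
  have pos: "Y0 \<ge> 0" "C0 \<ge> 0" "D \<ge> 0" using M by (auto simp: Y0_def C0_def D_def)
  have small: "\<bar>v t x\<bar> \<le> Y0 * t powr (- n/2)" if "0 < t" "t \<le> 2 * R" for t x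
  proof -
    have "(2 * R) powr (n/2) * t powr (- n/2) = ((2 * R) / t) powr (n/2)"
      by (rule powr_ratio)
    also have "\<dots> \<ge> 1" using that R n1 by (intro ge_one_powr_ge_zero) (auto simp: n_def)
    finally have "M * 1 \<le> M * ((2 * R) powr (n/2) * t powr (- n/2))" using M by (intro mult_left_mono) auto
    then show ?thesis using v_bound[OF that(1), of x] by (simp add: Y0_def mult_ac)
  qed
  \<comment> \<open>At k = 0 this is the trivial bound \<open>M\<close> rescaled to the range up to
    \<open>T\<close>; each further k halves the excess over \<open>D\<close>.\<close>
  have iter: "\<bar>v s x\<bar> \<le> (D + M * T powr (n/2) / 2 ^ k) * s powr (- n/2)" if "2 \<le> s" "s \<le> T" for s x T k
    using that
  proof (induction k arbitrary: s x)
    case 0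
    have "1 \<le> (T / s) powr (n/2)" using 0 n1 by (intro ge_one_powr_ge_zero) (auto simp: n_def)
    also have "\<dots> = T powr (n/2) * s powr (- n/2)" by (rule powr_ratio[symmetric])
    finally have "M * 1 \<le> M * (T powr (n/2) * s powr (- n/2))" using M by (intro mult_left_mono) auto
    moreover have "0 \<le> D * s powr (- n/2)" using pos by simp
    moreover have "(D + M * T powr (n/2) / 2 ^ 0) * s powr (- n/2) = D * s powr (- n/2) + M * (T powr (n/2) * s powr (- n/2))"
      by (simp add: distrib_right mult.assoc)
    ultimately show ?case using v_bound[of s x] 0 by linarith
  next
    case (Suc k)
    define Y where "Y = D + M * T powr (n/2) / 2 ^ k"
    have Y: "Y \<ge> 0" using pos M by (simp add: Y_def)
    have eq: "D + M * T powr (n/2) / 2 ^ Suc k = Y0 + C0 + Y / 2" by (simp add: Y_def D_def field_simps)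
    show ?case unfolding eq
    proof (cases "s \<le> 2 * R")
      case True
      have "\<bar>v s x\<bar> \<le> Y0 * s powr (- n/2)" using True Suc.prems by (intro small) auto
      also have "\<dots> \<le> (Y0 + C0 + Y / 2) * s powr (- n/2)" using pos Y by (intro mult_right_mono) auto
      finally show "\<bar>v s x\<bar> \<le> (Y0 + C0 + Y / 2) * s powr (- n/2)" .
    next
      case False
      have "\<bar>v s x\<bar> \<le> 2 powr (n/2) * (M + 8 * (1 + CE) * cD * Y * (s/2) powr (-(1/4))) * s powr (- n/2)"
        unfolding n_def using CE R False Suc Y
        by (intro sup_step) (auto simp: Y_def n_def)
      also have "\<dots> \<le> (C0 + Y / 2) * s powr (- n/2)"
      proof (rule mult_right_mono)
        have "(s/2) powr (-(1/4)) \<le> R powr (-(1/4))" using False R by (intro powr_mono2') auto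
        then have s4: "(s/2) powr (-(1/4)) \<le> 1 / (2 * q)" using Rp by simp
        have "2 powr (n/2) * (8 * (1 + CE) * cD) * (Y * (s/2) powr (-(1/4))) \<le> q * (Y * (1 / (2 * q)))"
          using s4 Y q by (intro mult_mono) (auto simp: q_def)
        also have "\<dots> = Y / 2" using q by simp
        finally show "2 powr (n/2) * (M + 8 * (1 + CE) * cD * Y * (s/2) powr (-(1/4))) \<le> C0 + Y / 2"
          by (simp add: C0_def algebra_simps)
      qed simp
      also have "\<dots> \<le> (Y0 + C0 + Y / 2) * s powr (- n/2)" using pos by (intro mult_right_mono) auto
      finally show "\<bar>v s x\<bar> \<le> (Y0 + C0 + Y / 2) * s powr (- n/2)" .
    qed
  qed
  have big: "\<bar>v t x\<bar> \<le> D * t powr (- n/2)" if "t \<ge> 2" for t x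
  proof (rule tendsto_lowerbound[OF _ always_eventually])
    show "\<forall>k. \<bar>v t x\<bar> \<le> (D + M * t powr (n/2) / 2 ^ k) * t powr (- n/2)" using iter that by auto
    have "(\<lambda>k. M * t powr (n/2) * (1/2::real) ^ k) \<longlonglongrightarrow> M * t powr (n/2) * 0"
      by (intro tendsto_intros LIMSEQ_power_zero) auto
    then have "(\<lambda>k. M * t powr (n/2) / 2 ^ k) \<longlonglongrightarrow> 0" by (simp add: power_divide)
    then have "(\<lambda>k. (D + M * t powr (n/2) / 2 ^ k) * t powr (- n/2)) \<longlonglongrightarrow> (D + 0) * t powr (- n/2)"
      by (intro tendsto_intros)
    then show "(\<lambda>k. (D + M * t powr (n/2) / 2 ^ k) * t powr (- n/2)) \<longlonglongrightarrow> D * t powr (- n/2)" by simp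
  qed simp
  have all: "\<bar>v t x\<bar> \<le> (D + M) * t powr (- n/2)" if "t > 0" for t x
  proof (cases "t \<ge> 2")
    case True
    then show ?thesis using big[OF True, of x] M by (simp add: distrib_right add_increasing2)
  next
    case False
    have "\<bar>v t x\<bar> \<le> Y0 * t powr (- n/2)" using False R that by (intro small) auto
    also have "\<dots> \<le> (D + M) * t powr (- n/2)" using pos M by (intro mult_right_mono) (auto simp: D_def)
    finally show ?thesis .
  qed
  show thesis
  proof (rule that[of "D + M"])
    show "D + M \<ge> 0" using pos M by simp
    show "nb t (D + M) (v t)" if "t > 0" for t
      using all[OF that] v_integrable[OF that] v_l1[OF that] pos by (auto simp: nb_def n_def)
  qed
qed

end

section \<open>Asymptotic expansion\<close>

text \<open>Exponents can be lowered for times above 1 and raised below 1; this merges bounds from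
  both regimes into one valid for all positive times.\<close>

lemma nb_powr_mono:
  assumes n: "nb t (A * t powr (- \<alpha>)) \<phi>" and A: "A \<ge> 0" and t: "t > 0"
    and ab: "t \<ge> 1 \<and> \<beta> \<le> \<alpha> \<or> t \<le> 1 \<and> \<alpha> \<le> \<beta>" and AB: "A \<le> A'"
  shows "nb t (A' * t powr (- \<beta>)) \<phi>"
proof (rule nb_mono[OF n])
  have "t powr (- \<alpha>) \<le> t powr (- \<beta>)"
    using ab
  proof
    assume "t \<ge> 1 \<and> \<beta> \<le> \<alpha>" then show ?thesis by (intro powr_mono) auto
  next
    assume "t \<le> 1 \<and> \<alpha> \<le> \<beta>" then show ?thesis using t by (intro powr_mono') auto
  qed
  then show "A * t powr (- \<alpha>) \<le> A' * t powr (- \<beta>)" using A AB by (intro mult_mono) auto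
qed

lemma nb_powr_mono0:
  assumes n: "nb t A \<phi>" and A: "A \<ge> 0" and t: "t > 0" "t \<le> 1" and ab: "\<beta> \<ge> 0" and AB: "A \<le> A'"
  shows "nb t (A' * t powr (- \<beta>)) \<phi>"
  using nb_powr_mono[of t A 0 \<phi> \<beta> A'] assms by simp

text \<open>In \<open>second_order\<close> this weight majorises the early history of the source:
  the rate 3/4 is integrable at 0, the rate 1 + \<delta> at infinity.\<close>

lemma tail_weight_integrable:
  assumes d: "\<delta> > 0"
  shows "set_integrable lborel {0<..} (\<lambda>s::real. if s \<le> 1 then s powr (-(3/4)) else s powr (-(1 + \<delta>)))" (is "set_integrable _ _ ?\<omega>")
proof -
  have 1: "set_integrable lborel {0<..<1} ?\<omega>"
    using powr_integrable[of "3/4" 1] by (rule set_integrable_cong[THEN iffD1, rotated -1]) auto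
  have "((\<lambda>x. x powr (-(1 + \<delta>))) has_integral -(1 powr (-(1 + \<delta>)+1)) / (-(1 + \<delta>)+1)) {1..}"
    using d by (intro has_integral_powr_to_inf) auto
  then have n: "integral\<^sup>N lborel (\<lambda>x. ennreal (x powr (-(1 + \<delta>))) * indicator {1..} x) = ennreal (-(1 powr (-(1 + \<delta>)+1)) / (-(1 + \<delta>)+1))"
    by (intro nn_integral_has_integral_lebesgue') auto
  define q where "q = (\<lambda>x. indicator {1..} x *\<^sub>R ?\<omega> x)"
  have q0: "q x \<ge> 0" for x by (simp add: q_def)
  have [measurable]: "q \<in> borel_measurable borel" unfolding q_def by measurable
  have "ennreal (x powr (-(1 + \<delta>))) * indicator {1..} x = ennreal (q x)" for x
    by (auto simp: q_def indicator_def)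
  with n have nq: "(\<integral>\<^sup>+x. ennreal (q x) \<partial>lborel) = ennreal (-(1 powr (-(1 + \<delta>)+1)) / (-(1 + \<delta>)+1))" by simp
  have 2: "set_integrable lborel {1..} ?\<omega>"
    unfolding set_integrable_def q_def[symmetric] by (rule integrableI_nonneg) (auto simp: nq q0)
  have "{0<..<1} \<union> {1..} = {0::real<..}" by auto
  with set_integrable_Un[OF 1 2] show ?thesis by simp
qed

text \<open>A power of the kernel is still Gaussian and absorbs the factor norm y at the cost of
  sqrt s; the power itself has size s^(-3/4). This gives the first moment of the leading odd
  term.\<close>

lemma norm_heat_kernel_powr:
  fixes y :: "'a::euclidean_space"
  assumes s: "s > 0" and k: "\<kappa> > 0" and nk: "real DIM('a) * \<kappa> = 3/2"
  shows "norm y * heat_kernel s y powr \<kappa> \<le> s powr (-(1/4)) / sqrt \<kappa>"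
proof -
  define z where "z = norm y / sqrt s"
  have z: "norm y = z * sqrt s" "z \<ge> 0" using s by (auto simp: z_def)
  have "heat_kernel s y powr \<kappa> = ((4 * pi * s) powr (- real DIM('a) / 2)) powr \<kappa> * exp (- (norm y)\<^sup>2 / (4 * s)) powr \<kappa>"
    unfolding heat_kernel_def by (rule powr_mult)
  also have "((4 * pi * s) powr (- real DIM('a) / 2)) powr \<kappa> = (4 * pi * s) powr (- (real DIM('a) * \<kappa>) / 2)"
    by (simp add: powr_powr)
  also have "\<dots> = (4 * pi * s) powr (-(3/4))" unfolding nk by simp
  also have "exp (- (norm y)\<^sup>2 / (4 * s)) powr \<kappa> = exp (- (\<kappa> * z\<^sup>2 / 4))"
    using s by (simp add: exp_powr_real z(1) power_mult_distrib mult_ac)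
  finally have eq: "heat_kernel s y powr \<kappa> = (4 * pi * s) powr (-(3/4)) * exp (- (\<kappa> * z\<^sup>2 / 4))" .
  have p: "(4 * pi * s) powr (-(3/4)) \<le> s powr (-(3/4))" using s pi_ge_two by (intro powr_mono2') auto
  have "sqrt \<kappa> * z \<le> 1 + \<kappa> * z\<^sup>2 / 4"
  proof -
    have "0 \<le> (1 - sqrt \<kappa> * z / 2)\<^sup>2" by simp
    also have "\<dots> = 1 - sqrt \<kappa> * z + (sqrt \<kappa>)\<^sup>2 * z\<^sup>2 / 4" by (simp add: power2_eq_square algebra_simps)
    finally show ?thesis using k by simp
  qed
  also have "\<dots> \<le> exp (\<kappa> * z\<^sup>2 / 4)" by (rule exp_ge_add_one_self)
  finally have ze: "z * exp (- (\<kappa> * z\<^sup>2 / 4)) \<le> 1 / sqrt \<kappa>"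
    using k by (simp add: exp_minus field_simps)
  have "norm y * heat_kernel s y powr \<kappa> = (4 * pi * s) powr (-(3/4)) * (sqrt s * (z * exp (- (\<kappa> * z\<^sup>2 / 4))))"
    by (simp add: eq z(1))
  also have "\<dots> \<le> s powr (-(3/4)) * (sqrt s * (1 / sqrt \<kappa>))"
    using p ze z s k by (intro mult_mono mult_left_mono) auto
  also have "\<dots> = (s powr (-(3/4)) * s powr (1/2)) / sqrt \<kappa>" using s by (simp add: powr_half_sqrt)
  also have "s powr (-(3/4)) * s powr (1/2) = s powr (-(1/4))" by (simp flip: powr_add)
  finally show ?thesis .
qed

context mild_solution
begin

section \<open>The two profiles and the preliminary rates\<close>

definition m0 where "m0 = (LINT y|lborel. w0 y)"
definition a0 where "a0 s x = m0 * heat_kernel s (x::'a)"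
definition g0 where "g0 s x = pw \<kappa> (a0 s x)"
text \<open>This is \<open>A01\<close> written with convolutions and the Borel representative of the
  datum; the two are identified in the final theorem.\<close>

definition A1 where "A1 t x = a0 t x + duh a g0 t x"

lemma a0_measurable [measurable (raw)]:
  "T \<in> borel_measurable N \<Longrightarrow> X \<in> borel_measurable N \<Longrightarrow> (\<lambda>w. a0 (T w) (X w)) \<in> borel_measurable N"
  unfolding a0_def by measurable

lemma g0_joint [measurable]: "(\<lambda>p. g0 (fst p) (snd p)) \<in> borel_measurable (borel \<Otimes>\<^sub>M borel)"
  unfolding g0_def by measurable

lemma a0_nb: "t > 0 \<Longrightarrow> nb t \<bar>m0\<bar> (a0 t)"
proof -
  assume t: "t > 0"
  have "nb t 1 (heat_kernel t :: 'a \<Rightarrow> real)"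
    using t heat_kernel_le[OF t] by (auto simp: nb_def l1_heat_kernel)
  from nb_mult[OF this, of "a0 t" "\<bar>m0\<bar>"] show ?thesis
    by (auto simp: a0_def abs_mult)
qed

text \<open>The relation n \<kappa> = 3/2 removes the dimension from all exponents: the \<kappa>-th
  power of a quantity of heat kernel size is of order s^(-3/4), the \<kappa>/2-th power of order
  s^(-3/8).\<close>

lemma scale_powr:
  assumes "A \<ge> 0"
  shows "(A * s powr (- real DIM('a) / 2)) powr \<kappa> = A powr \<kappa> * s powr (-(3/4))"
    and "(A * s powr (- real DIM('a) / 2)) powr (\<kappa>/2) = A powr (\<kappa>/2) * s powr (-(3/8))"
proof -
  have "(s powr (- real DIM('a) / 2)) powr \<kappa> = s powr (- (real DIM('a) * \<kappa>) / 2)"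
    "(s powr (- real DIM('a) / 2)) powr (\<kappa>/2) = s powr (- (real DIM('a) * \<kappa>) / 4)"
    by (simp_all add: powr_powr)
  then show "(A * s powr (- real DIM('a) / 2)) powr \<kappa> = A powr \<kappa> * s powr (-(3/4))"
    "(A * s powr (- real DIM('a) / 2)) powr (\<kappa>/2) = A powr (\<kappa>/2) * s powr (-(3/8))"
    unfolding kappa_n powr_mult by simp_all
qed

lemma nb_pw:
  fixes \<phi> :: "'a \<Rightarrow> real"
  assumes n: "nb s A \<phi>"
  shows "nb s (A powr \<kappa> * A * s powr (-(3/4))) (\<lambda>x. pw \<kappa> (\<phi> x))"
proof -
  have [measurable]: "\<phi> \<in> borel_measurable borel" using nbD[OF n] by simp
  have "\<bar>pw \<kappa> (\<phi> x)\<bar> \<le> A powr \<kappa> * s powr (-(3/4)) * \<bar>\<phi> x\<bar>" for x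
  proof -
    have "\<bar>\<phi> x\<bar> powr \<kappa> \<le> (A * s powr (- real DIM('a) / 2)) powr \<kappa>"
      using nbD(4)[OF n] k0 by (intro powr_mono2) auto
    then show ?thesis unfolding abs_pw scale_powr(1)[OF nbD(5)[OF n]] by (intro mult_right_mono) auto
  qed
  from nb_mult[OF n _ this] have "nb s (A powr \<kappa> * s powr (-(3/4)) * A) (\<lambda>x. pw \<kappa> (\<phi> x))" by simp
  then show ?thesis by (simp add: mult_ac)
qed

definition m1 where "m1 = (LINT y|lborel. norm y * \<bar>w0 y\<bar>)"

lemma m1_nonneg: "m1 \<ge> 0" by (simp add: m1_def)

text \<open>The finite first moment of the datum enters here. The resulting rate 1/2 for the linear
  part is already the rate of the theorem.\<close>

lemma heat_w0_nb:
  assumes t: "t > 0"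
  shows "nb t (kernel_const TYPE('a) * m1 * t powr (-(1/2))) (\<lambda>x. kconv (heat_kernel t) w0 x - a0 t x)"
proof -
  have "nb t (kernel_const TYPE('a) * t powr (-1/2) * (LINT y|lborel. norm y * \<bar>w0 y\<bar>)) (\<lambda>x. kconv (heat_kernel t) w0 x - (LINT y|lborel. w0 y) * heat_kernel t x)"
    using l1_heat_kernel_shift[OF t, where 'a='a] t
    by (intro nb_moment L1b_heat_kernel w0 w0_moment) auto
  then show ?thesis by (simp add: a0_def m0_def m1_def mult_ac)
qed

lemma duh_g: "t > 0 \<Longrightarrow> v t x = kconv (heat_kernel t) w0 x + duh a g t x"
  using duhamel by (simp add: g_def[abs_def])

context
  fixes Cv :: real
  assumes Cv0: "Cv \<ge> 0" and vnb: "\<And>t. t > 0 \<Longrightarrow> nb t Cv (v t)"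
begin

lemma g_nb: "s > 0 \<Longrightarrow> nb s (Cv powr \<kappa> * Cv * s powr (-(3/4))) (g s)"
  using nb_pw[OF vnb, of s] by (simp add: g_def[abs_def])

lemma g0_nb: "s > 0 \<Longrightarrow> nb s (\<bar>m0\<bar> powr \<kappa> * \<bar>m0\<bar> * s powr (-(3/4))) (g0 s)"
  using nb_pw[OF a0_nb, of s] by (simp add: g0_def[abs_def])

text \<open>Both nonlinear terms are Duhamel integrals of sources of order s^(-3/4), whence the rate
  1/4. The 12 in the constants is 2 / (1 - \<alpha>) + 4 at \<alpha> = 3/4.\<close>

lemma first_order:
  obtains C where "C \<ge> 0" "\<And>t. t > 0 \<Longrightarrow> nb t (C * t powr (-(1/4))) (\<lambda>x. v t x - a0 t x)"
    "\<And>t. t > 0 \<Longrightarrow> nb t (C * t powr (-(1/4))) (duh a g0 t)"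
proof -
  define D where "D = Cv powr \<kappa> * Cv"
  define D' where "D' = \<bar>m0\<bar> powr \<kappa> * \<bar>m0\<bar>"
  have D: "D \<ge> 0" "D' \<ge> 0" using Cv0 by (auto simp: D_def D'_def)
  define X where "X = duh_const a * 12 * D"
  define X' where "X' = duh_const a * 12 * D'"
  have X: "X \<ge> 0" "X' \<ge> 0" using D by (auto simp: X_def X'_def)
  define k where "k = kernel_const TYPE('a) * m1"
  have k: "k \<ge> 0" using m1_nonneg by (simp add: k_def)
  define C where "C = X + X' + k + Cv + \<bar>m0\<bar>"
  have C: "C \<ge> 0" using X k Cv0 by (simp add: C_def)
  have 1: "nb t (X * t powr (-(1/4))) (duh a g t)" if "t > 0" for t
    using nb_duh_powr(1)[OF g_joint that, of D "3/4" a] g_nb D by (simp add: X_def D_def)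
  have 2: "nb t (X' * t powr (-(1/4))) (duh a g0 t)" if "t > 0" for t
    using nb_duh_powr(1)[OF g0_joint that, of D' "3/4" a] g0_nb D by (simp add: X'_def D'_def)
  have 3: "nb t (C * t powr (-(1/4))) (\<lambda>x. v t x - a0 t x)" if t: "t > 0" for t
  proof (cases "t \<ge> 1")
    case True
    have "nb t (k * t powr (-(1/4))) (\<lambda>x. kconv (heat_kernel t) w0 x - a0 t x)"
      by (rule nb_powr_mono[OF heat_w0_nb[OF t, folded k_def] k t]) (use True in auto)
    from nb_add[OF this 1[OF t]] have "nb t ((k + X) * t powr (-(1/4))) (\<lambda>x. v t x - a0 t x)"
      by (simp add: duh_g[OF t] distrib_right algebra_simps)
    then show ?thesis by (rule nb_mono) (use X Cv0 in \<open>auto simp: C_def intro!: mult_right_mono\<close>)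
  next
    case False
    show ?thesis
      by (rule nb_powr_mono0[OF nb_diff[OF vnb[OF t] a0_nb[OF t]]]) (use False t Cv0 X k in \<open>auto simp: C_def\<close>)
  qed
  have 4: "nb t (C * t powr (-(1/4))) (duh a g0 t)" if t: "t > 0" for t
    by (rule nb_mono[OF 2[OF t]]) (use X Cv0 k in \<open>auto simp: C_def intro!: mult_right_mono\<close>)
  show thesis by (rule that[OF C 3 4])
qed

lemma v_a0_bound: "s > 0 \<Longrightarrow> \<bar>v s x\<bar> \<le> (Cv + \<bar>m0\<bar>) * s powr (- real DIM('a) / 2)"
  "s > 0 \<Longrightarrow> \<bar>a0 s x\<bar> \<le> (Cv + \<bar>m0\<bar>) * s powr (- real DIM('a) / 2)"
  using nbD(4)[OF vnb, of s x] nbD(4)[OF a0_nb, of s x] Cv0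
  by (auto simp: distrib_right intro!: add_increasing2 add_increasing)

text \<open>The Lipschitz bound combined with \<open>first_order\<close> gives the critical rate 1,
  while estimating the two terms separately gives 3/4, which is integrable at 0. The rate 7/8
  interpolates: it holds for all times and, being below 1, is admissible in
  \<open>nb_duh_powr\<close>.\<close>

lemma g_diff_nb:
  obtains C where "C \<ge> 0" "\<And>s. s > 0 \<Longrightarrow> nb s (C * s powr (-1)) (\<lambda>x. g s x - g0 s x)"
    "\<And>s. s > 0 \<Longrightarrow> nb s (C * s powr (-(3/4))) (\<lambda>x. g s x - g0 s x)"
    "\<And>s. s > 0 \<Longrightarrow> nb s (C * s powr (-(7/8))) (\<lambda>x. g s x - g0 s x)"
proof -
  obtain C1 where C1: "C1 \<ge> 0" "\<And>t. t > 0 \<Longrightarrow> nb t (C1 * t powr (-(1/4))) (\<lambda>x. v t x - a0 t x)"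
    by (rule first_order) blast
  define L where "L = (\<kappa> + 1) * (Cv + \<bar>m0\<bar>) powr \<kappa>"
  have L: "L \<ge> 0" using k0 by (simp add: L_def)
  define D where "D = Cv powr \<kappa> * Cv + \<bar>m0\<bar> powr \<kappa> * \<bar>m0\<bar>"
  have D: "D \<ge> 0" using Cv0 by (simp add: D_def)
  define C where "C = L * C1 + D"
  have C: "C \<ge> 0" "L * C1 \<le> C" "D \<le> C" using L C1 D by (auto simp: C_def)
  have 1: "nb s (C * s powr (-1)) (\<lambda>x. g s x - g0 s x)" if s: "s > 0" for s
  proof -
    have "nb s (L * s powr (-(3/4)) * (C1 * s powr (-(1/4)))) (\<lambda>x. g s x - g0 s x)"
    proof (rule nb_mult[OF C1(2)[OF s]])
      show "\<bar>g s x - g0 s x\<bar> \<le> L * s powr (-(3/4)) * \<bar>v s x - a0 s x\<bar>" for x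
        using pw_lipschitz[OF k0 v_a0_bound[OF s, of x], unfolded scale_powr(1)[OF add_nonneg_nonneg[OF Cv0 abs_ge_zero]]]
        by (simp add: g_def g0_def L_def mult_ac)
    qed (use L in \<open>auto simp: g_def g0_def\<close>)
    moreover have "L * s powr (-(3/4)) * (C1 * s powr (-(1/4))) = L * C1 * (s powr (-(3/4)) * s powr (-(1/4)))" by simp
    moreover have "s powr (-(3/4)) * s powr (-(1/4)) = s powr (-1)" by (simp flip: powr_add)
    ultimately have "nb s (L * C1 * s powr (-1)) (\<lambda>x. g s x - g0 s x)" by simp
    then show ?thesis by (rule nb_mono) (intro mult_right_mono C, simp)
  qed
  have 2: "nb s (C * s powr (-(3/4))) (\<lambda>x. g s x - g0 s x)" if s: "s > 0" for s
  proof -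
    have "nb s (D * s powr (-(3/4))) (\<lambda>x. g s x - g0 s x)"
      using nb_diff[OF g_nb[OF s] g0_nb[OF s]] by (simp add: D_def distrib_right)
    then show ?thesis by (rule nb_mono) (intro mult_right_mono C, simp)
  qed
  have 3: "nb s (C * s powr (-(7/8))) (\<lambda>x. g s x - g0 s x)" if s: "s > 0" for s
  proof (cases "s \<ge> 1")
    case True
    show ?thesis by (rule nb_powr_mono[OF 1[OF s] C(1) s]) (use True in auto)
  next
    case False
    show ?thesis by (rule nb_powr_mono[OF 2[OF s] C(1) s]) (use False in auto)
  qed
  show thesis by (rule that[OF C(1) 1 2 3])
qed

lemma gd_joint: "(\<lambda>p. (\<lambda>s y. g s y - g0 s y) (fst p) (snd p)) \<in> borel_measurable (borel \<Otimes>\<^sub>M borel)"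
  by measurable

lemma v_minus_A1:
  assumes t: "t > 0"
  shows "v t x - A1 t x = (kconv (heat_kernel t) w0 x - a0 t x) + duh a (\<lambda>s y. g s y - g0 s y) t x"
proof -
  have D: "Cv powr \<kappa> * Cv \<ge> 0" "\<bar>m0\<bar> powr \<kappa> * \<bar>m0\<bar> \<ge> 0" using Cv0 by auto
  have i: "set_integrable lborel {0<..<t} (\<lambda>s. kconv (dheat_kernel a (t - s)) (g s) x)"
    "set_integrable lborel {0<..<t} (\<lambda>s. kconv (dheat_kernel a (t - s)) (g0 s) x)"
    using nb_duh_powr(2)[OF g_joint t g_nb _ _ D(1)] nb_duh_powr(2)[OF g0_joint t g0_nb _ _ D(2)] by auto
  have "duh a (\<lambda>s y. g s y - g0 s y) t x = (LINT s:{0<..<t}|lborel. kconv (dheat_kernel a (t - s)) (g s) x - kconv (dheat_kernel a (t - s)) (g0 s) x)"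
    unfolding duh_def
  proof (rule set_lebesgue_integral_cong; safe?)
    fix s assume "s \<in> {0<..<t}"
    then show "kconv (dheat_kernel a (t - s)) (\<lambda>y. g s y - g0 s y) x = kconv (dheat_kernel a (t - s)) (g s) x - kconv (dheat_kernel a (t - s)) (g0 s) x"
      using nbD(2)[OF g_nb, of s] nbD(2)[OF g0_nb, of s] by (intro kconv_diff_right L1b_dheat_kernel) auto
  qed simp
  also have "\<dots> = duh a g t x - duh a g0 t x"
    unfolding duh_def by (rule set_integral_diff(2)[OF i])
  finally show ?thesis using duh_g[OF t, of x] by (simp add: A1_def)
qed

text \<open>For times above 1, a source of rate 7/8 yields 1/2 - 7/8 = -3/8, with 20 = 2 / (1 -
  \<alpha>) + 4 at \<alpha> = 7/8. For smaller times the bounds of \<open>first_order\<close> are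
  already stronger.\<close>

lemma second_order_rough:
  obtains C where "C \<ge> 0" "\<And>t. t > 0 \<Longrightarrow> nb t (C * t powr (-(3/8))) (\<lambda>x. v t x - A1 t x)"
proof -
  obtain C1 where C1: "C1 \<ge> 0" "\<And>t. t > 0 \<Longrightarrow> nb t (C1 * t powr (-(1/4))) (\<lambda>x. v t x - a0 t x)"
    "\<And>t. t > 0 \<Longrightarrow> nb t (C1 * t powr (-(1/4))) (duh a g0 t)"
    by (rule first_order) blast
  obtain C2 where C2: "C2 \<ge> 0" "\<And>s. s > 0 \<Longrightarrow> nb s (C2 * s powr (-(7/8))) (\<lambda>x. g s x - g0 s x)"
    by (rule g_diff_nb) blast
  define X where "X = duh_const a * 20 * C2"
  have X: "X \<ge> 0" using C2 by (simp add: X_def)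
  define k where "k = kernel_const TYPE('a) * m1"
  have k: "k \<ge> 0" using m1_nonneg by (simp add: k_def)
  define C where "C = 2 * C1 + X + k"
  have C: "C \<ge> 0" using C1 X k by (simp add: C_def)
  have "nb t (C * t powr (-(3/8))) (\<lambda>x. v t x - A1 t x)" if t: "t > 0" for t
  proof (cases "t \<ge> 1")
    case True
    have 1: "nb t (X * t powr (-(3/8))) (duh a (\<lambda>s y. g s y - g0 s y) t)"
      using nb_duh_powr(1)[OF gd_joint t, of C2 "7/8" a] C2 by (simp add: X_def)
    have "nb t (k * t powr (-(3/8))) (\<lambda>x. kconv (heat_kernel t) w0 x - a0 t x)"
      by (rule nb_powr_mono[OF heat_w0_nb[OF t, folded k_def] k t]) (use True in auto)
    from nb_add[OF this 1] have "nb t ((k + X) * t powr (-(3/8))) (\<lambda>x. v t x - A1 t x)"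
      by (simp add: v_minus_A1[OF t] distrib_right)
    then show ?thesis by (rule nb_mono) (use C1 in \<open>auto simp: C_def intro!: mult_right_mono\<close>)
  next
    case False
    have "nb t (2 * C1 * t powr (-(1/4))) (\<lambda>x. v t x - A1 t x)"
      using nb_diff[OF C1(2)[OF t] C1(3)[OF t]] by (simp add: A1_def algebra_simps)
    then show ?thesis by (rule nb_powr_mono) (use False t C1 X k in \<open>auto simp: C_def\<close>)
  qed
  with C that show thesis by blast
qed

text \<open>The leading part of the difference of the nonlinearities is odd, hence has zero mean; this
  cancellation is what removes the logarithm.\<close>

definition h1 where "h1 s x = (\<kappa> + 1) * \<bar>a0 s x\<bar> powr \<kappa> * duh a g0 s x"

text \<open>The leading profile is radial, so its nonlinearity is even, and the derivative kernel is
  odd; convolution and time integration preserve this parity.\<close>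

lemma duh_g0_odd: "duh a g0 s (- x) = - duh a g0 s x"
proof -
  have g0e: "g0 r (- y) = g0 r y" for r y by (simp add: g0_def a0_def)
  have "kconv (dheat_kernel a \<tau>) (g0 r) (- x) = - kconv (dheat_kernel a \<tau>) (g0 r) x" for \<tau> r
  proof -
    have [measurable]: "g0 r \<in> borel_measurable borel" unfolding g0_def by measurable
    have "kconv (dheat_kernel a \<tau>) (g0 r) (- x) = (LINT y|lborel. dheat_kernel a \<tau> (- x - (0 - y)) * g0 r (0 - y))"
      unfolding kconv_def by (rule integral_lborel_reflect[symmetric]) simp
    also have "\<dots> = (LINT y|lborel. - (dheat_kernel a \<tau> (x - y) * g0 r y))"
      using dheat_kernel_minus[of a \<tau> "x - _"] by (intro Bochner_Integration.integral_cong refl) (simp add: g0e algebra_simps dheat_kernel_def heat_kernel_commute)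
    finally show ?thesis by (simp add: kconv_def)
  qed
  then show ?thesis by (simp add: duh_def set_lebesgue_integral_def)
qed

text \<open>The mean vanishes because \<open>h1 s\<close> is an even factor times an odd one. In the
  first moment, norm y is absorbed by the \<kappa>-th power of the profile, leaving s^(-1/4), and
  the Duhamel factor contributes another s^(-1/4).\<close>

lemma h1_props:
  obtains C where "C \<ge> 0"
    "\<And>s. s > 0 \<Longrightarrow> L1b (h1 s)"
    "\<And>s. s > 0 \<Longrightarrow> (LINT x|lborel. h1 s x) = 0"
    "\<And>s. s > 0 \<Longrightarrow> integrable lborel (\<lambda>y. norm y * h1 s y)"
    "\<And>s. s > 0 \<Longrightarrow> (LINT y|lborel. norm y * \<bar>h1 s y\<bar>) \<le> C * s powr (-(1/2))"
proof -
  obtain C1 where C1: "C1 \<ge> 0" "\<And>t. t > 0 \<Longrightarrow> nb t (C1 * t powr (-(1/4))) (duh a g0 t)"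
    by (rule first_order) blast
  define D where "D = (\<kappa> + 1) * \<bar>m0\<bar> powr \<kappa> / sqrt \<kappa>"
  have D: "D \<ge> 0" using k0 by (simp add: D_def)
  have meas: "h1 s \<in> borel_measurable borel" if s: "s > 0" for s
  proof -
    have [measurable]: "duh a g0 s \<in> borel_measurable borel" using nbD(1)[OF C1(2)[OF s]] .
    show ?thesis unfolding h1_def[abs_def] by measurable
  qed
  have 1: "L1b (h1 s)" if s: "s > 0" for s
    unfolding h1_def[abs_def]
  proof (rule L1b_mult_bounded[OF nbD(6)[OF C1(2)[OF s]]])
    show "\<bar>(\<kappa> + 1) * \<bar>a0 s x\<bar> powr \<kappa>\<bar> \<le> (\<kappa> + 1) * (\<bar>m0\<bar> * s powr (- real DIM('a) / 2)) powr \<kappa>" for x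
      using k0 nbD(4)[OF a0_nb[OF s]] by (auto simp: abs_mult intro!: mult_left_mono powr_mono2)
  qed measurable
  have le: "\<bar>norm y * h1 s y\<bar> \<le> D * s powr (-(1/4)) * \<bar>duh a g0 s y\<bar>" if s: "s > 0" for s y
  proof -
    have "\<bar>norm y * h1 s y\<bar> = (\<kappa> + 1) * \<bar>m0\<bar> powr \<kappa> * (norm y * heat_kernel s y powr \<kappa>) * \<bar>duh a g0 s y\<bar>"
      using k0 by (simp add: h1_def a0_def abs_mult powr_mult mult_ac)
    also have "\<dots> \<le> (\<kappa> + 1) * \<bar>m0\<bar> powr \<kappa> * (s powr (-(1/4)) / sqrt \<kappa>) * \<bar>duh a g0 s y\<bar>"
      using k0 by (intro mult_right_mono mult_left_mono norm_heat_kernel_powr[OF s k0 kappa_n]) auto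
    finally show ?thesis by (simp add: D_def mult_ac)
  qed
  have dl: "integrable lborel (\<lambda>y. D * s powr (-(1/4)) * \<bar>duh a g0 s y\<bar>)" if s: "s > 0" for s
    using nbD(2)[OF C1(2)[OF s]] by auto
  have 3: "integrable lborel (\<lambda>y. norm y * h1 s y)" if s: "s > 0" for s
    using meas[OF s] le[OF s] by (intro l1_bounded_le(1)[OF dl[OF s]]) auto
  have 4: "(LINT y|lborel. norm y * \<bar>h1 s y\<bar>) \<le> (D * C1) * s powr (-(1/2))" if s: "s > 0" for s
  proof -
    have "(LINT y|lborel. norm y * \<bar>h1 s y\<bar>) = l1 (\<lambda>y. norm y * h1 s y)" by (simp add: l1_def abs_mult)
    also have "\<dots> \<le> (LINT y|lborel. D * s powr (-(1/4)) * \<bar>duh a g0 s y\<bar>)"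
      using meas[OF s] le[OF s] by (intro l1_bounded_le(2)[OF dl[OF s]]) auto
    also have "\<dots> = D * s powr (-(1/4)) * l1 (duh a g0 s)" by (simp add: l1_def)
    also have "\<dots> \<le> D * s powr (-(1/4)) * (C1 * s powr (-(1/4)))"
      using nbD(3)[OF C1(2)[OF s]] D by (intro mult_left_mono) auto
    also have "\<dots> = D * C1 * (s powr (-(1/4)) * s powr (-(1/4)))" by simp
    also have "s powr (-(1/4)) * s powr (-(1/4)) = s powr (-(1/2))" by (simp flip: powr_add)
    finally show ?thesis .
  qed
  have 2: "(LINT x|lborel. h1 s x) = 0" if s: "s > 0" for s
  proof -
    have "(LINT x|lborel. h1 s x) = (LINT x|lborel. h1 s (0 - x))"
      by (rule integral_lborel_reflect[symmetric, OF meas[OF s]])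
    also have "\<dots> = (LINT x|lborel. - h1 s x)" by (simp add: h1_def a0_def duh_g0_odd)
    finally show ?thesis by simp
  qed
  have "D * C1 \<ge> 0" using D C1 by simp
  from that[OF this 1 2 3 4] show thesis by blast
qed

text \<open>Since \<open>A1\<close> is the profile plus its Duhamel term, subtracting
  \<open>h1\<close> from the linearisation leaves the derivative at the profile times v - A1, of
  order s^(-3/4 - 3/8). The Taylor remainder of the nonlinearity has order s^(-1 - \<kappa>/8). Both
  decay strictly faster than 1/s.\<close>

lemma h2_l1:
  obtains C \<delta> where "C \<ge> 0" "\<delta> > 0"
    "\<And>s. s \<ge> 1 \<Longrightarrow> l1 (\<lambda>x. g s x - g0 s x - h1 s x) \<le> C * s powr (-(1 + \<delta>))"
proof -
  obtain C1 where C1: "C1 \<ge> 0" "\<And>t. t > 0 \<Longrightarrow> nb t (C1 * t powr (-(1/4))) (\<lambda>x. v t x - a0 t x)"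
    by (rule first_order) blast
  obtain C2 where C2: "C2 \<ge> 0" "\<And>t. t > 0 \<Longrightarrow> nb t (C2 * t powr (-(3/8))) (\<lambda>x. v t x - A1 t x)"
    by (rule second_order_rough) blast
  obtain C3 where C3: "\<And>s. s > 0 \<Longrightarrow> L1b (h1 s)" by (rule h1_props) blast
  \<comment> \<open>The first entry comes from the rate 3/8 of \<open>second_order_rough\<close>,
    the second from the Taylor remainder.\<close>
  define \<delta> where "\<delta> = min (1/8) (\<kappa>/8)"
  have d: "\<delta> > 0" using k0 by (simp add: \<delta>_def)
  define m where "m = Cv + \<bar>m0\<bar>"
  have m: "m \<ge> 0" using Cv0 by (simp add: m_def)
  define P where "P = (\<kappa> + 1) * \<bar>m0\<bar> powr \<kappa>"
  define Q where "Q = 2 * (\<kappa> + 1) * m powr (\<kappa>/2) * C1 powr (\<kappa>/2)"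
  have PQ: "P \<ge> 0" "Q \<ge> 0" using k0 by (auto simp: P_def Q_def)
  have "l1 (\<lambda>x. g s x - g0 s x - h1 s x) \<le> (P * C2 + Q * C1) * s powr (-(1 + \<delta>))" if s1: "s \<ge> 1" for s
  proof -
    have s: "s > 0" using s1 by simp
    define p where "p = P * s powr (-(3/4))"
    define r where "r = Q * s powr (-(3/4) - \<kappa>/8)"
    have le: "\<bar>g s x - g0 s x - h1 s x\<bar> \<le> p * \<bar>v s x - A1 s x\<bar> + r * \<bar>v s x - a0 s x\<bar>" for x
    proof -
      define R where "R = g s x - g0 s x - (\<kappa> + 1) * \<bar>a0 s x\<bar> powr \<kappa> * (v s x - a0 s x)"
      have eq: "g s x - g0 s x - h1 s x = (\<kappa> + 1) * \<bar>a0 s x\<bar> powr \<kappa> * (v s x - A1 s x) + R"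
        by (simp add: R_def h1_def A1_def algebra_simps)
      have "\<bar>(\<kappa> + 1) * \<bar>a0 s x\<bar> powr \<kappa> * (v s x - A1 s x)\<bar> = ((\<kappa> + 1) * \<bar>a0 s x\<bar> powr \<kappa>) * \<bar>v s x - A1 s x\<bar>"
        using k0 by (simp add: abs_mult)
      also have "\<dots> \<le> ((\<kappa> + 1) * (\<bar>m0\<bar> * s powr (- real DIM('a) / 2)) powr \<kappa>) * \<bar>v s x - A1 s x\<bar>"
        using k0 nbD(4)[OF a0_nb[OF s]] by (intro mult_right_mono mult_left_mono powr_mono2) auto
      also have "\<dots> = p * \<bar>v s x - A1 s x\<bar>" unfolding scale_powr(1)[OF abs_ge_zero] by (simp add: p_def P_def)
      finally have 1: "\<bar>(\<kappa> + 1) * \<bar>a0 s x\<bar> powr \<kappa> * (v s x - A1 s x)\<bar> \<le> p * \<bar>v s x - A1 s x\<bar>" .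
      have d2: "\<bar>v s x - a0 s x\<bar> powr (\<kappa>/2) \<le> C1 powr (\<kappa>/2) * s powr (-(\<kappa>/8)) * s powr (-(3/8))"
      proof -
        have "\<bar>v s x - a0 s x\<bar> powr (\<kappa>/2) \<le> ((C1 * s powr (-(1/4))) * s powr (- real DIM('a) / 2)) powr (\<kappa>/2)"
          using nbD(4)[OF C1(2)[OF s], of x] k0 by (intro powr_mono2) auto
        also have "\<dots> = (C1 * s powr (-(1/4))) powr (\<kappa>/2) * s powr (-(3/8))"
          using C1 by (intro scale_powr) auto
        also have "(C1 * s powr (-(1/4))) powr (\<kappa>/2) = C1 powr (\<kappa>/2) * s powr (-(\<kappa>/8))"
          by (simp add: powr_mult powr_powr)
        finally show ?thesis .
      qed
      have "\<bar>R\<bar> \<le> 2 * (\<kappa> + 1) * (m * s powr (- real DIM('a) / 2)) powr (\<kappa>/2) * \<bar>v s x - a0 s x\<bar> powr (\<kappa>/2) * \<bar>v s x - a0 s x\<bar>"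
        unfolding R_def g_def g0_def m_def by (rule pw_taylor[OF k0 k2 v_a0_bound[OF s]])
      also have "\<dots> \<le> 2 * (\<kappa> + 1) * (m powr (\<kappa>/2) * s powr (-(3/8))) * (C1 powr (\<kappa>/2) * s powr (-(\<kappa>/8)) * s powr (-(3/8))) * \<bar>v s x - a0 s x\<bar>"
        unfolding scale_powr(2)[OF m] using d2 k0 by (intro mult_right_mono mult_left_mono) auto
      also have "\<dots> = Q * (s powr (-(3/8)) * s powr (-(\<kappa>/8)) * s powr (-(3/8))) * \<bar>v s x - a0 s x\<bar>"
        by (simp add: Q_def mult_ac)
      also have "s powr (-(3/8)) * s powr (-(\<kappa>/8)) * s powr (-(3/8)) = s powr (-(3/4) - \<kappa>/8)"
        by (simp flip: powr_add)
      finally have 2: "\<bar>R\<bar> \<le> r * \<bar>v s x - a0 s x\<bar>" by (simp add: r_def)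
      show ?thesis unfolding eq using 1 2 by linarith
    qed
    have i: "integrable lborel (\<lambda>x. p * \<bar>v s x - A1 s x\<bar>)" "integrable lborel (\<lambda>x. r * \<bar>v s x - a0 s x\<bar>)"
      using nbD(2)[OF C1(2)[OF s]] nbD(2)[OF C2(2)[OF s]] by auto
    have "l1 (\<lambda>x. g s x - g0 s x - h1 s x) \<le> (LINT x|lborel. p * \<bar>v s x - A1 s x\<bar> + r * \<bar>v s x - a0 s x\<bar>)"
      by (rule l1_bounded_le(2)[OF Bochner_Integration.integrable_add[OF i] _ le])
        (use L1b_measurable[OF C3[OF s]] in \<open>simp add: g0_def\<close>)
    also have "\<dots> = p * l1 (\<lambda>x. v s x - A1 s x) + r * l1 (\<lambda>x. v s x - a0 s x)"
      using i by (simp add: l1_def)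
    also have "\<dots> \<le> p * (C2 * s powr (-(3/8))) + r * (C1 * s powr (-(1/4)))"
      using nbD(3)[OF C1(2)[OF s]] nbD(3)[OF C2(2)[OF s]] PQ by (intro add_mono mult_left_mono) (auto simp: p_def r_def)
    also have "\<dots> = P * C2 * (s powr (-(3/4)) * s powr (-(3/8))) + Q * C1 * (s powr (-(3/4) - \<kappa>/8) * s powr (-(1/4)))"
      by (simp add: p_def r_def)
    also have "s powr (-(3/4)) * s powr (-(3/8)) = s powr (-(9/8))" by (simp flip: powr_add)
    also have "s powr (-(3/4) - \<kappa>/8) * s powr (-(1/4)) = s powr (-(1 + \<kappa>/8))" by (simp flip: powr_add)
    also have "P * C2 * s powr (-(9/8)) + Q * C1 * s powr (-(1 + \<kappa>/8)) \<le> P * C2 * s powr (-(1 + \<delta>)) + Q * C1 * s powr (-(1 + \<delta>))"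
      using PQ C1 C2 s1 by (intro add_mono mult_left_mono powr_mono) (auto simp: \<delta>_def)
    finally show ?thesis by (simp add: distrib_right)
  qed
  moreover have "P * C2 + Q * C1 \<ge> 0" using PQ C1 C2 by simp
  ultimately show thesis using that d by blast
qed

text \<open>The source has critical size 1/s, so the time interval is treated in three ranges:
  before 1 by the weaker integrable bound, up to t / 2 by splitting off the odd part, and after t /
  2 directly. Each range contributes order t^(-1/2).\<close>

lemma second_order:
  obtains C where "C \<ge> 0" "\<And>t. t > 4 \<Longrightarrow> nb t (C * t powr (-1/2)) (\<lambda>x. v t x - A1 t x)"
proof -
  obtain C1 where C1: "C1 \<ge> 0" "\<And>s. s > 0 \<Longrightarrow> nb s (C1 * s powr (-1)) (\<lambda>x. g s x - g0 s x)"
    "\<And>s. s > 0 \<Longrightarrow> nb s (C1 * s powr (-(3/4))) (\<lambda>x. g s x - g0 s x)"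
    by (rule g_diff_nb) blast
  obtain C2 where C2: "C2 \<ge> 0"
    "\<And>s. s > 0 \<Longrightarrow> L1b (h1 s)"
    "\<And>s. s > 0 \<Longrightarrow> (LINT x|lborel. h1 s x) = 0"
    "\<And>s. s > 0 \<Longrightarrow> integrable lborel (\<lambda>y. norm y * h1 s y)"
    "\<And>s. s > 0 \<Longrightarrow> (LINT y|lborel. norm y * \<bar>h1 s y\<bar>) \<le> C2 * s powr (-(1/2))"
    by (rule h1_props) blast
  obtain C3 \<delta> where C3: "C3 \<ge> 0" "\<delta> > 0"
    "\<And>s. s \<ge> 1 \<Longrightarrow> l1 (\<lambda>x. g s x - g0 s x - h1 s x) \<le> C3 * s powr (-(1 + \<delta>))"
    by (rule h2_l1) blast
  define K where "K = 2 * duh_const a * (C1 + C2 + C3)"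
  have K: "K \<ge> 0" "2 * duh_const a * C1 \<le> K" "2 * duh_const a * C2 \<le> K" "2 * duh_const a * C3 \<le> K"
    unfolding K_def using C1 C2 C3 by (auto intro!: mult_left_mono)
  define \<omega> where "\<omega> = (\<lambda>s::real. if s \<le> 1 then s powr (-(3/4)) else s powr (-(1 + \<delta>)))"
  have \<omega>i: "set_integrable lborel {0<..} \<omega>" unfolding \<omega>_def by (rule tail_weight_integrable[OF C3(2)])
  have \<omega>0: "\<omega> s \<ge> 0" for s by (simp add: \<omega>_def)
  define \<Omega> where "\<Omega> = (LINT s:{0<..}|lborel. \<omega> s)"
  have \<Omega>0: "\<Omega> \<ge> 0" unfolding \<Omega>_def set_lebesgue_integral_def by (intro integral_nonneg_AE AE_I2) (simp add: \<omega>0)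
  define k where "k = kernel_const TYPE('a) * m1"
  have k: "k \<ge> 0" using m1_nonneg by (simp add: k_def)
  have "nb t ((k + K * \<Omega> + 4 * K) * t powr (-1/2)) (\<lambda>x. v t x - A1 t x)" if t4: "t > 4" for t
  proof -
    have t: "t > 0" using t4 by simp
    \<comment> \<open>The weight \<omega> covers the range before time 1 and the remainder without
      the odd part, s^(-1/2) / t the odd part through its moment, and (t - s)^(-1/2) / t the late
      range.\<close>
    define b where "b = (\<lambda>s. K * t powr (-1/2) * \<omega> s + (K / t * s powr (-(1/2)) + K / t * (t - s) powr (-(1/2))))"
    have \<omega>t: "set_integrable lborel {0<..<t} \<omega>" using \<omega>i by (rule set_integrable_subset) auto
    have pi: "set_integrable lborel {0<..<t} (\<lambda>s. K / t * s powr (-(1/2)) + K / t * (t - s) powr (-(1/2)))"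
      by (rule powr_sum_integrable[OF t]) simp
    have bi: "set_integrable lborel {0<..<t} b"
      unfolding b_def by (intro set_integral_add(1) pi set_integrable_mult_right \<omega>t)
    have "(LINT s:{0<..<t}|lborel. \<omega> s) \<le> \<Omega>"
      unfolding \<Omega>_def set_lebesgue_integral_def
      using \<omega>t \<omega>i \<omega>0 by (intro integral_mono) (auto simp: set_integrable_def indicator_def)
    then have "K * t powr (-1/2) * (LINT s:{0<..<t}|lborel. \<omega> s) \<le> K * t powr (-1/2) * \<Omega>"
      using K by (intro mult_left_mono) auto
    moreover have "(LINT s:{0<..<t}|lborel. b s) = K * t powr (-1/2) * (LINT s:{0<..<t}|lborel. \<omega> s) +
        (K / t * (t powr (1 - 1/2) / (1 - 1/2)) + K / t * (2 * t powr (1/2)))"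
      unfolding b_def using powr_sum_integral[OF t, of "1/2" "K / t" "K / t"]
      by (subst set_integral_add(2)[OF set_integrable_mult_right[OF \<omega>t] pi]) simp
    moreover have "K / t * (t powr (1 - 1/2) / (1 - 1/2)) + K / t * (2 * t powr (1/2)) = 4 * K * t powr (-1/2)"
    proof -
      have "t powr (1/2) / t = t powr (1/2 - 1)" using t by (subst powr_diff) simp
      also have "\<dots> = t powr (-1/2)" by simp
      finally have "t powr (1/2) / t = t powr (-1/2)" .
      then have "4 * K * t powr (-1/2) = 4 * K * (t powr (1/2) / t)" by simp
      then show ?thesis by simp
    qed
    ultimately have I: "(LINT s:{0<..<t}|lborel. b s) \<le> (K * \<Omega> + 4 * K) * t powr (-1/2)"
      by (simp add: algebra_simps)
    have "nb t (b s) (kconv (dheat_kernel a (t - s)) (\<lambda>y. g s y - g0 s y))" if s: "0 < s" "s < t" for s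
    proof -
      note n = C1(2)[OF s(1)] C1(3)[OF s(1)]
      have nn: "K / t * s powr (-(1/2)) \<ge> 0" "K / t * (t - s) powr (-(1/2)) \<ge> 0" "K * t powr (-1/2) * \<omega> s \<ge> 0"
        using K t \<omega>0 by auto
      consider "s \<le> 1" | "1 < s" "s \<le> t / 2" | "s > t / 2" by linarith
      then show ?thesis
      proof cases
        \<comment> \<open>The source is estimated by s^(-3/4), integrable at 0; the kernel time is
          at least t / 2 because \<open>t > 4\<close>.\<close>
        case 1
        have "duh_const a * (2 * t powr (-1/2)) * (C1 * s powr (-(3/4))) = (2 * duh_const a * C1) * (t powr (-1/2) * \<omega> s)"
          using 1 by (simp add: \<omega>_def)
        also have "\<dots> \<le> K * (t powr (-1/2) * \<omega> s)" using K \<omega>0 by (intro mult_right_mono) auto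
        also have "\<dots> \<le> b s" using nn by (simp add: b_def mult.assoc)
        finally have le: "duh_const a * (2 * t powr (-1/2)) * (C1 * s powr (-(3/4))) \<le> b s" .
        have "nb t (duh_const a * (2 * t powr (-1/2)) * (C1 * s powr (-(3/4)))) (kconv (dheat_kernel a (t - s)) (\<lambda>y. g s y - g0 s y))"
          using 1 t4 nbD(2,3)[OF n(2)] by (intro nb_dheat_early') auto
        then show ?thesis using le by (rule nb_mono)
      next
        case 2
        define \<tau> where "\<tau> = t - s"
        have \<tau>: "\<tau> > 0" "t / 2 \<le> \<tau>" using 2 s by (auto simp: \<tau>_def)
        have d: "integrable lborel (\<lambda>y. g s y - g0 s y - h1 s y)"
          using nbD(2)[OF n(1)] L1b_integrable[OF C2(2)[OF s(1)]] by auto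
        have "duh_const a * (2 * t powr (-1/2)) * (C3 * s powr (-(1 + \<delta>))) = (2 * duh_const a * C3) * (t powr (-1/2) * \<omega> s)"
          using 2 by (simp add: \<omega>_def)
        also have "\<dots> \<le> K * (t powr (-1/2) * \<omega> s)" using K \<omega>0 by (intro mult_right_mono) auto
        finally have le: "duh_const a * (2 * t powr (-1/2)) * (C3 * s powr (-(1 + \<delta>))) \<le> K * (t powr (-1/2) * \<omega> s)" .
        have "nb t (duh_const a * (2 * t powr (-1/2)) * (C3 * s powr (-(1 + \<delta>)))) (kconv (dheat_kernel a (t - s)) (\<lambda>y. g s y - g0 s y - h1 s y))"
          using 2 t4 C3(3)[of s] d by (intro nb_dheat_early') auto
        then have i: "nb t (K * (t powr (-1/2) * \<omega> s)) (kconv (dheat_kernel a (t - s)) (\<lambda>y. g s y - g0 s y - h1 s y))"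
          using le by (rule nb_mono)
        \<comment> \<open>The zero mean of \<open>h1 s\<close> improves the kernel factor from order
          \<tau>^(-1/2) to 1/\<tau>, paid for by a first moment that decays like s^(-1/2).\<close>
        have "nb \<tau> (kernel_const TYPE('a) * norm a / \<tau> * (LINT y|lborel. norm y * \<bar>h1 s y\<bar>)) (\<lambda>x. kconv (dheat_kernel a \<tau>) (h1 s) x - (LINT y|lborel. h1 s y) * dheat_kernel a \<tau> x)"
          using \<tau> l1_dheat_kernel_shift[OF \<tau>(1), of a] s
          by (intro nb_moment L1b_dheat_kernel C2) auto
        then have "nb \<tau> (kernel_const TYPE('a) * norm a / \<tau> * (LINT y|lborel. norm y * \<bar>h1 s y\<bar>)) (kconv (dheat_kernel a \<tau>) (h1 s))"
          using C2(3)[OF s(1)] by simp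
        from nb_rescale[OF this \<tau>(2) t] have m: "nb t (duh_const a * ((1 / \<tau>) * (LINT y|lborel. norm y * \<bar>h1 s y\<bar>))) (kconv (dheat_kernel a \<tau>) (h1 s))"
          by (simp add: duh_const_def mult_ac)
        have "1 / \<tau> \<le> 2 / t" using \<tau> t by (simp add: field_simps)
        then have "duh_const a * ((1 / \<tau>) * (LINT y|lborel. norm y * \<bar>h1 s y\<bar>)) \<le> duh_const a * ((2 / t) * (C2 * s powr (-(1/2))))"
          using C2(5)[OF s(1)] t by (intro mult_left_mono mult_mono) auto
        also have "\<dots> = (2 * duh_const a * C2) * (s powr (-(1/2)) / t)" by simp
        also have "\<dots> \<le> K * (s powr (-(1/2)) / t)" using K t by (intro mult_right_mono) auto
        finally have ii: "nb t (K * (s powr (-(1/2)) / t)) (kconv (dheat_kernel a \<tau>) (h1 s))"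
          by (rule nb_mono[OF m])
        have eq: "kconv (dheat_kernel a (t - s)) (\<lambda>y. g s y - g0 s y) x = kconv (dheat_kernel a (t - s)) (\<lambda>y. g s y - g0 s y - h1 s y) x + kconv (dheat_kernel a \<tau>) (h1 s) x" for x
          using kconv_diff_right(2)[OF d L1b_integrable[OF C2(2)[OF s(1)]] L1b_dheat_kernel[OF \<tau>(1)], of a x]
          by (simp add: \<tau>_def)
        have "nb t (K * (t powr (-1/2) * \<omega> s) + K * (s powr (-(1/2)) / t)) (kconv (dheat_kernel a (t - s)) (\<lambda>y. g s y - g0 s y))"
          using nb_add[OF i ii] unfolding eq[symmetric] by simp
        then show ?thesis by (rule nb_mono) (use nn in \<open>simp add: b_def mult.assoc\<close>)
      next
        case 3
        \<comment> \<open>In the late half the critical size is simply of order 1/t, and only the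
          integrable singularity of the kernel remains.\<close>
        have "s powr (-1) \<le> 2 / t" using 3 t by (simp add: powr_minus field_simps)
        then have "duh_const a * (t - s) powr (-1/2) * (C1 * s powr (-1)) \<le> duh_const a * (t - s) powr (-1/2) * (C1 * (2 / t))"
          using C1 by (intro mult_left_mono) auto
        also have "\<dots> = (2 * duh_const a * C1) * ((t - s) powr (-(1/2)) / t)" by simp
        also have "\<dots> \<le> K * ((t - s) powr (-(1/2)) / t)" using K t by (intro mult_right_mono) auto
        also have "\<dots> \<le> b s" using nn by (simp add: b_def)
        finally have le: "duh_const a * (t - s) powr (-1/2) * (C1 * s powr (-1)) \<le> b s" .
        have "nb t (duh_const a * (t - s) powr (-1/2) * (C1 * s powr (-1))) (kconv (dheat_kernel a (t - s)) (\<lambda>y. g s y - g0 s y))"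
          unfolding duh_const_def by (rule nb_dheat_late[where s=s]) (use 3 t s n(1) in auto)
        then show ?thesis using le by (rule nb_mono)
      qed
    qed
    from nb_mono[OF nb_duh[OF gd_joint this bi] I]
    have 1: "nb t ((K * \<Omega> + 4 * K) * t powr (-1/2)) (duh a (\<lambda>s y. g s y - g0 s y) t)" by simp
    have 2: "nb t (k * t powr (-1/2)) (\<lambda>x. kconv (heat_kernel t) w0 x - a0 t x)"
      using heat_w0_nb[OF t] by (simp add: k_def)
    from nb_add[OF 2 1] show ?thesis by (simp add: v_minus_A1[OF t] distrib_right add.assoc)
  qed
  moreover have "k + K * \<Omega> + 4 * K \<ge> 0" using k K \<Omega>0 by simp
  ultimately show thesis using that by blast
qed

end

end

section \<open>Lebesgue norms\<close>

lemma Lnorm_1_eq: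
  fixes \<phi> \<psi> :: "'a::euclidean_space \<Rightarrow> real"
  assumes ae: "AE x in lebesgue. \<phi> x = \<psi> x"
  shows "Lnorm 1 \<phi> = enn2ereal (\<integral>\<^sup>+x. ennreal \<bar>\<psi> x\<bar> \<partial>lborel)"
proof -
  have "(\<integral>\<^sup>+x. ennreal (\<bar>\<phi> x\<bar> powr real_of_ereal 1) \<partial>lebesgue) = (\<integral>\<^sup>+x. ennreal \<bar>\<psi> x\<bar> \<partial>lebesgue)"
    using ae by (intro nn_integral_cong_AE) (auto elim!: eventually_mono)
  also have "\<dots> = (\<integral>\<^sup>+x. ennreal \<bar>\<psi> x\<bar> \<partial>lborel)" by (rule nn_integral_completion)
  finally have I: "(\<integral>\<^sup>+x. ennreal (\<bar>\<phi> x\<bar> powr real_of_ereal 1) \<partial>lebesgue) = (\<integral>\<^sup>+x. ennreal \<bar>\<psi> x\<bar> \<partial>lborel)" .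
  show ?thesis
  proof (cases "(\<integral>\<^sup>+x. ennreal \<bar>\<psi> x\<bar> \<partial>lborel)")
    case (real r)
    then show ?thesis unfolding Lnorm_def Let_def I by (auto simp: enn2ereal_ennreal)
  next
    case top
    then show ?thesis unfolding Lnorm_def Let_def I by (simp add: enn2ereal_top infinity_ennreal_def)
  qed
qed

lemma Lnorm_1_integrable:
  fixes \<phi> \<psi> :: "'a::euclidean_space \<Rightarrow> real"
  assumes ae: "AE x in lebesgue. \<phi> x = \<psi> x" and [measurable]: "\<psi> \<in> borel_measurable borel"
    and fin: "Lnorm 1 \<phi> < \<infinity>"
  shows "integrable lborel \<psi>" "Lnorm 1 \<phi> = ereal (l1 \<psi>)"
proof -
  have "(\<integral>\<^sup>+x. ennreal \<bar>\<psi> x\<bar> \<partial>lborel) < \<infinity>"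
    using fin unfolding Lnorm_1_eq[OF ae] by (metis enn2ereal_top infinity_ennreal_def less_irrefl top.not_eq_extremum)
  then show i: "integrable lborel \<psi>" by (intro integrableI_bounded) auto
  show "Lnorm 1 \<phi> = ereal (l1 \<psi>)" unfolding Lnorm_1_eq[OF ae] l1_eq_nn[OF i] by (simp add: enn2ereal_ennreal)
qed

lemma Lnorm_inf_AE:
  assumes "Lnorm \<infinity> \<phi> \<le> ereal M"
  shows "AE x in lebesgue. \<bar>\<phi> x\<bar> \<le> M"
proof -
  have "AE x in lebesgue. ereal \<bar>\<phi> x\<bar> \<le> esssup lebesgue (\<lambda>x. ereal \<bar>\<phi> x\<bar>)" by (rule esssup_AE)
  then show ?thesis using assms
    by (auto elim!: eventually_mono simp: Lnorm_def) (metis ereal_less_eq(3) order_trans)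
qed

text \<open>Truncating a Borel version at height \<open>M\<close> makes the almost everywhere bound
  hold at every point without changing the class.\<close>

lemma borel_representative:
  fixes \<phi> :: "'a::euclidean_space \<Rightarrow> real"
  assumes "\<phi> \<in> borel_measurable lebesgue" "AE x in lebesgue. \<bar>\<phi> x\<bar> \<le> M" "M \<ge> 0"
  obtains \<psi> where "\<psi> \<in> borel_measurable borel" "\<And>x. \<bar>\<psi> x\<bar> \<le> M" "AE x in lebesgue. \<phi> x = \<psi> x"
proof -
  from completion_ex_borel_measurable_real[OF assms(1)] obtain g' where
    g': "g' \<in> borel_measurable borel" "AE x in lborel. \<phi> x = g' x" by auto
  have [measurable]: "g' \<in> borel_measurable borel" by fact
  show thesis
  proof (rule that[of "\<lambda>x. max (- M) (min M (g' x))"])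
    show "\<bar>max (- M) (min M (g' x))\<bar> \<le> M" for x using assms(3) by auto
    show "AE x in lebesgue. \<phi> x = max (- M) (min M (g' x))"
      using AE_completion[OF g'(2)] assms(2) by eventually_elim auto
  qed measurable
qed

text \<open>Interpolation between L^1 and the sup norm: the r-th power is the sup bound to the power
  r - 1 times the absolute value, and the powers of \<open>t\<close> combine to n/2 (1 -
  1/r).\<close>

lemma Lnorm_le_nb:
  fixes \<phi> \<psi> :: "'a::euclidean_space \<Rightarrow> real"
  assumes nb: "nb t A \<psi>" and ae: "AE x in lebesgue. \<phi> x = \<psi> x" and m: "\<phi> \<in> borel_measurable lebesgue"
    and t: "t > 0" and q: "1 \<le> q"
  shows "ereal (t powr (real DIM('a) / 2 * (1 - (if q = \<infinity> then 0 else 1 / real_of_ereal q)))) * Lnorm q \<phi> \<le> ereal A"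
proof -
  define n where "n = real DIM('a)"
  define S where "S = A * t powr (- n/2)"
  have A: "A \<ge> 0" using nbD(5)[OF nb] .
  have S0: "S \<ge> 0" using A by (simp add: S_def)
  have S: "\<bar>\<psi> x\<bar> \<le> S" for x using nbD(4)[OF nb] by (simp add: S_def n_def)
  show ?thesis
  proof (cases "q = \<infinity>")
    case True
    have "AE x in lebesgue. ereal \<bar>\<phi> x\<bar> \<le> ereal S" using ae S by (auto elim!: eventually_mono)
    then have "Lnorm q \<phi> \<le> ereal S" unfolding Lnorm_def using True m by (auto intro!: esssup_I)
    then have "ereal (t powr (n/2)) * Lnorm q \<phi> \<le> ereal (t powr (n/2)) * ereal S"
      by (intro ereal_mult_left_mono) auto
    also have "\<dots> = ereal A"
    proof -
      have "t powr (n/2) * t powr (- n/2) = 1" using t by (simp flip: powr_add)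
      then show ?thesis by (simp add: S_def mult.left_commute)
    qed
    finally show ?thesis using True by (simp add: n_def)
  next
    case False
    then obtain r where r: "q = ereal r" "r \<ge> 1" using q by (cases q) (auto simp: one_ereal_def)
    have r0: "r > 0" using r by simp
    define I where "I = (\<integral>\<^sup>+x. ennreal (\<bar>\<phi> x\<bar> powr r) \<partial>lebesgue)"
    have "I = (\<integral>\<^sup>+x. ennreal (\<bar>\<psi> x\<bar> powr r) \<partial>lborel)"
    proof -
      have "I = (\<integral>\<^sup>+x. ennreal (\<bar>\<psi> x\<bar> powr r) \<partial>lebesgue)"
        unfolding I_def using ae by (intro nn_integral_cong_AE) (auto elim!: eventually_mono)
      then show ?thesis by (simp only: nn_integral_completion)
    qed
    also have "\<dots> \<le> (\<integral>\<^sup>+x. ennreal (S powr (r - 1)) * ennreal \<bar>\<psi> x\<bar> \<partial>lborel)"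
    proof (intro nn_integral_mono)
      fix x
      have "\<bar>\<psi> x\<bar> powr ((r - 1) + 1) = \<bar>\<psi> x\<bar> powr (r - 1) * \<bar>\<psi> x\<bar>" by (subst powr_add) simp
      also have "\<dots> \<le> S powr (r - 1) * \<bar>\<psi> x\<bar>" using S r by (intro mult_right_mono powr_mono2) auto
      finally show "ennreal (\<bar>\<psi> x\<bar> powr r) \<le> ennreal (S powr (r - 1)) * ennreal \<bar>\<psi> x\<bar>"
        by (simp add: ennreal_mult'[symmetric] ennreal_leI)
    qed
    also have "\<dots> = ennreal (S powr (r - 1)) * ennreal (l1 \<psi>)"
      using nbD(1,2)[OF nb] by (subst nn_integral_cmult) (auto simp: l1_eq_nn)
    also have "\<dots> \<le> ennreal (S powr (r - 1) * A)"
      using nbD(3)[OF nb] by (simp add: ennreal_mult'[symmetric] ennreal_leI mult_left_mono)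
    also have "S powr (r - 1) * A = (A * t powr (- (n/2 * (1 - 1/r)))) powr r"
    proof -
      have "S powr (r - 1) * A = A powr (r - 1) * A * (t powr (- n/2)) powr (r - 1)"
        by (simp add: S_def powr_mult)
      also have "A powr (r - 1) * A = A powr r"
        using powr_add[of A "r - 1" 1] A by simp
      also have "(t powr (- n/2)) powr (r - 1) = t powr (- (n/2 * (r - 1)))" by (simp add: powr_powr)
      also have "n/2 * (r - 1) = (n/2 * (1 - 1/r)) * r" using r0 by (simp add: field_simps)
      also have "t powr (- (n/2 * (1 - 1/r) * r)) = (t powr (- (n/2 * (1 - 1/r)))) powr r" by (simp add: powr_powr)
      finally show ?thesis by (simp add: powr_mult)
    qed
    finally have I: "I \<le> ennreal ((A * t powr (- (n/2 * (1 - 1/r)))) powr r)" .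
    then have fin: "I \<noteq> \<infinity>" using ennreal_less_top le_less_trans by (metis infinity_ennreal_def less_irrefl)
    have "enn2real I \<le> (A * t powr (- (n/2 * (1 - 1/r)))) powr r"
      using enn2real_mono[OF I] by simp
    then have "enn2real I powr (1/r) \<le> ((A * t powr (- (n/2 * (1 - 1/r)))) powr r) powr (1/r)"
      using r0 by (intro powr_mono2) auto
    also have "\<dots> = A * t powr (- (n/2 * (1 - 1/r)))" using r0 A by (simp add: powr_powr)
    finally have L: "enn2real I powr (1/r) \<le> A * t powr (- (n/2 * (1 - 1/r)))" .
    have "Lnorm q \<phi> = ereal (enn2real I powr (1/r))"
      using False fin by (simp add: Lnorm_def Let_def r(1) I_def)
    then have "ereal (t powr (n/2 * (1 - 1/r))) * Lnorm q \<phi> = ereal (t powr (n/2 * (1 - 1/r)) * enn2real I powr (1/r))"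
      by simp
    also have "\<dots> \<le> ereal (t powr (n/2 * (1 - 1/r)) * (A * t powr (- (n/2 * (1 - 1/r)))))"
      using L by (simp add: mult_left_mono)
    also have "t powr (n/2 * (1 - 1/r)) * (A * t powr (- (n/2 * (1 - 1/r)))) = A"
    proof -
      have "t powr (n/2 * (1 - 1/r)) * t powr (- (n/2 * (1 - 1/r))) = 1" using t by (subst powr_add[symmetric]) simp
      then show ?thesis by (simp only: mult.left_commute mult_1_right)
    qed
    finally show ?thesis using False r(1) by (simp add: n_def)
  qed
qed

section \<open>Regular representatives of mild solutions\<close>

text \<open>The passage from \<open>heat\<close> and \<open>dir_grad\<close>, defined for Lebesgue
  measurable functions, to convolutions of Borel representatives: integrals ignore null sets, and
  the derivative is taken under the integral.\<close>

lemma
  fixes \<phi> \<psi> :: "'a::euclidean_space \<Rightarrow> real"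
  assumes ae: "AE x in lebesgue. \<phi> x = \<psi> x" and m: "\<phi> \<in> borel_measurable lebesgue" and \<psi>: "integrable lborel \<psi>"
    and t: "t > 0"
  shows heat_eq_kconv: "heat t \<phi> x = kconv (heat_kernel t) \<psi> x"
    and dir_grad_heat_eq: "dir_grad a (heat t \<phi>) x = kconv (dheat_kernel a t) \<psi> x"
proof -
  have [measurable]: "\<psi> \<in> borel_measurable borel" using \<psi> by auto
  have *: "heat t \<phi> x = kconv (heat_kernel t) \<psi> x" for x
  proof -
    have k: "(\<lambda>y. heat_kernel t (x - y)) \<in> borel_measurable lebesgue"
      by (rule measurable_completion) measurable
    have \<psi>l: "\<psi> \<in> borel_measurable lebesgue" by (rule measurable_completion) measurable
    have "(\<integral>y. heat_kernel t (x - y) * \<phi> y \<partial>lebesgue) = (\<integral>y. heat_kernel t (x - y) * \<psi> y \<partial>lebesgue)"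
      using ae k m \<psi>l by (intro integral_cong_AE borel_measurable_times) (auto elim!: eventually_mono)
    also have "\<dots> = kconv (heat_kernel t) \<psi> x"
      unfolding kconv_def by (rule integral_completion) measurable
    finally show ?thesis using t by (simp add: heat_def)
  qed
  show "heat t \<phi> x = kconv (heat_kernel t) \<psi> x" by (rule *)
  show "dir_grad a (heat t \<phi>) x = kconv (dheat_kernel a t) \<psi> x"
    unfolding dir_grad_def * using kconv_heat_has_dir_derivative[OF t \<psi>, of x a 0]
    by (intro DERIV_imp_deriv) simp
qed

text \<open>At the endpoints \<open>F\<close> is arbitrary: for \<open>s = t\<close> it involves the
  derivative of a function that has not been smoothed. Measurability of the integrand is therefore
  obtained by viewing it as a measurable function altered at two points.\<close>

lemma closed_interval_integral_eq:
  fixes F G :: "real \<Rightarrow> real"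
  assumes t: "t > 0" and eq: "\<And>s. 0 < s \<Longrightarrow> s < t \<Longrightarrow> F s = G s"
    and [measurable]: "(\<lambda>s. indicator {0<..<t} s *\<^sub>R G s) \<in> borel_measurable borel"
  shows "(LINT s:{0..t}|lborel. F s) = (LINT s:{0<..<t}|lborel. G s)"
  unfolding set_lebesgue_integral_def
proof (rule integral_cong_AE)
  have "(\<lambda>s. indicat_real {0..t} s *\<^sub>R F s) = (\<lambda>s. if s = 0 then F 0 else if s = t then F t else indicator {0<..<t} s *\<^sub>R G s)"
    using t eq by (auto simp: fun_eq_iff indicator_def)
  then show "(\<lambda>s. indicat_real {0..t} s *\<^sub>R F s) \<in> borel_measurable lborel" by simp
  show "AE s in lborel. indicat_real {0..t} s *\<^sub>R F s = indicat_real {0<..<t} s *\<^sub>R G s"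
    using AE_lborel_singleton[of 0] AE_lborel_singleton[of t]
    by eventually_elim (use eq in \<open>auto simp: indicator_def\<close>)
qed (use assms(3) in simp)

text \<open>Continuity of the source in time with values in L^1 is enough, since the kernel is
  bounded while its time stays away from 0: the change of source is estimated in L^1, the change of
  kernel by dominated convergence.\<close>

lemma kconv_dheat_jointly_continuous:
  fixes Q :: "real \<Rightarrow> 'a::euclidean_space \<Rightarrow> real"
  assumes Q: "\<And>s. s > 0 \<Longrightarrow> integrable lborel (Q s)"
    and cont: "\<And>s X. s > 0 \<Longrightarrow> (\<And>i. X i > 0) \<Longrightarrow> X \<longlonglongrightarrow> s \<Longrightarrow> (\<lambda>i. l1 (\<lambda>y. Q (X i) y - Q s y)) \<longlonglongrightarrow> 0"
    and \<tau>: "\<tau> > 0" "\<And>i. T i > 0" "T \<longlonglongrightarrow> \<tau>" and s: "s > 0" "\<And>i. S i > 0" "S \<longlonglongrightarrow> s" and x: "X \<longlonglongrightarrow> x"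
  shows "(\<lambda>i. kconv (dheat_kernel a (T i)) (Q (S i)) (X i)) \<longlonglongrightarrow> kconv (dheat_kernel a \<tau>) (Q s) x"
proof -
  define b where "b = (\<lambda>\<tau>. kernel_const TYPE('a) * norm a * \<tau> powr (-1/2) * \<tau> powr (- real DIM('a)/2))"
  have b: "(\<lambda>i. b (T i)) \<longlonglongrightarrow> b \<tau>"
    unfolding b_def using \<tau> by (intro tendsto_intros) auto
  from convergent_imp_Bseq[OF convergentI[OF this]] obtain C where C: "\<And>i. \<bar>b (T i)\<bar> \<le> C"
    unfolding Bseq_def by auto
  have db: "\<bar>dheat_kernel a (T i) z\<bar> \<le> b (T i)" for i z unfolding b_def by (rule dheat_kernel_le[OF \<tau>(2)])
  have dC: "\<bar>dheat_kernel a (T i) z\<bar> \<le> C" for i z using db[of i z] C[of i] by linarith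
  have [measurable]: "Q r \<in> borel_measurable borel" if "r > 0" for r using Q[OF that] by auto
  have "(\<lambda>i. kconv (dheat_kernel a (T i)) (Q s) (X i)) \<longlonglongrightarrow> kconv (dheat_kernel a \<tau>) (Q s) x"
    unfolding kconv_def
  proof (rule integral_dominated_convergence[where w="\<lambda>y. C * \<bar>Q s y\<bar>"])
    show "integrable lborel (\<lambda>y. C * \<bar>Q s y\<bar>)" using Q[OF s(1)] by auto
    have "(\<lambda>i. dheat_kernel a (T i) (X i - y)) \<longlonglongrightarrow> dheat_kernel a \<tau> (x - y)" for y
    proof -
      have c: "continuous_on {p. fst p > 0} (\<lambda>p. dheat_kernel a (fst p) (snd p :: 'a))"
        by (intro continuous_intros) auto
      have "(\<lambda>i. (T i, X i - y)) \<longlonglongrightarrow> (\<tau>, x - y)" using \<tau> x by (intro tendsto_intros)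
      from continuous_on_tendsto_compose[OF c this] \<tau> show ?thesis by simp
    qed
    then show "AE y in lborel. (\<lambda>i. dheat_kernel a (T i) (X i - y) * Q s y) \<longlonglongrightarrow> dheat_kernel a \<tau> (x - y) * Q s y"
      by (auto intro!: tendsto_intros AE_I2)
    show "AE y in lborel. norm (dheat_kernel a (T i) (X i - y) * Q s y) \<le> C * \<bar>Q s y\<bar>" for i
      using dC by (auto simp: abs_mult intro!: mult_right_mono AE_I2)
  qed (use s in auto)
  moreover have "(\<lambda>i. kconv (dheat_kernel a (T i)) (Q (S i)) (X i) - kconv (dheat_kernel a (T i)) (Q s) (X i)) \<longlonglongrightarrow> 0"
  proof (rule Lim_null_comparison)
    show "(\<lambda>i. b (T i) * l1 (\<lambda>y. Q (S i) y - Q s y)) \<longlonglongrightarrow> 0"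
      using tendsto_mult[OF b cont[OF s]] by simp
    have "norm (kconv (dheat_kernel a (T i)) (Q (S i)) (X i) - kconv (dheat_kernel a (T i)) (Q s) (X i)) \<le> b (T i) * l1 (\<lambda>y. Q (S i) y - Q s y)" for i
    proof -
      have "kconv (dheat_kernel a (T i)) (Q (S i)) (X i) - kconv (dheat_kernel a (T i)) (Q s) (X i) = kconv (dheat_kernel a (T i)) (\<lambda>y. Q (S i) y - Q s y) (X i)"
        using s \<tau> by (intro kconv_diff_right(1)[symmetric] Q L1b_dheat_kernel)
      moreover have "\<bar>kconv (dheat_kernel a (T i)) (\<lambda>y. Q (S i) y - Q s y) (X i)\<bar> \<le> b (T i) * l1 (\<lambda>y. Q (S i) y - Q s y)"
        using s Q by (intro kconv_le1 db) auto
      ultimately show ?thesis by simp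
    qed
    then show "\<forall>\<^sub>F i in sequentially. norm (kconv (dheat_kernel a (T i)) (Q (S i)) (X i) - kconv (dheat_kernel a (T i)) (Q s) (X i)) \<le> b (T i) * l1 (\<lambda>y. Q (S i) y - Q s y)"
      by simp
  qed
  ultimately have "(\<lambda>i. (kconv (dheat_kernel a (T i)) (Q (S i)) (X i) - kconv (dheat_kernel a (T i)) (Q s) (X i)) + kconv (dheat_kernel a (T i)) (Q s) (X i)) \<longlonglongrightarrow> 0 + kconv (dheat_kernel a \<tau>) (Q s) x"
    by (rule tendsto_add[rotated])
  then show ?thesis by simp
qed

text \<open>The source is given time by time, without joint measurability. The convolution is
  nevertheless jointly continuous on the open set 0 < s < t, hence Borel there, and integration in
  \<open>s\<close> preserves this.\<close>

lemma duh_measurable: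
  fixes Q :: "real \<Rightarrow> 'a::euclidean_space \<Rightarrow> real"
  assumes Q: "\<And>s. s > 0 \<Longrightarrow> integrable lborel (Q s)"
    and cont: "\<And>s X. s > 0 \<Longrightarrow> (\<And>i. X i > 0) \<Longrightarrow> X \<longlonglongrightarrow> s \<Longrightarrow> (\<lambda>i. l1 (\<lambda>y. Q (X i) y - Q s y)) \<longlonglongrightarrow> 0"
  shows "(\<lambda>p. duh a Q (fst p) (snd p)) \<in> borel_measurable (borel \<Otimes>\<^sub>M borel)"
    and "(\<lambda>s. indicator {0<..<t} s *\<^sub>R kconv (dheat_kernel a (t - s)) (Q s) x) \<in> borel_measurable borel"
proof -
  define S where "S = {q :: (real \<times> 'a) \<times> real. 0 < snd q \<and> snd q < fst (fst q)}"
  define F where "F = (\<lambda>q :: (real \<times> 'a) \<times> real. kconv (dheat_kernel a (fst (fst q) - snd q)) (Q (snd q)) (snd (fst q)))"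
  have "open S" unfolding S_def by (intro open_Collect_conj open_Collect_less continuous_intros)
  then have S: "S \<in> sets borel" by simp
  have "continuous_on S F"
    unfolding continuous_on_sequentially o_def
  proof (intro allI ballI impI)
    fix X q assume q: "q \<in> S" and X: "(\<forall>n. X n \<in> S) \<and> X \<longlonglongrightarrow> q"
    have 1: "(\<lambda>n. fst (fst (X n)) - snd (X n)) \<longlonglongrightarrow> fst (fst q) - snd q" "(\<lambda>n. snd (X n)) \<longlonglongrightarrow> snd q" "(\<lambda>n. snd (fst (X n))) \<longlonglongrightarrow> snd (fst q)"
      using X by (auto intro!: tendsto_intros)
    show "(\<lambda>n. F (X n)) \<longlonglongrightarrow> F q"
      unfolding F_def using q X by (intro kconv_dheat_jointly_continuous[OF Q cont _ _ 1(1) _ _ 1(2,3)]) (auto simp: S_def)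
  qed
  then have m: "(\<lambda>q. indicator S q *\<^sub>R F q) \<in> borel_measurable borel"
    by (rule borel_measurable_continuous_on_indicator[OF S])
  have m': "(\<lambda>q. indicator S q *\<^sub>R F q) \<in> borel_measurable ((borel \<Otimes>\<^sub>M borel) \<Otimes>\<^sub>M borel)"
    using m unfolding borel_prod .
  have e: "indicator S ((t, x), s) *\<^sub>R F ((t, x), s) = indicator {0<..<t} s *\<^sub>R kconv (dheat_kernel a (t - s)) (Q s) x" for t x s
    by (auto simp: S_def F_def indicator_def)
  have "(\<lambda>p. LINT s|lborel. indicator S (p, s) *\<^sub>R F (p, s)) \<in> borel_measurable (borel \<Otimes>\<^sub>M borel)"
    using m' by (intro lborel.borel_measurable_lebesgue_integral) (simp add: case_prod_beta')
  then show "(\<lambda>p. duh a Q (fst p) (snd p)) \<in> borel_measurable (borel \<Otimes>\<^sub>M borel)"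
    unfolding duh_def set_lebesgue_integral_def e[symmetric] by simp
  show "(\<lambda>s. indicator {0<..<t} s *\<^sub>R kconv (dheat_kernel a (t - s)) (Q s) x) \<in> borel_measurable borel"
    unfolding e[symmetric] by (rule measurable_compose[OF _ m]) (simp add: borel_prod[symmetric])
qed

lemma moment_integrable:
  fixes u0 w0 :: "'a::euclidean_space \<Rightarrow> real"
  assumes m: "memL11 u0" and ae: "AE x in lebesgue. u0 x = w0 x" and [measurable]: "w0 \<in> borel_measurable borel"
  shows "integrable lborel (\<lambda>y. norm y * w0 y)"
proof -
  have i: "integrable lborel (\<lambda>y. (y \<bullet> b) * w0 y)" if "b \<in> Basis" for b
  proof (rule Lnorm_1_integrable(1))
    show "Lnorm 1 (\<lambda>x. (x \<bullet> b) * u0 x) < \<infinity>" using m that by (simp add: memL11_def memLq_def)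
    show "AE x in lebesgue. (x \<bullet> b) * u0 x = (x \<bullet> b) * w0 x" using ae by eventually_elim simp
  qed measurable
  have "integrable lborel (\<lambda>y. \<Sum>b\<in>Basis. \<bar>(y \<bullet> b) * w0 y\<bar>)"
    using i by (intro Bochner_Integration.integrable_sum integrable_abs)
  then show ?thesis
  proof (rule l1_bounded_le(1))
    fix y
    have "norm y * \<bar>w0 y\<bar> \<le> (\<Sum>b\<in>Basis. \<bar>y \<bullet> b\<bar>) * \<bar>w0 y\<bar>"
      by (intro mult_right_mono norm_le_l1) auto
    then show "\<bar>norm y * w0 y\<bar> \<le> (\<Sum>b\<in>Basis. \<bar>(y \<bullet> b) * w0 y\<bar>)"
      by (simp add: abs_mult sum_distrib_right)
  qed measurable
qed

text \<open>Borel versions of \<open>u s\<close> are chosen independently for each \<open>s\<close>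
  and need not fit together measurably. The right-hand side of Duhamel's formula, built from them,
  does, and it is therefore taken as the representative.\<close>

lemma mild_representative:
  fixes a :: "'a::euclidean_space" and u0 :: "'a \<Rightarrow> real" and u :: "real \<Rightarrow> 'a \<Rightarrow> real"
  assumes \<kappa>: "\<kappa> = 3 / (2 * real DIM('a))" and m11: "memL11 u0" and minf: "memLq \<infinity> u0"
    and sol: "global_solution a (pw \<kappa>) u0 u"
  obtains M v w0 where "mild_solution a \<kappa> M v w0"
    "\<And>t. t > 0 \<Longrightarrow> AE x in lebesgue. u t x = v t x" "AE x in lebesgue. u0 x = w0 x"
proof -
  have k0: "\<kappa> > 0" by (simp add: \<kappa>)
  from sol obtain M1 M2 where
    u1: "\<And>t. t \<ge> 0 \<Longrightarrow> memLq 1 (u t)" and M1: "\<And>t. t \<ge> 0 \<Longrightarrow> Lnorm 1 (u t) \<le> ereal M1"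
    and uc: "\<And>t. t \<ge> 0 \<Longrightarrow> ((\<lambda>s. Lnorm 1 (\<lambda>x. u s x - u t x)) \<longlongrightarrow> 0) (at t within {0..})"
    and M2: "\<And>t. t > 0 \<Longrightarrow> Lnorm \<infinity> (u t) \<le> ereal M2"
    and duh: "\<And>t. t > 0 \<Longrightarrow> AE x in lebesgue.
        u t x = heat t u0 x + (LINT s:{0..t}|lborel. dir_grad a (heat (t - s) (\<lambda>y. pw \<kappa> (u s y))) x)"
    unfolding global_solution_def by blast
  obtain M0 where M0: "Lnorm \<infinity> u0 \<le> ereal M0"
    using minf by (cases "Lnorm \<infinity> u0") (auto simp: memLq_def)
  define M where "M = max (max M1 M2) (max M0 1)"
  have M: "M \<ge> M1" "M \<ge> M2" "M \<ge> M0" "M \<ge> 1" "M > 0" "M \<ge> 0" by (auto simp: M_def)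
  have u0m: "u0 \<in> borel_measurable lebesgue" using minf by (simp add: memLq_def)
  have "AE x in lebesgue. \<bar>u0 x\<bar> \<le> M" using Lnorm_inf_AE[OF M0] M by (auto elim!: eventually_mono)
  from borel_representative[OF u0m this M(6)] obtain w0 where
    w0m [measurable]: "w0 \<in> borel_measurable borel" and w0b: "\<And>x. \<bar>w0 x\<bar> \<le> M" and w0ae: "AE x in lebesgue. u0 x = w0 x"
    by blast
  have w0i: "integrable lborel w0"
    using Lnorm_1_integrable(1)[OF w0ae w0m] m11 by (simp add: memL11_def memLq_def)
  have w0L: "L1b w0" by (rule L1bI[OF w0m w0i w0b])
  have um: "u s \<in> borel_measurable lebesgue" if "s > 0" for s using u1[of s] that by (simp add: memLq_def)
  have ub: "AE x in lebesgue. \<bar>u s x\<bar> \<le> M" if "s > 0" for s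
    using Lnorm_inf_AE[OF M2[OF that]] M by (auto elim!: eventually_mono)
  have "\<exists>\<psi>. \<psi> \<in> borel_measurable borel \<and> (\<forall>x. \<bar>\<psi> x\<bar> \<le> M) \<and> (AE x in lebesgue. u s x = \<psi> x)" if "s > 0" for s
    using borel_representative[OF um[OF that] ub[OF that] M(6)] by blast
  then obtain U where U: "\<And>s. s > 0 \<Longrightarrow> U s \<in> borel_measurable borel" "\<And>s x. s > 0 \<Longrightarrow> \<bar>U s x\<bar> \<le> M"
    "\<And>s. s > 0 \<Longrightarrow> AE x in lebesgue. u s x = U s x" by metis
  have Ui: "integrable lborel (U s)" if "s > 0" for s
    using Lnorm_1_integrable(1)[OF U(3)[OF that] U(1)[OF that]] u1[of s] that by (simp add: memLq_def)
  define Q where "Q = (\<lambda>s y. pw \<kappa> (U s y))"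
  have Qm: "Q s \<in> borel_measurable borel" if "s > 0" for s
    unfolding Q_def using U(1)[OF that] by measurable
  define B where "B = M powr \<kappa> * M"
  have Qb: "\<bar>Q s y\<bar> \<le> B" if "s > 0" for s y
    unfolding Q_def abs_pw B_def using U(2)[OF that] k0 M by (intro mult_mono powr_mono2) auto
  have Qi: "integrable lborel (Q s)" if s: "s > 0" for s
  proof (rule l1_bounded_le(1)[where h="\<lambda>y. M powr \<kappa> * \<bar>U s y\<bar>"])
    show "integrable lborel (\<lambda>y. M powr \<kappa> * \<bar>U s y\<bar>)" using Ui[OF s] by auto
    show "\<bar>Q s y\<bar> \<le> M powr \<kappa> * \<bar>U s y\<bar>" for y
      unfolding Q_def abs_pw using U(2)[OF s] k0 by (intro mult_right_mono powr_mono2) auto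
  qed (rule Qm[OF s])
  have Uc: "(\<lambda>i. l1 (\<lambda>y. U (X i) y - U s y)) \<longlonglongrightarrow> 0" if s: "s > 0" and X: "\<And>i. X i > 0" "X \<longlonglongrightarrow> s" for s X
  proof -
    define h where "h = (\<lambda>r. Lnorm 1 (\<lambda>x. u r x - u s x))"
    have "h s = 0" unfolding h_def using Lnorm_1_eq[of "\<lambda>x. u s x - u s x" "\<lambda>_. 0"] by (simp add: zero_ennreal.rep_eq)
    then have "continuous (at s within {0..}) h"
      using uc[of s] s unfolding continuous_within h_def by simp
    then have "(\<lambda>i. h (X i)) \<longlonglongrightarrow> h s"
      by (rule continuous_within_tendsto_compose[OF _ _ X(2)]) (use X(1) in \<open>auto intro!: always_eventually less_imp_le\<close>)
    moreover have "h r = ereal (l1 (\<lambda>y. U r y - U s y))" if r: "r > 0" for r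
    proof -
      have "AE x in lebesgue. u r x - u s x = U r x - U s x"
        using U(3)[OF r] U(3)[OF s] by eventually_elim simp
      from Lnorm_1_eq[OF this] l1_eq_nn[of "\<lambda>y. U r y - U s y"] Ui[OF r] Ui[OF s]
      show ?thesis by (simp add: h_def enn2ereal_ennreal)
    qed
    ultimately have "(\<lambda>i. ereal (l1 (\<lambda>y. U (X i) y - U s y))) \<longlonglongrightarrow> ereal 0"
      using X \<open>h s = 0\<close> by (simp add: zero_ereal_def)
    then show ?thesis by simp
  qed
  have Qc: "(\<lambda>i. l1 (\<lambda>y. Q (X i) y - Q s y)) \<longlonglongrightarrow> 0" if s: "s > 0" and X: "\<And>i. X i > 0" "X \<longlonglongrightarrow> s" for s X
  proof (rule Lim_null_comparison)
    show "(\<lambda>i. (\<kappa> + 1) * M powr \<kappa> * l1 (\<lambda>y. U (X i) y - U s y)) \<longlonglongrightarrow> 0"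
      using tendsto_mult[OF tendsto_const Uc[OF s X]] by simp
    have "l1 (\<lambda>y. Q (X i) y - Q s y) \<le> (LINT y|lborel. (\<kappa> + 1) * M powr \<kappa> * \<bar>U (X i) y - U s y\<bar>)" for i
    proof (rule l1_bounded_le(2))
      show "integrable lborel (\<lambda>y. (\<kappa> + 1) * M powr \<kappa> * \<bar>U (X i) y - U s y\<bar>)"
        using Ui[OF X(1)] Ui[OF s] by auto
      show "(\<lambda>y. Q (X i) y - Q s y) \<in> borel_measurable borel" using Qm[OF X(1)] Qm[OF s] by simp
      show "\<bar>Q (X i) y - Q s y\<bar> \<le> (\<kappa> + 1) * M powr \<kappa> * \<bar>U (X i) y - U s y\<bar>" for y
        unfolding Q_def by (rule pw_lipschitz[OF k0 U(2)[OF X(1)] U(2)[OF s]])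
    qed
    then show "\<forall>\<^sub>F i in sequentially. norm (l1 (\<lambda>y. Q (X i) y - Q s y)) \<le> (\<kappa> + 1) * M powr \<kappa> * l1 (\<lambda>y. U (X i) y - U s y)"
      by (intro always_eventually) (simp add: l1_def)
  qed
  note dm = duh_measurable[OF Qi Qc, where a=a]
  \<comment> \<open>The value 0 at nonpositive times only completes the definition to a jointly
    Borel function; all later statements concern positive times.\<close>
  define v where "v = (\<lambda>t x. if t > 0 then kconv (heat_kernel t) w0 x + duh a Q t x else 0)"
  have vj: "(\<lambda>p. v (fst p) (snd p)) \<in> borel_measurable (borel \<Otimes>\<^sub>M borel)"
  proof -
    have [measurable]: "(\<lambda>p. duh a Q (fst p) (snd p)) \<in> borel_measurable (borel \<Otimes>\<^sub>M borel)" by (rule dm(1))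
    show ?thesis unfolding v_def kconv_def by measurable
  qed
  have vm: "v t \<in> borel_measurable borel" for t
    using measurable_compose[OF measurable_Pair1'[of t borel borel] vj] by simp
  have vae: "AE x in lebesgue. u t x = v t x" if t: "t > 0" for t
  proof -
    have "heat t u0 x + (LINT s:{0..t}|lborel. dir_grad a (heat (t - s) (\<lambda>y. pw \<kappa> (u s y))) x) = v t x" for x
    proof -
      have dg: "dir_grad a (heat (t - s) (\<lambda>y. pw \<kappa> (u s y))) x = kconv (dheat_kernel a (t - s)) (Q s) x" if s: "0 < s" "s < t" for s
      proof (rule dir_grad_heat_eq[OF _ _ Qi[OF s(1)]])
        show "AE y in lebesgue. pw \<kappa> (u s y) = Q s y" using U(3)[OF s(1)] by eventually_elim (simp add: Q_def)
        show "(\<lambda>y. pw \<kappa> (u s y)) \<in> borel_measurable lebesgue" by (rule measurable_compose[OF um[OF s(1)] pw_measurable])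
      qed (use s in simp)
      have "(LINT s:{0..t}|lborel. dir_grad a (heat (t - s) (\<lambda>y. pw \<kappa> (u s y))) x) = duh a Q t x"
        unfolding duh_def by (rule closed_interval_integral_eq[OF t dg dm(2)])
      then show ?thesis
        using heat_eq_kconv[OF w0ae u0m w0i t, of x] t by (simp only: v_def if_True)
    qed
    with duh[OF t] show ?thesis by simp
  qed
  \<comment> \<open>Continuity in space upgrades the almost everywhere bound by \<open>M\<close> to
    a bound at every point: the set where it holds is closed and has full measure.\<close>
  have cont: "continuous_on UNIV (v t)" if t: "t > 0" for t
  proof -
    define c where "c = kernel_const TYPE('a) * norm a"
    have hc: "continuous_on UNIV (kconv (heat_kernel t) w0)"
      using t heat_kernel_le[OF t] w0i
      by (intro kconv_continuous[where B="t powr (- real DIM('a) / 2)"]) (auto intro!: continuous_intros)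
    have "(\<lambda>i. duh a Q t (X i)) \<longlonglongrightarrow> duh a Q t x" if X: "X \<longlonglongrightarrow> x" for X x
      unfolding duh_def set_lebesgue_integral_def
    proof (rule integral_dominated_convergence[where w="\<lambda>s. indicator {0<..<t} s *\<^sub>R (c * B * (t - s) powr (-(1/2)))"])
      show "integrable lborel (\<lambda>s. indicat_real {0<..<t} s *\<^sub>R (c * B * (t - s) powr (-(1/2))))"
        using set_integrable_mult_right[of "c * B", OF powr_integrable'[of "1/2" t 0]] t
        by (simp add: set_integrable_def)
      show "(\<lambda>s. indicat_real {0<..<t} s *\<^sub>R kconv (dheat_kernel a (t - s)) (Q s) x) \<in> borel_measurable lborel" for x
        using dm(2) by simp
      then show "(\<lambda>s. indicat_real {0<..<t} s *\<^sub>R kconv (dheat_kernel a (t - s)) (Q s) (X i)) \<in> borel_measurable lborel" for i .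
      have "(\<lambda>i. kconv (dheat_kernel a (t - s)) (Q s) (X i)) \<longlonglongrightarrow> kconv (dheat_kernel a (t - s)) (Q s) x" if s: "0 < s" "s < t" for s
      proof -
        have ts: "t - s > 0" using s by simp
        have c: "continuous_on UNIV (kconv (dheat_kernel a (t - s)) (Q s))"
          using s by (intro kconv_continuous[OF _ dheat_kernel_le[OF ts] Qi]) (auto intro!: continuous_intros)
        show ?thesis using continuous_on_tendsto_compose[OF c X] by simp
      qed
      then show "AE s in lborel. (\<lambda>i. indicat_real {0<..<t} s *\<^sub>R kconv (dheat_kernel a (t - s)) (Q s) (X i)) \<longlonglongrightarrow>
          indicat_real {0<..<t} s *\<^sub>R kconv (dheat_kernel a (t - s)) (Q s) x"
        by (intro AE_I2) (auto simp: indicator_def)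
      have "\<bar>kconv (dheat_kernel a (t - s)) (Q s) y\<bar> \<le> c * B * (t - s) powr (-(1/2))" if s: "0 < s" "s < t" for s y
      proof -
        have ts: "t - s > 0" using s by simp
        have "\<bar>kconv (dheat_kernel a (t - s)) (Q s) y\<bar> \<le> l1 (dheat_kernel a (t - s)) * B"
          using Qm[OF s(1)] Qb[OF s(1)] by (intro kconv_le2 L1b_integrable[OF L1b_dheat_kernel[OF ts]]) auto
        also have "\<dots> \<le> (c * (t - s) powr (-1/2)) * B"
          using l1_dheat_kernel[OF ts, of a] M by (intro mult_right_mono) (auto simp: c_def B_def)
        finally show ?thesis by (simp add: mult_ac)
      qed
      then show "AE s in lborel. norm (indicat_real {0<..<t} s *\<^sub>R kconv (dheat_kernel a (t - s)) (Q s) (X i)) \<le>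
          indicator {0<..<t} s *\<^sub>R (c * B * (t - s) powr (-(1/2)))" for i
        by (intro AE_I2) (auto simp: indicator_def)
    qed
    then have "continuous_on UNIV (duh a Q t)" by (auto simp: continuous_on_sequentially o_def)
    from continuous_on_add[OF hc this] show ?thesis using t by (simp add: v_def)
  qed
  have vb: "\<bar>v t x\<bar> \<le> M" if t: "t > 0" for t x
  proof -
    have "closed {x. \<bar>v t x\<bar> \<le> M}" by (intro closed_Collect_le continuous_intros cont[OF t])
    moreover have "AE x in lebesgue. x \<in> {x. \<bar>v t x\<bar> \<le> M}"
      using ub[OF t] vae[OF t] by eventually_elim simp
    ultimately have "x \<in> {x. \<bar>v t x\<bar> \<le> M}" by (rule mem_closed_if_AE_lebesgue)
    then show ?thesis by simp
  qed
  have vi: "integrable lborel (v t)" "l1 (v t) \<le> M" if t: "t > 0" for t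
  proof -
    have "Lnorm 1 (u t) < \<infinity>" using u1[of t] t by (simp add: memLq_def)
    note L = Lnorm_1_integrable[OF vae[OF t] vm this]
    show "integrable lborel (v t)" by (rule L)
    have "ereal (l1 (v t)) \<le> ereal M1" using M1[of t] t L(2) by simp
    then show "l1 (v t) \<le> M" using M by simp
  qed
  have vd: "v t x = kconv (heat_kernel t) w0 x + duh a (\<lambda>s y. pw \<kappa> (v s y)) t x" if t: "t > 0" for t x
  proof -
    \<comment> \<open>For each \<open>s\<close> the versions \<open>U s\<close> and
      \<open>v s\<close> agree off a null set, which the convolution does not see. So
      \<open>v\<close> itself solves the fixed-point equation.\<close>
    have "duh a Q t x = duh a (\<lambda>s y. pw \<kappa> (v s y)) t x"
      unfolding duh_def
    proof (rule set_lebesgue_integral_cong; safe?)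
      fix s assume "s \<in> {0<..<t}"
      then have s: "s > 0" by simp
      have "AE y in lebesgue. Q s y = pw \<kappa> (v s y)"
        using U(3)[OF s] vae[OF s] by eventually_elim (simp add: Q_def)
      then have "AE y in lborel. Q s y = pw \<kappa> (v s y)" by (simp add: AE_completion_iff)
      then show "kconv (dheat_kernel a (t - s)) (Q s) x = kconv (dheat_kernel a (t - s)) (\<lambda>y. pw \<kappa> (v s y)) x"
        using Qm[OF s] vm[of s] by (intro kconv_AE_cong) auto
    qed simp
    then show ?thesis using t by (simp add: v_def)
  qed
  have "mild_solution a \<kappa> M v w0"
    by unfold_locales (fact \<kappa> M(5) vj vi vb w0L moment_integrable[OF m11 w0ae w0m] vd)+
  from that[OF this vae w0ae] show thesis .
qed

theorem theorem2p6:
  fixes a :: "'a::euclidean_space" and u0 :: "'a \<Rightarrow> real" and u :: "real \<Rightarrow> 'a \<Rightarrow> real"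
    and p :: real and f :: "real \<Rightarrow> real"
  assumes "a \<noteq> 0"
    and "p = 1 + 3 / (2 * real DIM('a))"
    and "f = (\<lambda>\<xi>. \<bar>\<xi>\<bar> powr (p - 1) * \<xi>)"
    and "memL11 u0" and "memLq \<infinity> u0"
    and "global_solution a f u0 u"
  shows "\<forall>q::ereal. 1 \<le> q \<longrightarrow> (\<exists>C>0. \<forall>t>4.
           ereal (t powr (real DIM('a) / 2 * (1 - (if q = \<infinity> then 0 else 1 / real_of_ereal q))))
             * Lnorm q (\<lambda>x. u t x - A01 a f u0 t x)
           \<le> ereal (C * t powr (- 1 / 2)))"
proof -
  define \<kappa> where "\<kappa> = p - 1"
  have \<kappa>: "\<kappa> = 3 / (2 * real DIM('a))" using assms(2) by (simp add: \<kappa>_def)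
  have f: "f = pw \<kappa>" unfolding assms(3) by (simp add: pw_def fun_eq_iff \<kappa>_def)
  from mild_representative[OF \<kappa> assms(4,5) assms(6)[unfolded f]] obtain M v w0
    where ms: "mild_solution a \<kappa> M v w0" and vae: "\<And>t. t > 0 \<Longrightarrow> AE x in lebesgue. u t x = v t x"
      and w0ae: "AE x in lebesgue. u0 x = w0 x" by blast
  interpret mild_solution a \<kappa> M v w0 by (rule ms)
  obtain Cv where Cv: "Cv \<ge> 0" "\<And>t. t > 0 \<Longrightarrow> nb t Cv (v t)" by (rule v_nb) blast
  obtain C where C: "C \<ge> 0" "\<And>t. t > 4 \<Longrightarrow> nb t (C * t powr (-1/2)) (\<lambda>x. v t x - A1 t x)"
  proof (rule second_order[OF Cv])
    fix C' assume "0 \<le> C'" "\<And>t. 4 < t \<Longrightarrow> nb t (C' * t powr (-1/2)) (\<lambda>x. v t x - A1 t x)"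
    then show thesis by (rule that)
  qed
  have w0m [measurable]: "w0 \<in> borel_measurable borel" using w0 by auto
  have mass: "mass0 u0 = m0"
  proof -
    have "w0 \<in> borel_measurable lebesgue" by (rule measurable_completion) simp
    moreover have "u0 \<in> borel_measurable lebesgue" using assms(5) by (simp add: memLq_def)
    ultimately have "mass0 u0 = (\<integral>x. w0 x \<partial>lebesgue)"
      unfolding mass0_def using w0ae by (intro integral_cong_AE)
    also have "\<dots> = m0" unfolding m0_def by (rule integral_completion) simp
    finally show ?thesis .
  qed
  \<comment> \<open>The profile has closed form, so the integrands agree at every \<open>s\<close>
    strictly inside the interval and the equality with \<open>A1\<close> holds at every
    point.\<close>
  have A01: "A01 a f u0 t x = A1 t x" if t: "t > 0" for t x
  proof -
    have A0: "A0 u0 s y = a0 s y" for s y by (simp add: A0_def a0_def mass)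
    have "dir_grad a (heat (t - s) (\<lambda>y. f (A0 u0 s y))) x = kconv (dheat_kernel a (t - s)) (g0 s) x" if s: "0 < s" "s < t" for s
    proof (rule dir_grad_heat_eq)
      show i: "integrable lborel (g0 s)" using nbD(2)[OF g0_nb[OF Cv s(1)]] .
      show "AE y in lebesgue. f (A0 u0 s y) = g0 s y" by (simp add: f A0 g0_def)
      show "(\<lambda>y. f (A0 u0 s y)) \<in> borel_measurable lebesgue"
      proof -
        have "g0 s \<in> borel_measurable lebesgue"
          by (rule measurable_completion) (rule borel_measurable_integrable[OF i])
        moreover have "(\<lambda>y. f (A0 u0 s y)) = g0 s" by (simp add: f A0 g0_def fun_eq_iff)
        ultimately show ?thesis by simp
      qed
    qed (use s in simp)
    moreover have "(\<lambda>s. indicator {0<..<t} s *\<^sub>R kconv (dheat_kernel a (t - s)) (g0 s) x) \<in> borel_measurable borel"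
      using measurable_compose[OF measurable_Pair2'[of x borel borel] kconv_dheat_joint_measurable[OF g0_joint, of a t]]
      by simp
    ultimately show ?thesis
      using closed_interval_integral_eq[OF t, of "\<lambda>s. dir_grad a (heat (t - s) (\<lambda>y. f (A0 u0 s y))) x"]
      by (simp add: A01_def A1_def duh_def A0)
  qed
  show ?thesis
  \<comment> \<open>\<open>C\<close> is only known to be nonnegative, whereas the constant of the
    statement is positive; adding 1 covers this, and the choice works for all q at once.\<close>
  proof (intro allI impI exI[of _ "C + 1"] conjI)
    fix q :: ereal and t :: real assume q: "1 \<le> q" and t4: "4 < t"
    have t: "t > 0" using t4 by simp
    note n = C(2)[OF t4]
    have ae: "AE x in lebesgue. u t x - A01 a f u0 t x = v t x - A1 t x"
      using vae[OF t] by eventually_elim (simp add: A01[OF t])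
    have A1m: "A1 t \<in> borel_measurable borel"
      using borel_measurable_diff[OF v_measurable[of t] nbD(1)[OF n]] by simp
    have "u t \<in> borel_measurable lebesgue"
      using assms(6) t by (simp add: global_solution_def memLq_def)
    moreover have "A1 t \<in> borel_measurable lebesgue" by (rule measurable_completion) (use A1m in simp)
    ultimately have "(\<lambda>x. u t x - A01 a f u0 t x) \<in> borel_measurable lebesgue"
      unfolding A01[OF t] by (rule borel_measurable_diff)
    from Lnorm_le_nb[OF n ae this t q]
    have "ereal (t powr (real DIM('a) / 2 * (1 - (if q = \<infinity> then 0 else 1 / real_of_ereal q)))) * Lnorm q (\<lambda>x. u t x - A01 a f u0 t x)
      \<le> ereal (C * t powr (-1/2))" .
    also have "\<dots> \<le> ereal ((C + 1) * t powr (-1/2))" by (simp add: mult_right_mono)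
    finally show "ereal (t powr (real DIM('a) / 2 * (1 - (if q = \<infinity> then 0 else 1 / real_of_ereal q)))) * Lnorm q (\<lambda>x. u t x - A01 a f u0 t x)
      \<le> ereal ((C + 1) * t powr (-1/2))" .
  qed (use C in simp)
qed

end
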